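(* Let $q$ be a real sequence with $q\in\ell^1_2(\mathbb{Z})$, let $H=-\Delta_L+q$ on $\ell^2(\mathbb{Z})$, $(Hu)_n=-(u_{n+1}-2u_n+u_{n-1})+q_nu_n$, and let $P_c$ be the orthogonal projection onto the continuous spectral subspace of $H$. Assume neither $\omega=0$ nor $\omega=4$ is a resonance of $H$. Then for every $\sigma>3/2$, $$\|\mathrm{e}^{-\mathrm{i}tH}P_c\|_{\ell^2_\sigma\to\ell^2_{-\sigma}}=\mathcal{O}(t^{-3/2}),\quad t\to\infty.$$
   Context: $\ell^2_\sigma$ is the weighted space with norm $\big(\sum_n(1+|n|)^{2\sigma}|u(n)|^2\big)^{1/2}$; $\ell^1_2$ is the space of sequences with $\sum_n(1+|n|)^2|q_n|<\infty$. For $\omega\in\{0,4\}$, $\omega$ is a resonance of $H$ if $Hu=\omega u$ has a nonzero bounded solution $u\in\ell^\infty(\mathbb{Z})$. *)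

theory Defs
  imports "HOL-Analysis.Analysis"
begin

definition Hop :: "(int \<Rightarrow> real) \<Rightarrow> (int \<Rightarrow> complex) \<Rightarrow> (int \<Rightarrow> complex)" where
  "Hop q u = (\<lambda>n. - (u (n + 1) - 2 * u n + u (n - 1)) + complex_of_real (q n) * u n)"

definition in_l2w :: "real \<Rightarrow> (int \<Rightarrow> complex) \<Rightarrow> bool" where
  "in_l2w \<sigma> u \<longleftrightarrow> (\<lambda>n. (1 + \<bar>real_of_int n\<bar>) powr (2 * \<sigma>) * (cmod (u n))\<^sup>2) summable_on UNIV"

definition wnorm :: "real \<Rightarrow> (int \<Rightarrow> complex) \<Rightarrow> real" where
  "wnorm \<sigma> u = sqrt (\<Sum>\<^sub>\<infinity>n\<in>UNIV. (1 + \<bar>real_of_int n\<bar>) powr (2 * \<sigma>) * (cmod (u n))\<^sup>2)"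

abbreviation l2 :: "(int \<Rightarrow> complex) \<Rightarrow> bool" where "l2 u \<equiv> in_l2w 0 u"

definition l2inner :: "(int \<Rightarrow> complex) \<Rightarrow> (int \<Rightarrow> complex) \<Rightarrow> complex" where
  "l2inner u v = (\<Sum>\<^sub>\<infinity>n\<in>UNIV. u n * cnj (v n))"

definition eigvec :: "(int \<Rightarrow> real) \<Rightarrow> (int \<Rightarrow> complex) \<Rightarrow> bool" where
  "eigvec q \<phi> \<longleftrightarrow> l2 \<phi> \<and> \<phi> \<noteq> (\<lambda>_. 0) \<and> (\<exists>ev. Hop q \<phi> = (\<lambda>n. ev * \<phi> n))"

definition pp_space :: "(int \<Rightarrow> real) \<Rightarrow> (int \<Rightarrow> complex) set" where
  "pp_space q = {w. l2 w \<and> (\<forall>e>0. \<exists>(m::nat) c \<phi>. (\<forall>j<m. eigvec q (\<phi> j)) \<and>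
       wnorm 0 (\<lambda>n. w n - (\<Sum>j<m. c j * \<phi> j n)) < e)}"

text \<open>P_c: orthogonal projection onto the continuous spectral subspace (the orthogonal
  complement of the point spectral subspace): P_c u is the component of u orthogonal to
  all eigenvectors, with u - P_c u in the point spectral subspace.\<close>
definition Pc :: "(int \<Rightarrow> real) \<Rightarrow> (int \<Rightarrow> complex) \<Rightarrow> (int \<Rightarrow> complex)" where
  "Pc q u = (THE v. l2 v \<and> (\<forall>\<phi>. eigvec q \<phi> \<longrightarrow> l2inner v \<phi> = 0) \<and>
                    (\<lambda>n. u n - v n) \<in> pp_space q)"

text \<open>e^{-itH} u, via the exponential series (H is bounded on l^2), evaluated pointwise.\<close>
definition evol :: "(int \<Rightarrow> real) \<Rightarrow> real \<Rightarrow> (int \<Rightarrow> complex) \<Rightarrow> (int \<Rightarrow> complex)" where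
  "evol q t u = (\<lambda>n. \<Sum>k. ((- \<i> * complex_of_real t) ^ k / of_nat (fact k)) * ((Hop q ^^ k) u) n)"

definition resonance :: "(int \<Rightarrow> real) \<Rightarrow> real \<Rightarrow> bool" where
  "resonance q \<omega> \<longleftrightarrow> (\<exists>u. u \<noteq> (\<lambda>_. 0) \<and> bounded (range u) \<and>
      Hop q u = (\<lambda>n. complex_of_real \<omega> * u n))"

end

theory Submission
  imports Defs "HOL-Complex_Analysis.Complex_Analysis"
begin

text \<open>
  With \<open>\<omega> = 2 - z - 1 / z\<close> and \<open>z = exp (\<i> * \<theta>)\<close>, let \<open>f\<^sub>\<plusminus> n = z ^ (\<plusminus> n) * h\<^sub>\<plusminus> n\<close> be the Jost solutions. The factors
  \<open>h\<^sub>\<plusminus>\<close> are power series in \<open>z\<close>; a Gronwall argument on the Volterra recursion for their coefficients \<open>a k\<close>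
  bounds \<open>\<Sum>k. k * \<bar>a k\<bar>\<close> and \<open>sup k. k\<^sup>2 * \<bar>a k\<bar>\<close> with the right growth in \<open>n\<close>. The Wronskian \<open>W\<close> has no zero
  on the unit circle (at \<open>z = \<plusminus>1\<close> by non-resonance) and finitely many, real and simple ones inside, so the
  residue theorem represents \<open>exp (-\<i> t H) P\<^sub>c\<close> by the kernel
  \<open>1 / (2 \<pi>) * \<integral> exp (-\<i> t \<omega>) * 2 \<i> sin \<theta> * F d\<theta>\<close> with \<open>F = f\<^sub>- (min n m) * f\<^sub>+ (max n m) / W\<close>.

  One integration by parts gains \<open>1 / t\<close> and leaves the amplitude \<open>dF / d\<theta>\<close>. There \<open>f\<^sub>\<plusminus>\<close> and \<open>dW / d\<theta>\<close> are
  expanded into Fourier modes while \<open>1 / W\<close> and \<open>1 / W\<^sup>2\<close> are kept as \<open>C\<^sup>1\<close> amplitudes, which avoids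
  Wiener's lemma: modes of order below \<open>t\<close> contribute \<open>t powr (- 1 / 2)\<close> by a van der Corput estimate, and the
  remaining ones do so by orthogonality, because their coefficients are \<open>O (1 / k)\<close>. This needs
  \<open>\<bar>n\<bar>, \<bar>m\<bar> \<le> t / 4\<close>; elsewhere the weights and the unitarity of the evolution suffice, as \<open>\<sigma> \<ge> 3 / 2\<close>.
\<close>

text \<open>The two weights on \<open>q\<close> dictate the shape of the argument. They give the
  Jost coefficients a summable first moment but only a pointwise bound on the second, so one
  integration by parts is available and a second one must be replaced by an oscillatory estimate.
  The first divides by nothing that vanishes, because the factor \<open>sin \<theta>\<close> of the
  kernel is the derivative of the phase.

  The price is growth of the kernel like \<open>(1 + \<bar>n\<bar>) * (1 + \<bar>m\<bar>)\<close>.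
  Squared against the weights this requires
  \<open>(1 + \<bar>n\<bar>) powr (2 - 2 * \<sigma>)\<close> to be summable, which is \<sigma> > 3/2
  exactly.

  The projection is represented by the identity plus finitely many rank one terms. Orthogonality of
  its values to all eigenvectors is deduced from the decay itself. This replaces an enumeration of
  the eigenvectors and an exclusion of embedded eigenvalues.\<close>

abbreviation (input) wt :: "int \<Rightarrow> real" where
  "wt n \<equiv> 1 + \<bar>real_of_int n\<bar>"

abbreviation (input) phase :: "real \<Rightarrow> real \<Rightarrow> complex" where
  "phase t \<equiv> (\<lambda>x. exp (- \<i> * of_real t * of_real x))"


subsection \<open>The Hilbert space of square summable sequences\<close>

lemma weight_pos: "1 + \<bar>real_of_int n\<bar> > 0"
  by simp

lemma l2_iff: "l2 u \<longleftrightarrow> (\<lambda>n. (cmod (u n))\<^sup>2) summable_on UNIV"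
  using weight_pos by (simp add: in_l2w_def powr_def add_nonneg_eq_0_iff)

lemma wnorm_0: "wnorm 0 u = sqrt (\<Sum>\<^sub>\<infinity>n. (cmod (u n))\<^sup>2)"
  using weight_pos by (simp add: wnorm_def powr_def add_nonneg_eq_0_iff)

lemma wnorm_nonneg: "wnorm s u \<ge> 0"
  by (auto simp: wnorm_def intro!: infsum_nonneg)

lemma wnorm_0_sq: "(wnorm 0 u)\<^sup>2 = (\<Sum>\<^sub>\<infinity>n. (cmod (u n))\<^sup>2)"
  by (auto simp: wnorm_0 intro!: infsum_nonneg)

lemma L2_set_le_wnorm:
  assumes "l2 u" "finite F"
  shows "L2_set (\<lambda>n. cmod (u n)) F \<le> wnorm 0 u"
  unfolding L2_set_def wnorm_0
  using assms by (intro real_sqrt_le_mono finite_sum_le_infsum) (auto simp: l2_iff)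

lemma cmod_le_wnorm_0: "l2 u \<Longrightarrow> cmod (u n) \<le> wnorm 0 u"
  using L2_set_le_wnorm[of u "{n}"] by simp

text \<open>\<open>l2\<close> is a predicate on functions, not a type, so norm inequalities are
  imported from \<open>L2_set\<close>: a bound uniform over finite sets of sites gives both
  membership and the norm bound.\<close>

lemma l2I_L2_set:
  assumes "\<And>F. finite F \<Longrightarrow> L2_set (\<lambda>n. cmod (u n)) F \<le> b"
  shows "l2 u" "wnorm 0 u \<le> b"
proof -
  have b: "b \<ge> 0" using assms[of "{}"] by simp
  have le: "(\<Sum>n\<in>F. (cmod (u n))\<^sup>2) \<le> b\<^sup>2" if "finite F" for F
  proof -
    have "(L2_set (\<lambda>n. cmod (u n)) F)\<^sup>2 \<le> b\<^sup>2"
      by (intro power_mono assms that) auto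
    thus ?thesis by (simp add: L2_set_def sum_nonneg)
  qed
  show l: "l2 u" unfolding l2_iff
    by (rule nonneg_bdd_above_summable_on) (auto intro!: bdd_aboveI2[where M="b\<^sup>2"] le)
  have "(\<Sum>\<^sub>\<infinity>n. (cmod (u n))\<^sup>2) \<le> b\<^sup>2"
    using l le by (intro infsum_le_finite_sums) (auto simp: l2_iff)
  thus "wnorm 0 u \<le> b"
    unfolding wnorm_0 using b by (simp add: real_le_lsqrt infsum_nonneg)
qed

lemma l2_mult:
  assumes "l2 u" "l2 v"
  shows "(\<lambda>n. cmod (u n) * cmod (v n)) summable_on UNIV"
    and "(\<Sum>\<^sub>\<infinity>n. cmod (u n) * cmod (v n)) \<le> wnorm 0 u * wnorm 0 v"
proof -
  have le: "(\<Sum>n\<in>F. cmod (u n) * cmod (v n)) \<le> wnorm 0 u * wnorm 0 v" if "finite F" for F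
  proof -
    have "(\<Sum>n\<in>F. cmod (u n) * cmod (v n)) \<le> L2_set (\<lambda>n. cmod (u n)) F * L2_set (\<lambda>n. cmod (v n)) F"
      using L2_set_mult_ineq[of "\<lambda>n. cmod (u n)" "\<lambda>n. cmod (v n)" F] by simp
    also have "\<dots> \<le> wnorm 0 u * wnorm 0 v"
      by (intro mult_mono L2_set_le_wnorm assms that wnorm_nonneg) auto
    finally show ?thesis .
  qed
  show s: "(\<lambda>n. cmod (u n) * cmod (v n)) summable_on UNIV"
    by (rule nonneg_bdd_above_summable_on) (auto intro!: bdd_aboveI2 le)
  show "(\<Sum>\<^sub>\<infinity>n. cmod (u n) * cmod (v n)) \<le> wnorm 0 u * wnorm 0 v"
    by (intro infsum_le_finite_sums s le)
qed

lemma l2inner_abs_summable: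
  assumes "l2 u" "l2 v"
  shows "(\<lambda>n. norm (u n * cnj (v n))) summable_on UNIV"
  using l2_mult(1)[OF assms] by (simp add: norm_mult)

lemma l2inner_summable: "l2 u \<Longrightarrow> l2 v \<Longrightarrow> (\<lambda>n. u n * cnj (v n)) summable_on UNIV"
  by (rule abs_summable_summable[OF l2inner_abs_summable])

lemma l2inner_bound:
  assumes "l2 u" "l2 v"
  shows "cmod (l2inner u v) \<le> wnorm 0 u * wnorm 0 v"
proof -
  have "cmod (l2inner u v) \<le> (\<Sum>\<^sub>\<infinity>n. cmod (u n * cnj (v n)))"
    unfolding l2inner_def by (rule norm_infsum_bound[OF l2inner_abs_summable[OF assms]])
  also have "\<dots> \<le> wnorm 0 u * wnorm 0 v"
    using l2_mult(2)[OF assms] by (simp add: norm_mult)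
  finally show ?thesis .
qed

lemma l2_add:
  assumes "l2 u" "l2 v"
  shows "l2 (\<lambda>n. u n + v n)" "wnorm 0 (\<lambda>n. u n + v n) \<le> wnorm 0 u + wnorm 0 v"
proof -
  have "L2_set (\<lambda>n. cmod (u n + v n)) F \<le> wnorm 0 u + wnorm 0 v" if "finite F" for F
  proof -
    have "L2_set (\<lambda>n. cmod (u n + v n)) F \<le> L2_set (\<lambda>n. cmod (u n) + cmod (v n)) F"
      by (intro L2_set_mono norm_triangle_ineq) auto
    also have "\<dots> \<le> L2_set (\<lambda>n. cmod (u n)) F + L2_set (\<lambda>n. cmod (v n)) F"
      by (rule L2_set_triangle_ineq)
    also have "\<dots> \<le> wnorm 0 u + wnorm 0 v"
      by (intro add_mono L2_set_le_wnorm assms that)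
    finally show ?thesis .
  qed
  thus "l2 (\<lambda>n. u n + v n)" "wnorm 0 (\<lambda>n. u n + v n) \<le> wnorm 0 u + wnorm 0 v"
    using l2I_L2_set[of "\<lambda>n. u n + v n"] by blast+
qed

lemma l2_mono:
  assumes "l2 v" "c \<ge> 0" "\<And>n. cmod (u n) \<le> c * cmod (v n)"
  shows "l2 u" "wnorm 0 u \<le> c * wnorm 0 v"
proof -
  have "L2_set (\<lambda>n. cmod (u n)) F \<le> c * wnorm 0 v" if "finite F" for F
  proof -
    have "L2_set (\<lambda>n. cmod (u n)) F \<le> L2_set (\<lambda>n. c * cmod (v n)) F"
      by (intro L2_set_mono assms) auto
    also have "\<dots> = c * L2_set (\<lambda>n. cmod (v n)) F"
      using assms(2) by (simp add: L2_set_right_distrib)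
    also have "\<dots> \<le> c * wnorm 0 v"
      by (intro mult_left_mono L2_set_le_wnorm assms that)
    finally show ?thesis .
  qed
  thus "l2 u" "wnorm 0 u \<le> c * wnorm 0 v"
    using l2I_L2_set[of u] by blast+
qed

lemma l2_cmult: 
  assumes "l2 u"
  shows "l2 (\<lambda>n. c * u n)" "wnorm 0 (\<lambda>n. c * u n) \<le> cmod c * wnorm 0 u"
  using l2_mono[OF assms, of "cmod c" "\<lambda>n. c * u n"] by (auto simp: norm_mult)

lemma l2_diff:
  assumes "l2 u" "l2 v"
  shows "l2 (\<lambda>n. u n - v n)" "wnorm 0 (\<lambda>n. u n - v n) \<le> wnorm 0 u + wnorm 0 v"
proof -
  have m: "l2 (\<lambda>n. - v n)" "wnorm 0 (\<lambda>n. - v n) \<le> wnorm 0 v"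
    using l2_mono[OF assms(2), of 1 "\<lambda>n. - v n"] by auto
  show "l2 (\<lambda>n. u n - v n)" "wnorm 0 (\<lambda>n. u n - v n) \<le> wnorm 0 u + wnorm 0 v"
    using l2_add[OF assms(1) m(1)] m(2) by auto
qed

lemma l2_zero: "l2 (\<lambda>_. 0)" "wnorm 0 (\<lambda>_. 0) = 0"
  by (simp_all add: l2_iff wnorm_0)

lemma l2_sum: 
  assumes "finite A" "\<And>j. j \<in> A \<Longrightarrow> l2 (f j)"
  shows "l2 (\<lambda>n. \<Sum>j\<in>A. f j n) \<and> wnorm 0 (\<lambda>n. \<Sum>j\<in>A. f j n) \<le> (\<Sum>j\<in>A. wnorm 0 (f j))"
  using assms
proof (induction rule: finite_induct)
  case empty
  then show ?case by (simp add: l2_zero)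
next
  case (insert a A)
  have "l2 (f a)" "l2 (\<lambda>n. \<Sum>j\<in>A. f j n)" using insert by auto
  from l2_add[OF this] insert show ?case by auto
qed

lemma l2_shift: 
  assumes "l2 u"
  shows "l2 (\<lambda>n. u (n + a))" "wnorm 0 (\<lambda>n. u (n + a)) = wnorm 0 u"
proof -
  have b: "bij_betw (\<lambda>n. n + a) UNIV (UNIV :: int set)"
    by (rule bij_betwI[where g="\<lambda>n. n - a"]) auto
  show "l2 (\<lambda>n. u (n + a))"
    using assms summable_on_reindex_bij_betw[OF b, of "\<lambda>n. (cmod (u n))\<^sup>2"] by (simp add: l2_iff)
  show "wnorm 0 (\<lambda>n. u (n + a)) = wnorm 0 u"
    using infsum_reindex_bij_betw[OF b, of "\<lambda>n. (cmod (u n))\<^sup>2"] by (simp add: wnorm_0)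
qed

lemma l2inner_shift: "l2inner (\<lambda>n. u (n + a)) v = l2inner u (\<lambda>n. v (n - a))"
proof -
  have b: "bij_betw (\<lambda>n. n + a) UNIV (UNIV :: int set)"
    by (rule bij_betwI[where g="\<lambda>n. n - a"]) auto
  show ?thesis
    using infsum_reindex_bij_betw[OF b, of "\<lambda>n. u n * cnj (v (n - a))"] by (simp add: l2inner_def)
qed

lemma l2inner_commute: "l2inner v u = cnj (l2inner u v)"
  by (simp add: l2inner_def mult.commute flip: infsum_cnj)

lemma l2inner_add_left:
  assumes "l2 u" "l2 v" "l2 w"
  shows "l2inner (\<lambda>n. u n + v n) w = l2inner u w + l2inner v w"
  unfolding l2inner_def using assms
  by (simp add: ring_distribs infsum_add l2inner_summable)

lemma l2inner_diff_left:
  assumes "l2 u" "l2 v" "l2 w"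
  shows "l2inner (\<lambda>n. u n - v n) w = l2inner u w - l2inner v w"
  using l2inner_add_left[OF l2_diff(1)[OF assms(1,2)] assms(2,3)] by simp

lemma l2inner_diff_right:
  assumes "l2 u" "l2 v" "l2 w"
  shows "l2inner w (\<lambda>n. u n - v n) = l2inner w u - l2inner w v"
  using l2inner_diff_left[OF assms] l2inner_commute by (metis complex_cnj_diff)

lemma l2inner_add_right:
  assumes "l2 u" "l2 v" "l2 w"
  shows "l2inner w (\<lambda>n. u n + v n) = l2inner w u + l2inner w v"
  using l2inner_add_left[OF assms] l2inner_commute by (metis complex_cnj_add)

lemma l2inner_cmult_left: "l2inner (\<lambda>n. c * u n) w = c * l2inner u w"
  unfolding l2inner_def by (simp add: mult.assoc infsum_cmult_right')

lemma l2inner_sum_left: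
  assumes "finite A" "\<And>j. j \<in> A \<Longrightarrow> l2 (f j)" "l2 w"
  shows "l2inner (\<lambda>n. \<Sum>j\<in>A. f j n) w = (\<Sum>j\<in>A. l2inner (f j) w)"
  using assms
proof (induction rule: finite_induct)
  case empty
  then show ?case by (simp add: l2inner_def)
next
  case (insert a A)
  have "l2 (f a)" "l2 (\<lambda>n. \<Sum>j\<in>A. f j n)" using insert l2_sum by auto
  from l2inner_add_left[OF this] insert show ?case by auto
qed

lemma l2inner_self: "l2 u \<Longrightarrow> l2inner u u = of_real ((wnorm 0 u)\<^sup>2)"
proof -
  assume "l2 u"
  hence "((\<lambda>n. complex_of_real ((cmod (u n))\<^sup>2)) has_sum of_real ((wnorm 0 u)\<^sup>2)) UNIV"
    unfolding wnorm_0_sq l2_iff by (intro has_sum_of_real) auto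
  thus ?thesis
    unfolding l2inner_def by (intro infsumI) (simp add: complex_norm_square del: of_real_power)
qed

lemma wnorm_0_eq_0: 
  assumes "l2 u" "wnorm 0 u = 0"
  shows "u n = 0"
  using cmod_le_wnorm_0[OF assms(1), of n] assms(2) by simp

subsection \<open>The operator on square summable sequences\<close>

lemma Hop_l2:
  assumes "l2 u" "\<And>n. \<bar>q n\<bar> \<le> Q"
  shows "l2 (Hop q u)" "wnorm 0 (Hop q u) \<le> (4 + Q) * wnorm 0 u"
proof -
  have Q: "Q \<ge> 0" using assms(2)[of 0] by linarith
  have 1: "l2 (\<lambda>n. (2 + complex_of_real (q n)) * u n)" 
       "wnorm 0 (\<lambda>n. (2 + complex_of_real (q n)) * u n) \<le> (2 + Q) * wnorm 0 u"
  proof -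
    have "cmod ((2 + complex_of_real (q n)) * u n) \<le> (2 + Q) * cmod (u n)" for n
    proof -
      have "cmod (2 + complex_of_real (q n)) \<le> 2 + Q"
        using norm_triangle_ineq[of 2 "complex_of_real (q n)"] assms(2)[of n] by simp
      thus ?thesis by (simp add: norm_mult mult_right_mono)
    qed
    thus "l2 (\<lambda>n. (2 + complex_of_real (q n)) * u n)" 
       "wnorm 0 (\<lambda>n. (2 + complex_of_real (q n)) * u n) \<le> (2 + Q) * wnorm 0 u"
      using l2_mono[OF assms(1), of "2 + Q"] Q by auto
  qed
  have 2: "l2 (\<lambda>n. u (n + 1) + u (n - 1))" "wnorm 0 (\<lambda>n. u (n + 1) + u (n - 1)) \<le> 2 * wnorm 0 u"
    using l2_add[OF l2_shift(1)[OF assms(1), of 1] l2_shift(1)[OF assms(1), of "-1"]]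
      l2_shift(2)[OF assms(1), of 1] l2_shift(2)[OF assms(1), of "-1"] by auto
  have eq: "Hop q u = (\<lambda>n. (2 + complex_of_real (q n)) * u n - (u (n + 1) + u (n - 1)))"
    by (auto simp: Hop_def algebra_simps)
  show "l2 (Hop q u)" "wnorm 0 (Hop q u) \<le> (4 + Q) * wnorm 0 u"
    using l2_diff[OF 1(1) 2(1)] 1(2) 2(2) unfolding eq by (auto simp: algebra_simps)
qed

lemma Hop_symmetric:
  assumes "l2 u" "l2 v" "\<And>n. \<bar>q n\<bar> \<le> Q"
  shows "l2inner (Hop q u) v = l2inner u (Hop q v)"
proof -
  have s: "l2 (\<lambda>n. u (n + 1))" "l2 (\<lambda>n. u (n - 1))" "l2 (\<lambda>n. v (n + 1))" "l2 (\<lambda>n. v (n - 1))"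
    using assms l2_shift(1)[of _ 1] l2_shift(1)[of _ "-1"] by auto
  define M where "M w = (\<lambda>n. (2 + complex_of_real (q n)) * w n)" for w
  have eq: "Hop q w = (\<lambda>n. M w n - (w (n + 1) + w (n - 1)))" for w
    by (auto simp: Hop_def M_def algebra_simps)
  have M: "l2 (M w)" if "l2 w" for w
  proof -
    have "M w = (\<lambda>n. Hop q w n + (w (n + 1) + w (n - 1)))" by (auto simp: eq)
    thus ?thesis
      using that Hop_l2(1)[OF that assms(3)] l2_shift(1)[OF that, of 1] l2_shift(1)[OF that, of "-1"]
      by (auto intro!: l2_add)
  qed
  have 1: "l2inner (M u) v = l2inner u (M v)"
    unfolding l2inner_def M_def by (intro infsum_cong) (auto simp: algebra_simps)
  have 2: "l2inner (\<lambda>n. u (n + 1)) v = l2inner u (\<lambda>n. v (n - 1))"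
    "l2inner (\<lambda>n. u (n - 1)) v = l2inner u (\<lambda>n. v (n + 1))"
    using l2inner_shift[of u 1 v] l2inner_shift[of u "-1" v] by auto
  have R: "l2inner u (\<lambda>n. M v n - (v (n + 1) + v (n - 1))) =
      l2inner u (M v) - (l2inner u (\<lambda>n. v (n + 1)) + l2inner u (\<lambda>n. v (n - 1)))"
    using s M[OF assms(2)] assms(1) by (simp add: l2inner_diff_right l2inner_add_right l2_add)
  show ?thesis
    unfolding eq R using s M assms 1 2 
    by (simp add: l2inner_diff_left l2inner_add_left l2_add)
qed

lemma Hop_pow_l2:
  assumes "l2 u" "\<And>n. \<bar>q n\<bar> \<le> Q"
  shows "l2 ((Hop q ^^ k) u) \<and> wnorm 0 ((Hop q ^^ k) u) \<le> (4 + Q) ^ k * wnorm 0 u"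
proof (induction k)
  case 0
  then show ?case using assms by simp
next
  case (Suc k)
  have Q: "Q \<ge> 0" using assms(2)[of 0] by linarith
  have "wnorm 0 (Hop q ((Hop q ^^ k) u)) \<le> (4 + Q) * wnorm 0 ((Hop q ^^ k) u)"
    by (rule Hop_l2) (use Suc assms in auto)
  also have "\<dots> \<le> (4 + Q) * ((4 + Q) ^ k * wnorm 0 u)"
    using Suc Q by (intro mult_left_mono) auto
  finally show ?case using Hop_l2(1)[of "(Hop q ^^ k) u"] Suc assms(2) by auto
qed

lemma Hop_pow_symmetric:
  assumes "l2 u" "l2 v" "\<And>n. \<bar>q n\<bar> \<le> Q"
  shows "l2inner ((Hop q ^^ k) u) v = l2inner u ((Hop q ^^ k) v)"
  using assms(1,2)
proof (induction k arbitrary: v)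
  case (Suc k)
  have "l2inner ((Hop q ^^ Suc k) u) v = l2inner ((Hop q ^^ k) u) (Hop q v)"
    using Hop_symmetric[of "(Hop q ^^ k) u" v q Q] Hop_pow_l2[OF assms(1,3)] Suc assms(3) by simp
  also have "\<dots> = l2inner u ((Hop q ^^ k) (Hop q v))"
    using Suc Hop_l2(1)[OF Suc.prems(2) assms(3)] by simp
  finally show ?case by (simp add: funpow_swap1)
qed simp

lemma eigvec_Hop_pow:
  assumes "Hop q \<phi> = (\<lambda>n. ev * \<phi> n)"
  shows "(Hop q ^^ k) \<phi> = (\<lambda>n. ev ^ k * \<phi> n)"
proof (induction k)
  case (Suc k)
  have "(Hop q ^^ Suc k) \<phi> = Hop q (\<lambda>n. ev ^ k * \<phi> n)" using Suc by simp
  also have "\<dots> = (\<lambda>n. ev ^ k * Hop q \<phi> n)" by (auto simp: Hop_def algebra_simps)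
  finally show ?case using assms by (simp add: algebra_simps)
qed simp

lemma eigenvalue_real:
  assumes "l2 \<phi>" "\<phi> \<noteq> (\<lambda>_. 0)" "Hop q \<phi> = (\<lambda>n. ev * \<phi> n)" "\<And>n. \<bar>q n\<bar> \<le> Q"
  shows "cnj ev = ev"
proof -
  have "ev * l2inner \<phi> \<phi> = cnj ev * l2inner \<phi> \<phi>"
  proof -
    have "l2inner (\<lambda>n. ev * \<phi> n) \<phi> = l2inner \<phi> (\<lambda>n. ev * \<phi> n)"
      using Hop_symmetric[of \<phi> \<phi> q Q] assms by simp
    also have "\<dots> = cnj (l2inner (\<lambda>n. ev * \<phi> n) \<phi>)" by (rule l2inner_commute)
    finally show ?thesis
      using l2inner_commute[of \<phi> \<phi>] by (simp add: l2inner_cmult_left)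
  qed
  moreover have "wnorm 0 \<phi> \<noteq> 0" using wnorm_0_eq_0[OF assms(1)] assms(2) by auto
  ultimately show ?thesis using assms(1) by (simp add: l2inner_self)
qed

subsection \<open>The unitary group\<close>

text \<open>Completeness, in the form of a pointwise series with a summable majorant of the norms.
  The bound on finite sets of sites holds for partial sums and passes to the pointwise
  limit.\<close>

lemma l2_series:
  fixes x :: "nat \<Rightarrow> int \<Rightarrow> complex"
  assumes x: "\<And>k. l2 (x k)" "\<And>k. wnorm 0 (x k) \<le> b k" "summable b"
  shows "summable (\<lambda>k. norm (x k n))"
    and "l2 (\<lambda>n. \<Sum>k. x k n)" and "wnorm 0 (\<lambda>n. \<Sum>k. x k n) \<le> suminf b"
proof -
  have b0: "b k \<ge> 0" for k
    using x(2)[of k] wnorm_nonneg[of 0] order_trans by blast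
  show sm: "summable (\<lambda>k. norm (x k n))" for n
  proof (rule summable_comparison_test[OF _ x(3)], intro exI[of _ 0] allI impI)
    show "norm (cmod (x k n)) \<le> b k" for k
      using order_trans[OF cmod_le_wnorm_0[OF x(1)] x(2)] by simp
  qed
  have "L2_set (\<lambda>n. cmod (\<Sum>k. x k n)) F \<le> suminf b" if F: "finite F" for F
  proof (rule LIMSEQ_le_const2)
    show "(\<lambda>K. L2_set (\<lambda>n. cmod (\<Sum>k<K. x k n)) F) \<longlonglongrightarrow> L2_set (\<lambda>n. cmod (\<Sum>k. x k n)) F"
      unfolding L2_set_def using summable_LIMSEQ[OF summable_norm_cancel[OF sm]]
      by (intro tendsto_intros) auto
    have "L2_set (\<lambda>n. cmod (\<Sum>k<K. x k n)) F \<le> suminf b" for K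
    proof -
      note S = l2_sum[of "{..<K}" x, OF _ x(1)]
      have "L2_set (\<lambda>n. cmod (\<Sum>k<K. x k n)) F \<le> wnorm 0 (\<lambda>n. \<Sum>k<K. x k n)"
        by (rule L2_set_le_wnorm) (use S F in auto)
      also have "\<dots> \<le> (\<Sum>k<K. wnorm 0 (x k))" using S by auto
      also have "\<dots> \<le> (\<Sum>k<K. b k)" by (intro sum_mono x)
      also have "\<dots> \<le> suminf b" by (intro sum_le_suminf x) (use b0 in auto)
      finally show ?thesis .
    qed
    thus "\<exists>N. \<forall>n\<ge>N. L2_set (\<lambda>na. cmod (\<Sum>k<n. x k na)) F \<le> suminf b" by blast
  qed
  thus "l2 (\<lambda>n. \<Sum>k. x k n)" "wnorm 0 (\<lambda>n. \<Sum>k. x k n) \<le> suminf b"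
    using l2I_L2_set[of "\<lambda>n. \<Sum>k. x k n" "suminf b"] by auto
qed

text \<open>The remainder of the pointwise series is again such a series, so its norm is at most the
  tail of \<open>b\<close>.\<close>

lemma l2inner_series:
  fixes x :: "nat \<Rightarrow> int \<Rightarrow> complex"
  assumes x: "\<And>k. l2 (x k)" "\<And>k. wnorm 0 (x k) \<le> b k" "summable b" and y: "l2 y"
  shows "(\<lambda>k. l2inner (x k) y) sums l2inner (\<lambda>n. \<Sum>k. x k n) y"
proof -
  define X where "X = (\<lambda>n. \<Sum>k. x k n)"
  have sm: "summable (\<lambda>k. x k n)" for n
    by (rule summable_norm_cancel[OF l2_series(1)[OF x]])
  have X: "l2 X" unfolding X_def by (rule l2_series[OF x])
  have le: "norm ((\<Sum>k<K. l2inner (x k) y) - l2inner X y) \<le> (\<Sum>k. b (k + K)) * wnorm 0 y" for K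
  proof -
    have b': "summable (\<lambda>k. b (k + K))" using x(3) by (rule summable_ignore_initial_segment)
    have tail: "X n - (\<Sum>k<K. x k n) = (\<Sum>k. x (k + K) n)" for n
      unfolding X_def using suminf_split_initial_segment[OF sm, of n K] by simp
    have S: "l2 (\<lambda>n. \<Sum>k<K. x k n)" using l2_sum[of "{..<K}" x, OF _ x(1)] by auto
    have "l2inner X y - (\<Sum>k<K. l2inner (x k) y) = l2inner (\<lambda>n. X n - (\<Sum>k<K. x k n)) y"
      using l2inner_diff_left[OF X S y] l2inner_sum_left[of "{..<K}" x, OF _ x(1) y] by simp
    also have "cmod \<dots> \<le> (\<Sum>k. b (k + K)) * wnorm 0 y"
      unfolding tail using l2_series[OF x(1) x(2) b'] y wnorm_nonneg[of 0 y]
      by (intro order_trans[OF l2inner_bound] mult_right_mono) auto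
    finally show ?thesis by (simp add: norm_minus_commute)
  qed
  have "(\<lambda>K. (\<Sum>k. b (k + K)) * wnorm 0 y) \<longlonglongrightarrow> 0 * wnorm 0 y"
    by (intro tendsto_mult_right suminf_exist_split2 x(3))
  hence "(\<lambda>K. (\<Sum>k<K. l2inner (x k) y) - l2inner X y) \<longlonglongrightarrow> 0"
    by (intro Lim_null_comparison[OF always_eventually[OF allI[OF le]]]) simp
  thus ?thesis unfolding sums_def X_def by (simp add: LIM_zero_iff)
qed

text \<open>Norm conservation comes from symmetry of \<open>Hop q\<close>: up to the scalar
  coefficients, the inner product of the terms of order \<open>k\<close> and \<open>l\<close>
  depends on \<open>k + l\<close> alone. Regrouping by \<open>k + l\<close> lets the binomial
  theorem cancel every positive order.\<close>

lemma evol_l2: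
  assumes u: "l2 u" and Q: "\<And>n. \<bar>q n\<bar> \<le> Q"
  shows "l2 (evol q t u)"
    and "summable (\<lambda>k. norm ((- \<i> * complex_of_real t) ^ k / of_nat (fact k) * (Hop q ^^ k) u n))"
    and "l2 y \<Longrightarrow> (\<lambda>k. (- \<i> * complex_of_real t) ^ k / of_nat (fact k) * l2inner ((Hop q ^^ k) u) y) sums l2inner (evol q t u) y"
    and "wnorm 0 (evol q t u) = wnorm 0 u"
proof -
  define a where "a k = (- \<i> * complex_of_real t) ^ k / of_nat (fact k)" for k
  define x where "x k n = a k * (Hop q ^^ k) u n" for k n
  define b where "b k = (\<bar>t\<bar> * (4 + Q)) ^ k /\<^sub>R fact k * wnorm 0 u" for k
  note H = Hop_pow_l2[OF u Q]
  have na: "norm (a k) = \<bar>t\<bar> ^ k / fact k" for k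
    by (simp add: a_def norm_divide norm_power norm_mult)
  have b: "summable b" unfolding b_def by (intro summable_mult2 summable_exp_generic)
  have b0: "b k \<ge> 0" for k
    using Q[of 0] wnorm_nonneg[of 0 u] by (auto simp: b_def)
  have x: "l2 (x k)" for k unfolding x_def using l2_cmult H by auto
  have xb: "wnorm 0 (x k) \<le> b k" for k
  proof -
    have "wnorm 0 (x k) \<le> norm (a k) * wnorm 0 ((Hop q ^^ k) u)"
      unfolding x_def using l2_cmult H by auto
    also have "\<dots> \<le> norm (a k) * ((4 + Q) ^ k * wnorm 0 u)"
      using H by (intro mult_left_mono) auto
    also have "\<dots> = b k" by (simp add: na b_def power_mult_distrib divide_inverse mult_ac)
    finally show ?thesis .
  qed
  have ev: "evol q t u = (\<lambda>n. \<Sum>k. x k n)"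
    by (simp add: evol_def x_def a_def)
  show X: "l2 (evol q t u)" unfolding ev by (rule l2_series[OF x xb b])
  show "summable (\<lambda>k. norm ((- \<i> * complex_of_real t) ^ k / of_nat (fact k) * (Hop q ^^ k) u n))"
    using l2_series(1)[OF x xb b] by (simp add: x_def a_def)
  have ser: "(\<lambda>k. a k * l2inner ((Hop q ^^ k) u) y) sums l2inner (evol q t u) y" if "l2 y" for y
    using l2inner_series[OF x xb b that] unfolding ev[symmetric] 
    unfolding x_def by (simp add: l2inner_cmult_left)
  thus "l2 y \<Longrightarrow> (\<lambda>k. (- \<i> * complex_of_real t) ^ k / of_nat (fact k) * l2inner ((Hop q ^^ k) u) y) sums l2inner (evol q t u) y"
    by (simp add: a_def)
  define \<mu> where "\<mu> k = l2inner u ((Hop q ^^ k) u)" for k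
  define c where "c = (\<lambda>(k, l). a k * cnj (a l) * \<mu> (k + l))"
  have ck: "l2inner (x k) (x l) = c (k, l)" for k l
  proof -
    have "l2inner (x k) (x l) = a k * l2inner ((Hop q ^^ k) u) (x l)"
      unfolding x_def[of k] by (rule l2inner_cmult_left)
    also have "\<dots> = a k * l2inner u ((Hop q ^^ k) (x l))"
      using Hop_pow_symmetric[OF u x Q] by simp
    also have "(Hop q ^^ k) (x l) = (\<lambda>n. a l * (Hop q ^^ (k + l)) u n)"
    proof (induction k)
      case (Suc k)
      have "(Hop q ^^ Suc k) (x l) = Hop q (\<lambda>n. a l * (Hop q ^^ (k + l)) u n)" using Suc by simp
      also have "\<dots> = (\<lambda>n. a l * Hop q ((Hop q ^^ (k + l)) u) n)"
        by (auto simp: Hop_def algebra_simps)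
      finally show ?case by simp
    qed (simp add: x_def)
    also have "l2inner u (\<lambda>n. a l * (Hop q ^^ (k + l)) u n) = cnj (a l) * \<mu> (k + l)"
      using l2inner_commute[of u "\<lambda>n. a l * (Hop q ^^ (k + l)) u n"] 
         l2inner_commute[of u "(Hop q ^^ (k + l)) u"]
      by (simp add: l2inner_cmult_left \<mu>_def)
    finally show ?thesis by (simp add: c_def)
  qed
  \<comment> \<open>A product majorant makes the double series absolutely summable, which licenses
    the diagonal regrouping.\<close>
  have bb: "(\<lambda>kl. b (fst kl) * b (snd kl)) summable_on (UNIV \<times> UNIV)"
  proof (rule summable_on_SigmaI)
    have bs: "b summable_on UNIV" using b b0 by (intro summable_nonneg_imp_summable_on) auto
    show "((\<lambda>y. b (fst (k, y)) * b (snd (k, y))) has_sum b k * infsum b UNIV) UNIV" for k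
      using bs by (auto intro!: has_sum_cmult_right)
    show "(\<lambda>k. b k * infsum b UNIV) summable_on UNIV"
      using bs by (auto intro!: summable_on_cmult_left)
  qed (use b0 in auto)
  have "norm (c kl) \<le> b (fst kl) * b (snd kl)" for kl
  proof -
    have "norm (c kl) \<le> wnorm 0 (x (fst kl)) * wnorm 0 (x (snd kl))"
      using l2inner_bound[OF x x, of "fst kl" "snd kl"] ck[of "fst kl" "snd kl"] by simp
    also have "\<dots> \<le> b (fst kl) * b (snd kl)"
      by (intro mult_mono xb b0 wnorm_nonneg)
    finally show ?thesis .
  qed
  hence "(\<lambda>kl. norm (c kl)) summable_on (UNIV \<times> UNIV)"
    by (intro Infinite_Sum.abs_summable_on_comparison_test'[OF bb]) auto
  hence cs: "c summable_on (UNIV \<times> UNIV)" by (rule abs_summable_summable)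
  have inner: "(\<Sum>\<^sub>\<infinity>l. c (k, l)) = l2inner (x k) (evol q t u)" for k
  proof -
    have "(\<lambda>l. l2inner (x l) (x k)) sums l2inner (evol q t u) (x k)"
      using l2inner_series[OF x xb b x] unfolding ev[symmetric] .
    hence "(\<lambda>l. cnj (l2inner (x l) (x k))) sums cnj (l2inner (evol q t u) (x k))"
      by (simp add: sums_cnj)
    moreover have "cnj (l2inner (x l) (x k)) = c (k, l)" for l
      using ck[of k l] l2inner_commute[of "x k" "x l"] by simp
    ultimately have s: "(\<lambda>l. c (k, l)) sums l2inner (x k) (evol q t u)"
      using l2inner_commute[of "x k" "evol q t u"] by simp
    have "(\<lambda>l. c (k, l)) summable_on UNIV"
      by (rule summable_on_SigmaD1[of "\<lambda>k l. c (k, l)" UNIV "\<lambda>_. UNIV"]) (use cs in auto)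
    from has_sum_imp_sums[OF has_sum_infsum[OF this]] show ?thesis
      using s by (rule sums_unique2)
  qed
  have s: "(\<lambda>k. l2inner (x k) (evol q t u)) sums l2inner (evol q t u) (evol q t u)"
    using l2inner_series[OF x xb b X] unfolding ev[symmetric] .
  have "(\<lambda>k. \<Sum>\<^sub>\<infinity>l. c (k, l)) summable_on UNIV"
    using summable_on_Sigma_banach[of "\<lambda>k l. c (k, l)" UNIV "\<lambda>_. UNIV"] cs by simp
  hence "(\<lambda>k. l2inner (x k) (evol q t u)) sums (\<Sum>\<^sub>\<infinity>k. \<Sum>\<^sub>\<infinity>l. c (k, l))"
    unfolding inner by (intro has_sum_imp_sums has_sum_infsum)
  from sums_unique2[OF s this] 
  have "l2inner (evol q t u) (evol q t u) = (\<Sum>\<^sub>\<infinity>k. \<Sum>\<^sub>\<infinity>l. c (k, l))" .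
  also have "\<dots> = infsum c (UNIV \<times> UNIV)"
    by (rule infsum_Sigma_banach[OF cs])
  also have "\<dots> = (\<Sum>\<^sub>\<infinity>(N, k)\<in>Sigma UNIV (\<lambda>N. {..N}). c (k, N - k))"
    by (rule infsum_reindex_bij_witness[where i="\<lambda>(N, k). (k, N - k)" and j="\<lambda>(k, l). (k + l, k)"]) auto
  also have "\<dots> = (\<Sum>\<^sub>\<infinity>N. \<Sum>\<^sub>\<infinity>k\<in>{..N}. c (k, N - k))"
  proof (rule infsum_Sigma'_banach[symmetric])
    have "(\<lambda>(N, k). c (k, N - k)) summable_on Sigma UNIV (\<lambda>N. {..N}) \<longleftrightarrow> c summable_on (UNIV \<times> UNIV)"
      by (rule summable_on_reindex_bij_witness[where i="\<lambda>(k, l). (k + l, k)" and j="\<lambda>(N, k). (k, N - k)"]) auto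
    thus "(\<lambda>(N, k). c (k, N - k)) summable_on Sigma UNIV (\<lambda>N. {..N})" using cs by simp
  qed
  also have "\<dots> = (\<Sum>\<^sub>\<infinity>N::nat. if N = 0 then \<mu> 0 else 0)"
  proof (rule infsum_cong)
    fix N :: nat
    have "(\<Sum>k\<le>N. c (k, N - k)) = (\<Sum>k\<le>N. of_nat (N choose k) * (- \<i> * complex_of_real t) ^ k * (\<i> * complex_of_real t) ^ (N - k)) * (\<mu> N / fact N)"
      unfolding sum_distrib_right
    proof (rule sum.cong)
      fix k assume "k \<in> {..N}"
      hence "complex_of_nat (N choose k) = fact N / (fact k * fact (N - k))"
        using binomial_fact[of k N, where 'a=complex] by simp
      thus "c (k, N - k) = of_nat (N choose k) * (- \<i> * complex_of_real t) ^ k * (\<i> * complex_of_real t) ^ (N - k) * (\<mu> N / fact N)"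
        using \<open>k \<in> {..N}\<close> by (simp add: c_def a_def field_simps)
    qed auto
    \<comment> \<open>The base is 0, so only \<open>N = 0\<close> survives.\<close>
    also have "\<dots> = (- \<i> * complex_of_real t + \<i> * complex_of_real t) ^ N * (\<mu> N / fact N)"
      by (subst binomial_ring) simp
    finally show "(\<Sum>\<^sub>\<infinity>k\<in>{..N}. c (k, N - k)) = (if N = 0 then \<mu> 0 else 0)" by simp
  qed
  also have "\<dots> = (\<Sum>\<^sub>\<infinity>N\<in>{0::nat}. if N = 0 then \<mu> 0 else 0)"
    by (rule infsum_cong_neutral) auto
  also have "\<dots> = l2inner u u" by (simp add: \<mu>_def)
  finally have "(wnorm 0 (evol q t u))\<^sup>2 = (wnorm 0 u)\<^sup>2"
    unfolding l2inner_self[OF X] l2inner_self[OF u] of_real_eq_iff .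
  thus "wnorm 0 (evol q t u) = wnorm 0 u"
    using wnorm_nonneg by (simp add: power2_eq_iff_nonneg)
qed

text \<open>Symmetry moves all powers of \<open>Hop q\<close> onto \<phi>, whose eigenvalue is real;
  the pairing is multiplied by a unimodular number.\<close>

lemma evol_eigvec:
  assumes u: "l2 u" and Q: "\<And>n. \<bar>q n\<bar> \<le> Q" and phi: "eigvec q \<phi>"
  shows "cmod (l2inner (evol q t u) \<phi>) = cmod (l2inner u \<phi>)"
proof -
  obtain ev where p: "l2 \<phi>" "\<phi> \<noteq> (\<lambda>_. 0)" "Hop q \<phi> = (\<lambda>n. ev * \<phi> n)"
    using phi by (auto simp: eigvec_def)
  have re: "cnj ev = ev" by (rule eigenvalue_real[OF p Q])
  have "l2inner ((Hop q ^^ k) u) \<phi> = ev ^ k * l2inner u \<phi>" for k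
  proof -
    have "l2inner ((Hop q ^^ k) u) \<phi> = l2inner u (\<lambda>n. ev ^ k * \<phi> n)"
      using Hop_pow_symmetric[OF u p(1) Q] eigvec_Hop_pow[OF p(3)] by simp
    also have "\<dots> = ev ^ k * l2inner u \<phi>"
      using l2inner_commute[of u "\<lambda>n. ev ^ k * \<phi> n"] l2inner_commute[of u \<phi>] re
      by (simp add: l2inner_cmult_left)
    finally show ?thesis .
  qed
  hence "(- \<i> * complex_of_real t) ^ k / of_nat (fact k) * l2inner ((Hop q ^^ k) u) \<phi> =
      (- \<i> * complex_of_real t * ev) ^ k /\<^sub>R fact k * l2inner u \<phi>" for k
    using power_mult_distrib[of "- \<i> * complex_of_real t" ev k] 
    by (simp add: scaleR_conv_of_real field_simps)
  hence "(\<lambda>k. (- \<i> * complex_of_real t * ev) ^ k /\<^sub>R fact k * l2inner u \<phi>) sums l2inner (evol q t u) \<phi>"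
    using evol_l2(3)[where q=q and t=t, OF u Q p(1)] by simp
  moreover have "(\<lambda>k. (- \<i> * complex_of_real t * ev) ^ k /\<^sub>R fact k * l2inner u \<phi>) sums 
      (exp (- \<i> * complex_of_real t * ev) * l2inner u \<phi>)"
    by (intro sums_mult2 exp_converges)
  ultimately have "l2inner (evol q t u) \<phi> = exp (- \<i> * complex_of_real t * ev) * l2inner u \<phi>"
    by (rule sums_unique2)
  moreover have "norm (exp (- \<i> * complex_of_real t * ev)) = 1"
  proof -
    have "Im ev = 0" using re by (simp add: complex_eq_iff)
    thus ?thesis by (simp add: norm_exp_eq_Re)
  qed
  ultimately show ?thesis by (simp add: norm_mult)
qed

lemma evol_add:
  assumes "l2 u" "l2 v" "\<And>n. \<bar>q n\<bar> \<le> Q"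
  shows "evol q t (\<lambda>n. u n + v n) = (\<lambda>n. evol q t u n + evol q t v n)"
proof
  fix n
  have P: "(Hop q ^^ k) (\<lambda>n. u n + v n) = (\<lambda>n. (Hop q ^^ k) u n + (Hop q ^^ k) v n)" for k
    by (induction k) (auto simp: Hop_def algebra_simps)
  show "evol q t (\<lambda>n. u n + v n) n = evol q t u n + evol q t v n"
    using suminf_add[OF summable_norm_cancel[OF evol_l2(2)[where q=q and t=t and n=n, OF assms(1,3)]] 
                        summable_norm_cancel[OF evol_l2(2)[where q=q and t=t and n=n, OF assms(2,3)]]]
    by (simp add: evol_def P ring_distribs)
qed


text \<open>The difference \<open>d\<close> is orthogonal to the eigenvectors, hence by
  approximation to \<open>pp_space q\<close>. It is also the difference of \<open>u - w\<close> and
  \<open>u - v\<close>, both in that space, so \<open>d\<close> is orthogonal to itself.\<close>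

lemma pp_space_orthogonal_unique:
  assumes v: "l2 v" "\<forall>\<phi>. eigvec q \<phi> \<longrightarrow> l2inner v \<phi> = 0" "(\<lambda>n. u n - v n) \<in> pp_space q"
      and w: "l2 w" "\<forall>\<phi>. eigvec q \<phi> \<longrightarrow> l2inner w \<phi> = 0" "(\<lambda>n. u n - w n) \<in> pp_space q"
  shows "v = w"
proof -
  define d where "d = (\<lambda>n. v n - w n)"
  have d: "l2 d" unfolding d_def by (intro l2_diff v w)
  have orth: "l2inner d \<phi> = 0" if "eigvec q \<phi>" for \<phi>
    using l2inner_diff_left[OF v(1) w(1), of \<phi>] v(2) w(2) that by (auto simp: d_def eigvec_def)
  have orth_sum: "l2inner d (\<lambda>n. \<Sum>j<m. c j * \<phi> j n) = 0 \<and> l2 (\<lambda>n. \<Sum>j<m. c j * \<phi> j n)"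
    if "\<forall>j<m. eigvec q (\<phi> j)" for m :: nat and c \<phi>
  proof -
    have l: "l2 (\<lambda>n. c j * \<phi> j n)" if "j < m" for j
      using \<open>\<forall>j<m. eigvec q (\<phi> j)\<close> that l2_cmult by (auto simp: eigvec_def)
    have "l2inner (\<phi> j) d = 0" if "j < m" for j
      using orth[of "\<phi> j"] \<open>\<forall>j<m. eigvec q (\<phi> j)\<close> that l2inner_commute[of "\<phi> j" d] by simp
    hence "l2inner (\<lambda>n. \<Sum>j<m. c j * \<phi> j n) d = 0"
      using l2inner_sum_left[of "{..<m}" "\<lambda>j n. c j * \<phi> j n" d] l d by (simp add: l2inner_cmult_left)
    thus ?thesis
      using l2inner_commute[of d "\<lambda>n. \<Sum>j<m. c j * \<phi> j n"] l2_sum[of "{..<m}" "\<lambda>j n. c j * \<phi> j n"] l by simp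
  qed
  have small: "cmod (l2inner d x) \<le> e * wnorm 0 d" if "x \<in> pp_space q" "e > 0" for x e
  proof -
    have x: "l2 x" and "\<exists>(m::nat) c \<phi>. (\<forall>j<m. eigvec q (\<phi> j)) \<and> wnorm 0 (\<lambda>n. x n - (\<Sum>j<m. c j * \<phi> j n)) < e"
      using that by (auto simp: pp_space_def)
    then obtain m :: nat and c \<phi> where p: "\<forall>j<m. eigvec q (\<phi> j)" 
      "wnorm 0 (\<lambda>n. x n - (\<Sum>j<m. c j * \<phi> j n)) < e"
      by blast
    note o = orth_sum[OF p(1), of c]
    have "l2inner d (\<lambda>n. x n - (\<Sum>j<m. c j * \<phi> j n)) = l2inner d x"
      using l2inner_diff_right[OF x _ d] o by simp
    hence "cmod (l2inner d x) \<le> wnorm 0 d * wnorm 0 (\<lambda>n. x n - (\<Sum>j<m. c j * \<phi> j n))"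
      using l2inner_bound[OF d l2_diff(1)[OF x conjunct2[OF o]]] by simp
    also have "\<dots> \<le> wnorm 0 d * e"
      using p(2) wnorm_nonneg by (intro mult_left_mono) auto
    finally show ?thesis by (simp add: mult.commute)
  qed
  have zero: "l2inner d x = 0" if "x \<in> pp_space q" for x
  proof -
    have "cmod (l2inner d x) \<le> 0 + e" if "e > 0" for e
    proof -
      have "cmod (l2inner d x) \<le> (e / (1 + wnorm 0 d)) * wnorm 0 d"
        by (intro small) (use that \<open>x \<in> pp_space q\<close> wnorm_nonneg[of 0 d] in \<open>auto simp: add_pos_nonneg\<close>)
      also have "\<dots> \<le> e"
        using that wnorm_nonneg[of 0 d] by (simp add: field_simps)
      finally show ?thesis by simp
    qed
    hence "cmod (l2inner d x) \<le> 0" by (rule field_le_epsilon)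
    thus ?thesis by simp
  qed
  have "l2inner d d = l2inner d (\<lambda>n. (u n - w n) - (u n - v n))" by (simp add: d_def)
  also have "\<dots> = 0"
    using zero[OF v(3)] zero[OF w(3)] v(3) w(3) d
    by (subst l2inner_diff_right) (auto simp: pp_space_def)
  finally have "wnorm 0 d = 0" using d by (simp add: l2inner_self)
  thus ?thesis using wnorm_0_eq_0[OF d] by (auto simp: d_def)
qed

lemma Pc_eqI:
  assumes "l2 v" "\<And>\<phi>. eigvec q \<phi> \<Longrightarrow> l2inner v \<phi> = 0" "(\<lambda>n. u n - v n) \<in> pp_space q"
  shows "Pc q u = v"
  unfolding Pc_def
  by (rule the_equality) (use assms pp_space_orthogonal_unique[of _ q u v] in blast)+


subsection \<open>Power series coefficients of the Jost solutions\<close>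

definition decaying :: "(int \<Rightarrow> real) \<Rightarrow> bool" where
  "decaying q \<longleftrightarrow> (\<lambda>n. (wt n)\<^sup>2 * \<bar>q n\<bar>) summable_on UNIV"

text \<open>\<open>jw\<close> is the growth of the coefficient sums to the left, \<open>jE\<close> the Gronwall factor.\<close>

definition jw :: "int \<Rightarrow> real" where "jw n = (if n \<ge> 0 then 1 else 1 + \<bar>real_of_int n\<bar>)"

text \<open>The density fed to the Gronwall argument. The squared weight absorbs kernel length and
  growth as in \<open>jw_kernel_sq\<close>; the factor 2 is that of \<open>2 * l\<^sup>2\<close> in
  \<open>(2 * m + l)\<^sup>2 \<le> 8 * m\<^sup>2 + 2 * l\<^sup>2\<close>, used for the second
  moments.\<close>

definition jp :: "(int \<Rightarrow> real) \<Rightarrow> int \<Rightarrow> real" where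
  "jp q n = 2 * \<bar>q n\<bar> * (wt n)\<^sup>2"

definition jE :: "(int \<Rightarrow> real) \<Rightarrow> int \<Rightarrow> real" where
  "jE q n = exp (\<Sum>\<^sub>\<infinity>j\<in>{n<..}. jp q j)"

text \<open>With \<open>f\<close> denoting the Jost solution that behaves like \<open>z ^ n\<close> at \<open>+\<infinity>\<close>,
  the numbers \<open>JB q k n\<close> are the Taylor coefficients in \<open>z\<close> of \<open>f n / z ^ n\<close>. The recursion is
  the Volterra equation \<open>h n = 1 + (\<Sum>j>n. q j * (z + z ^ 3 + \<dots> + z ^ (2 * (j - n) - 1)) * h j)\<close>.\<close>

fun JB :: "(int \<Rightarrow> real) \<Rightarrow> nat \<Rightarrow> int \<Rightarrow> real" where
  "JB q 0 n = 1"
| "JB q (Suc k) n =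
    (\<Sum>\<^sub>\<infinity>j\<in>{n<..}. q j * (\<Sum>i<nat (j - n). if 2 * i \<le> k then JB q (k - 2 * i) j else 0))"

declare JB.simps(2) [simp del]

abbreviation (input) JBc :: "(int \<Rightarrow> real) \<Rightarrow> int \<Rightarrow> nat \<Rightarrow> complex" where
  "JBc q n \<equiv> (\<lambda>k. complex_of_real (JB q k n))"

lemma jw_ge_1: "jw n \<ge> 1"
  by (auto simp: jw_def)

text \<open>The Volterra kernel has \<open>j - n\<close> terms. Their number times the growth at
  \<open>j\<close> is charged to the growth at \<open>n\<close> and a single weight of
  \<open>j\<close>, so the growth \<open>jw\<close> reproduces itself under the recursion.\<close>

lemma jw_kernel:
  assumes "n < j"
  shows "real (nat (j - n)) * jw j \<le> jw n * (wt j)"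
proof -
  have m: "real (nat (j - n)) = real_of_int j - real_of_int n" using assms by simp
  consider "n \<ge> 0" | "n < 0" "j \<ge> 0" | "j < 0" by linarith
  thus ?thesis
  proof cases
    case 2
    have "0 \<le> real_of_int j * (- real_of_int n)" using 2 by (intro mult_nonneg_nonneg) auto
    thus ?thesis using 2 assms unfolding m by (simp add: jw_def algebra_simps)
  next
    case 3
    have "(real_of_int j - real_of_int n) * (1 - real_of_int j) \<le> (1 - real_of_int n) * (1 - real_of_int j)"
      using 3 by (intro mult_right_mono) auto
    thus ?thesis using 3 assms unfolding m by (simp add: jw_def)
  qed (use assms m in \<open>simp add: jw_def\<close>)
qed

text \<open>Both follow by squaring \<open>jw_kernel\<close>, because \<open>j - n\<close> and
  \<open>jw j\<close> are at least 1.\<close>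

lemma jw_kernel_sq:
  assumes "n < j"
  shows "real (nat (j - n)) * (jw j)\<^sup>2 \<le> (jw n)\<^sup>2 * (wt j)\<^sup>2"
    and "(real (nat (j - n)))\<^sup>2 * jw j \<le> (jw n)\<^sup>2 * (wt j)\<^sup>2"
proof -
  have a: "(real (nat (j - n)) * jw j)\<^sup>2 \<le> (jw n * (wt j))\<^sup>2"
    using jw_kernel[OF assms] jw_ge_1[of j] by (intro power_mono) auto
  have m: "real (nat (j - n)) \<ge> 1" using assms by linarith
  hence m2: "real (nat (j - n)) \<le> (real (nat (j - n)))\<^sup>2" by (intro self_le_power) auto
  have "real (nat (j - n)) * (jw j)\<^sup>2 \<le> (real (nat (j - n)) * jw j)\<^sup>2"
    unfolding power_mult_distrib by (intro mult_right_mono m2) auto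
  with a show "real (nat (j - n)) * (jw j)\<^sup>2 \<le> (jw n)\<^sup>2 * (wt j)\<^sup>2"
    by (simp add: power_mult_distrib)
  have "(real (nat (j - n)))\<^sup>2 * jw j \<le> (real (nat (j - n)) * jw j)\<^sup>2"
    unfolding power_mult_distrib using jw_ge_1[of j] by (intro mult_left_mono) (auto simp: power2_eq_square)
  with a show "(real (nat (j - n)))\<^sup>2 * jw j \<le> (jw n)\<^sup>2 * (wt j)\<^sup>2"
    by (simp add: power_mult_distrib)
qed

lemma jp_nonneg: "jp q n \<ge> 0"
  by (simp add: jp_def)

lemma jp_summable: "decaying q \<Longrightarrow> jp q summable_on A"
  using summable_on_cmult_right[of "\<lambda>n. (wt n)\<^sup>2 * \<bar>q n\<bar>" UNIV 2]
  by (intro summable_on_subset_banach[of _ UNIV A]) (auto simp: decaying_def jp_def[abs_def] mult_ac)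

lemma jE_ge_1: "jE q n \<ge> 1"
  by (auto simp: jE_def intro!: infsum_nonneg jp_nonneg)

lemma jE_le: "decaying q \<Longrightarrow> jE q n \<le> exp (\<Sum>\<^sub>\<infinity>j. jp q j)"
  by (auto simp: jE_def intro!: infsum_mono2 jp_summable jp_nonneg)

text \<open>A discrete differential inequality: \<open>1 + x \<le> exp x\<close> at the site
  \<open>j\<close>.\<close>

lemma jE_step: 
  assumes "decaying q"
  shows "jp q j * jE q j \<le> jE q (j - 1) - jE q j"
proof -
  have "{j - 1<..} = insert j {j<..}" by auto
  hence "jE q (j - 1) = exp (jp q j) * jE q j"
    using jp_summable[OF assms] by (simp add: jE_def infsum_insert exp_add)
  moreover have "(1 + jp q j) * jE q j \<le> exp (jp q j) * jE q j"
    using jE_ge_1[of q j] by (intro mult_right_mono exp_ge_add_one_self) auto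
  ultimately show ?thesis by (simp add: algebra_simps)
qed

text \<open>The telescoped \<open>jE_step\<close>. The subtracted 1 leaves room for the
  inhomogeneous term, so that a hypothesis with factor \<open>jE\<close> returns the same
  factor.\<close>

lemma jE_sum:
  assumes "decaying q"
  shows "(\<lambda>j. jp q j * jE q j) summable_on {n<..}"
    and "(\<Sum>\<^sub>\<infinity>j\<in>{n<..}. jp q j * jE q j) \<le> jE q n - 1"
proof -
  have pos: "jp q j * jE q j \<ge> 0" for j
    using jp_nonneg[of q j] jE_ge_1[of q j] by auto
  have tel: "(\<Sum>j\<in>{n<..N}. jp q j * jE q j) \<le> jE q n - jE q N" if "n \<le> N" for N
    using that
  proof (induction N rule: int_ge_induct)
    case (step N)
    have "{n<..N+1} = insert (N + 1) {n<..N}" using step by auto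
    thus ?case using step jE_step[OF assms, of "N + 1"] by simp
  qed simp
  have fin: "(\<Sum>j\<in>F. jp q j * jE q j) \<le> jE q n - 1" if "finite F" "F \<subseteq> {n<..}" for F
  proof -
    define N where "N = Max (insert n F)"
    have N: "n \<le> N" "F \<subseteq> {n<..N}" using that by (auto simp: N_def)
    have "(\<Sum>j\<in>F. jp q j * jE q j) \<le> (\<Sum>j\<in>{n<..N}. jp q j * jE q j)"
      using N pos by (intro sum_mono2) auto
    also have "\<dots> \<le> jE q n - 1" using tel[OF N(1)] jE_ge_1[of q N] by simp
    finally show ?thesis .
  qed
  show s: "(\<lambda>j. jp q j * jE q j) summable_on {n<..}"
    by (rule nonneg_bdd_above_summable_on) (auto intro!: bdd_aboveI2 fin pos)
  show "(\<Sum>\<^sub>\<infinity>j\<in>{n<..}. jp q j * jE q j) \<le> jE q n - 1"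
    by (intro infsum_le_finite_sums s fin)
qed

lemma jE_tendsto: 
  assumes "decaying q"
  shows "(\<lambda>N. jE q (int N)) \<longlonglongrightarrow> 1"
proof -
  have s: "summable (\<lambda>k. jp q (int k))"
  proof -
    have "(\<lambda>k. jp q (int k)) summable_on UNIV"
      using summable_on_reindex[of int UNIV "jp q"] jp_summable[OF assms] by (simp add: o_def)
    thus ?thesis by (rule summable_on_imp_summable)
  qed
  have "(\<Sum>\<^sub>\<infinity>j\<in>{int N<..}. jp q j) = (\<Sum>k. jp q (int (k + Suc N)))" for N
  proof -
    have b: "bij_betw (\<lambda>k. int (k + Suc N)) UNIV {int N<..}"
      by (rule bij_betwI[where g="\<lambda>j. nat (j - int N - 1)"]) auto
    have "(\<Sum>\<^sub>\<infinity>j\<in>{int N<..}. jp q j) = (\<Sum>\<^sub>\<infinity>k. jp q (int (k + Suc N)))"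
      using infsum_reindex_bij_betw[OF b, of "jp q"] by simp
    moreover have "(\<lambda>k. jp q (int (k + Suc N))) summable_on UNIV"
      using summable_on_reindex_bij_betw[OF b, of "jp q"] jp_summable[OF assms] by simp
    ultimately show ?thesis
      using has_sum_imp_sums[OF has_sum_infsum] sums_unique by metis
  qed
  moreover have "(\<lambda>N. \<Sum>k. jp q (int (k + Suc N))) \<longlonglongrightarrow> 0"
    using LIMSEQ_Suc[OF suminf_exist_split2[OF s]] .
  ultimately have "(\<lambda>N. exp (\<Sum>\<^sub>\<infinity>j\<in>{int N<..}. jp q j)) \<longlonglongrightarrow> exp 0"
    by (intro tendsto_exp) simp
  thus ?thesis by (simp add: jE_def)
qed

lemma has_sum_finite_sum:
  fixes f :: "'b \<Rightarrow> 'a \<Rightarrow> 'c :: topological_comm_monoid_add"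
  assumes "finite A" "\<And>k. k \<in> A \<Longrightarrow> (f k has_sum S k) B"
  shows "((\<lambda>j. \<Sum>k\<in>A. f k j) has_sum (\<Sum>k\<in>A. S k)) B"
  using assms by (induction rule: finite_induct) (auto intro: has_sum_add)

text \<open>Arbitrary finite index sets and weights \<phi> cover partial sums, first moments and a
  single coefficient at once. The substance is the exchange of the finite sum over \<open>k\<close>
  with the infinite sum over \<open>j\<close>.\<close>

lemma JB_step:
  assumes "finite A" "\<And>k. k \<in> A \<Longrightarrow> \<phi> k \<ge> (0::real)"
      and G: "\<And>j. j > n \<Longrightarrow> 
        (\<Sum>k\<in>A. \<phi> k * (\<Sum>i<nat (j - n). if 2 * i \<le> k then \<bar>JB q (k - 2 * i) j\<bar> else 0)) \<le> G j"
      and s: "(\<lambda>j. \<bar>q j\<bar> * G j) summable_on {n<..}"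
  shows "(\<Sum>k\<in>A. \<phi> k * \<bar>JB q (Suc k) n\<bar>) \<le> (\<Sum>\<^sub>\<infinity>j\<in>{n<..}. \<bar>q j\<bar> * G j)"
proof -
  define T where "T k j = (\<Sum>i<nat (j - n). if 2 * i \<le> k then JB q (k - 2 * i) j else 0)" for k j
  define T' where "T' k j = (\<Sum>i<nat (j - n). if 2 * i \<le> k then \<bar>JB q (k - 2 * i) j\<bar> else 0)" for k j
  have T'0: "T' k j \<ge> 0" for k j unfolding T'_def by (intro sum_nonneg) auto
  have TT': "\<bar>T k j\<bar> \<le> T' k j" for k j
    unfolding T_def T'_def by (rule order_trans[OF sum_abs]) (intro sum_mono, auto)
  have le1: "\<bar>q j\<bar> * (\<phi> k * T' k j) \<le> \<bar>q j\<bar> * G j" if "k \<in> A" "j > n" for k j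
  proof (intro mult_left_mono)
    have "\<phi> k * T' k j \<le> (\<Sum>k\<in>A. \<phi> k * T' k j)"
      using assms(1,2) T'0 that by (intro member_le_sum) auto
    also have "\<dots> \<le> G j" using G[OF that(2)] by (simp add: T'_def)
    finally show "\<phi> k * T' k j \<le> G j" .
  qed auto
  have s1: "(\<lambda>j. \<bar>q j\<bar> * (\<phi> k * T' k j)) summable_on {n<..}" if "k \<in> A" for k
    by (rule summable_on_comparison_test[OF s]) (use le1 that T'0 assms(2) in auto)
  have le2: "\<phi> k * \<bar>JB q (Suc k) n\<bar> \<le> (\<Sum>\<^sub>\<infinity>j\<in>{n<..}. \<bar>q j\<bar> * (\<phi> k * T' k j))" if k: "k \<in> A" for k
  proof -
    have le: "norm (\<phi> k * (q j * T k j)) \<le> \<bar>q j\<bar> * (\<phi> k * T' k j)" for j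
    proof -
      have "norm (\<phi> k * (q j * T k j)) = \<bar>q j\<bar> * \<phi> k * \<bar>T k j\<bar>"
        using assms(2)[OF k] by (simp add: abs_mult)
      also have "\<dots> \<le> \<bar>q j\<bar> * \<phi> k * T' k j" using assms(2)[OF k] TT' by (intro mult_left_mono) auto
      finally show ?thesis by (simp add: mult_ac)
    qed
    have "\<phi> k * JB q (Suc k) n = (\<Sum>\<^sub>\<infinity>j\<in>{n<..}. \<phi> k * (q j * T k j))"
      by (simp add: T_def JB.simps(2) infsum_cmult_right')
    hence "norm (\<phi> k * JB q (Suc k) n) \<le> (\<Sum>\<^sub>\<infinity>j\<in>{n<..}. \<bar>q j\<bar> * (\<phi> k * T' k j))"
    proof (elim ssubst, intro norm_infsum_le[OF has_sum_infsum has_sum_infsum])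
      show "(\<lambda>j. \<phi> k * (q j * T k j)) summable_on {n<..}"
        by (rule abs_summable_summable) (rule Infinite_Sum.abs_summable_on_comparison_test'[OF s1[OF k]], use le in auto)
    qed (use s1[OF k] le in auto)
    thus ?thesis using assms(2)[OF k] by (simp add: abs_mult)
  qed
  have "(\<Sum>k\<in>A. \<phi> k * \<bar>JB q (Suc k) n\<bar>) \<le> (\<Sum>k\<in>A. \<Sum>\<^sub>\<infinity>j\<in>{n<..}. \<bar>q j\<bar> * (\<phi> k * T' k j))"
    by (intro sum_mono le2)
  also have "\<dots> = (\<Sum>\<^sub>\<infinity>j\<in>{n<..}. \<Sum>k\<in>A. \<bar>q j\<bar> * (\<phi> k * T' k j))"
  proof -
    have "((\<lambda>j. \<Sum>k\<in>A. \<bar>q j\<bar> * (\<phi> k * T' k j)) has_sum (\<Sum>k\<in>A. \<Sum>\<^sub>\<infinity>j\<in>{n<..}. \<bar>q j\<bar> * (\<phi> k * T' k j))) {n<..}"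
      using s1 assms(1) by (intro has_sum_finite_sum) auto
    thus ?thesis by (simp add: infsumI)
  qed
  also have "\<dots> \<le> (\<Sum>\<^sub>\<infinity>j\<in>{n<..}. \<bar>q j\<bar> * G j)"
  proof (rule infsum_mono)
    show "(\<lambda>j. \<Sum>k\<in>A. \<bar>q j\<bar> * (\<phi> k * T' k j)) summable_on {n<..}"
      by (rule has_sum_imp_summable[OF has_sum_finite_sum[OF assms(1) has_sum_infsum[OF s1]]])
    show "(\<Sum>k\<in>A. \<bar>q j\<bar> * (\<phi> k * T' k j)) \<le> \<bar>q j\<bar> * G j" if "j \<in> {n<..}" for j
      unfolding sum_distrib_left[symmetric] using G[of j] that by (intro mult_left_mono) (auto simp: T'_def)
  qed (rule s)
  finally show ?thesis .
qed

text \<open>For fixed \<open>i\<close> the shift \<open>k - 2 * i\<close> hits each index at most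
  once, so each of the \<open>m\<close> shifts costs at most one full sum.\<close>

lemma inner_sum_le:
  fixes c :: "nat \<Rightarrow> real"
  assumes "\<And>l. c l \<ge> 0"
  shows "(\<Sum>k\<le>K. \<Sum>i<m. if 2 * i \<le> k then c (k - 2 * i) else 0) \<le> real m * (\<Sum>l\<le>K. c l)"
proof -
  have "(\<Sum>k\<le>K. \<Sum>i<m. if 2 * i \<le> k then c (k - 2 * i) else 0) =
        (\<Sum>i<m. \<Sum>k\<le>K. if 2 * i \<le> k then c (k - 2 * i) else 0)" by (rule sum.swap)
  also have "\<dots> \<le> (\<Sum>i<m. \<Sum>l\<le>K. c l)"
  proof (rule sum_mono)
    fix i
    have "(\<Sum>k\<le>K. if 2 * i \<le> k then c (k - 2 * i) else 0) = (\<Sum>k\<in>{k\<in>{..K}. 2 * i \<le> k}. c (k - 2 * i))"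
      by (rule sum.inter_filter[symmetric]) simp
    also have "\<dots> \<le> (\<Sum>l\<le>K. c l)"
      by (rule sum_le_included[where i="\<lambda>l. l + 2 * i"]) (use assms in \<open>auto intro!: bexI[of _ "_ - 2 * i"]\<close>)
    finally show "(\<Sum>k\<le>K. if 2 * i \<le> k then c (k - 2 * i) else 0) \<le> (\<Sum>l\<le>K. c l)" .
  qed
  finally show ?thesis by simp
qed

text \<open>For fixed \<open>k\<close> the indices \<open>k - 2 * i\<close> are distinct, which
  avoids the factor \<open>m\<close> of the summed version.\<close>

lemma inner_sum_le':
  fixes c :: "nat \<Rightarrow> real"
  assumes "\<And>l. c l \<ge> 0"
  shows "(\<Sum>i<m. if 2 * i \<le> k then c (k - 2 * i) else 0) \<le> (\<Sum>l\<le>k. c l)"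
proof -
  have "(\<Sum>i<m. if 2 * i \<le> k then c (k - 2 * i) else 0) = (\<Sum>i\<in>{i\<in>{..<m}. 2 * i \<le> k}. c (k - 2 * i))"
    by (rule sum.inter_filter[symmetric]) simp
  also have "\<dots> \<le> (\<Sum>l\<le>k. c l)"
    by (rule sum_le_included[where i="\<lambda>l. (k - l) div 2"]) (use assms in \<open>auto intro!: bexI[of _ "k - 2 * _"]\<close>)
  finally show ?thesis .
qed


section \<open>Gronwall bounds for the coefficients\<close>

lemma JB_bound0_aux:
  assumes n: "n < j" and X: "X \<le> jw j * jE q j"
  shows "\<bar>q j\<bar> * (real (nat (j - n)) * X) \<le> jw n * (jp q j * jE q j)"
proof -
  have "real (nat (j - n)) * X \<le> (real (nat (j - n)) * jw j) * jE q j"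
    using X by (simp add: mult_left_mono mult.assoc)
  also have "\<dots> \<le> (jw n * (wt j)) * jE q j"
    using jE_ge_1[of q j] by (intro mult_right_mono jw_kernel n) auto
  finally have "\<bar>q j\<bar> * (real (nat (j - n)) * X) \<le> \<bar>q j\<bar> * (jw n * (wt j) * jE q j)"
    by (intro mult_left_mono) auto
  also have "\<dots> = jw n * ((\<bar>q j\<bar> * (wt j)) * jE q j)" by simp
  also have "\<dots> \<le> jw n * (jp q j * jE q j)"
  proof (intro mult_left_mono mult_right_mono)
    have "1 * (wt j) \<le> (2 * (wt j)) * (wt j)"
      by (intro mult_right_mono) auto
    hence "\<bar>q j\<bar> * (wt j) \<le> \<bar>q j\<bar> * ((2 * (wt j)) * (wt j))"
      by (intro mult_left_mono) auto
    thus "\<bar>q j\<bar> * (wt j) \<le> jp q j"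
      by (simp add: jp_def power2_eq_square mult_ac)
  qed (use jE_ge_1[of q j] jw_ge_1[of n] in auto)
  finally show ?thesis .
qed

text \<open>Induction on the truncation \<open>K\<close> for all sites at once: the coefficient of
  order \<open>Suc k\<close> at \<open>n\<close> involves only orders up to \<open>k\<close>, at
  sites to the right of \<open>n\<close>. The second bound, without the leading coefficient, later
  forces the Jost factor to tend to 1.\<close>

lemma JB_bound0:
  assumes dec: "decaying q"
  shows "(\<Sum>k\<le>K. \<bar>JB q k n\<bar>) \<le> jw n * jE q n"
    and "(\<Sum>k\<le>K. \<bar>JB q (Suc k) n\<bar>) \<le> jw n * (jE q n - 1)"
proof -
  have step: "(\<Sum>k\<le>K. \<bar>JB q (Suc k) n\<bar>) \<le> jw n * (jE q n - 1)"
    if IH: "\<And>n. (\<Sum>k\<le>K. \<bar>JB q k n\<bar>) \<le> jw n * jE q n" for K n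
  proof -
    define X where "X j = (\<Sum>k\<le>K. \<bar>JB q k j\<bar>)" for j
    have X0: "X j \<ge> 0" for j unfolding X_def by (intro sum_nonneg) auto
    have le: "\<bar>q j\<bar> * (real (nat (j - n)) * X j) \<le> jw n * (jp q j * jE q j)" if "n < j" for j
      using IH[of j] by (intro JB_bound0_aux that) (simp add: X_def)
    have s: "(\<lambda>j. jw n * (jp q j * jE q j)) summable_on {n<..}"
      by (intro summable_on_cmult_right jE_sum dec)
    have s': "(\<lambda>j. \<bar>q j\<bar> * (real (nat (j - n)) * X j)) summable_on {n<..}"
      by (rule summable_on_comparison_test[OF s]) (use le X0 in auto)
    have "(\<Sum>k\<le>K. 1 * \<bar>JB q (Suc k) n\<bar>) \<le> (\<Sum>\<^sub>\<infinity>j\<in>{n<..}. \<bar>q j\<bar> * (real (nat (j - n)) * X j))"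
    proof (rule JB_step)
      fix j assume "j > n"
      show "(\<Sum>k\<le>K. 1 * (\<Sum>i<nat (j - n). if 2 * i \<le> k then \<bar>JB q (k - 2 * i) j\<bar> else 0)) \<le> real (nat (j - n)) * X j"
        using inner_sum_le[of "\<lambda>l. \<bar>JB q l j\<bar>"] by (simp add: X_def)
    qed (use s' in auto)
    also have "\<dots> \<le> (\<Sum>\<^sub>\<infinity>j\<in>{n<..}. jw n * (jp q j * jE q j))"
      by (intro infsum_mono s s') (use le in auto)
    also have "\<dots> = jw n * (\<Sum>\<^sub>\<infinity>j\<in>{n<..}. jp q j * jE q j)"
      by (rule infsum_cmult_right')
    also have "\<dots> \<le> jw n * (jE q n - 1)"
      using jw_ge_1[of n] by (intro mult_left_mono jE_sum dec) auto
    finally show ?thesis by simp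
  qed
  have main: "(\<Sum>k\<le>K. \<bar>JB q k n\<bar>) \<le> jw n * jE q n" for K n
  proof (induction K arbitrary: n)
    case 0
    show ?case using mult_mono[OF jw_ge_1 jE_ge_1, of n q n] jw_ge_1[of n] by simp
  next
    case (Suc K)
    have "(\<Sum>k\<le>Suc K. \<bar>JB q k n\<bar>) = 1 + (\<Sum>k\<le>K. \<bar>JB q (Suc k) n\<bar>)"
      by (subst sum.atMost_Suc_shift) simp
    also have "\<dots> \<le> jw n * jE q n"
      using step[OF Suc.IH, of n] jw_ge_1[of n] by (simp add: algebra_simps)
    finally show ?case .
  qed
  show "(\<Sum>k\<le>K. \<bar>JB q k n\<bar>) \<le> jw n * jE q n" by (rule main)
  show "(\<Sum>k\<le>K. \<bar>JB q (Suc k) n\<bar>) \<le> jw n * (jE q n - 1)" by (rule step[OF main])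
qed

text \<open>\<open>X\<close> is a coefficient sum, already controlled, and \<open>Y\<close> the
  moment under induction. The kernel length enters squared with \<open>X\<close> and linearly with
  \<open>Y\<close>, the two combinations of \<open>jw_kernel_sq\<close>.\<close>

lemma JB_bound2_aux:
  assumes n: "n < j" and X: "X \<le> jw j * jE q j" and Y: "Y \<le> M * (jw j)\<^sup>2 * jE q j"
      and M: "M \<ge> 0" and E: "\<And>j. jE q j \<le> E"
  shows "\<bar>q j\<bar> * (8 * (real (nat (j - n)))\<^sup>2 * X + 2 * real (nat (j - n)) * Y)
          \<le> (jw n)\<^sup>2 * (4 * E * jp q j + M * (jp q j * jE q j))"
proof -
  define W where "W = (jw n)\<^sup>2 * (wt j)\<^sup>2"
  have W: "W \<ge> 0" by (simp add: W_def)
  have E0: "E \<ge> 0" using E[of j] jE_ge_1[of q j] by linarith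
  have "8 * (real (nat (j - n)))\<^sup>2 * X \<le> 8 * (real (nat (j - n)))\<^sup>2 * (jw j * jE q j)"
    by (intro mult_left_mono X) auto
  also have "\<dots> = 8 * (((real (nat (j - n)))\<^sup>2 * jw j) * jE q j)" by simp
  also have "\<dots> \<le> 8 * (W * E)"
    using jw_kernel_sq(2)[OF n] jE_ge_1[of q j] W E[of j] 
    by (intro mult_left_mono mult_mono) (auto simp: W_def)
  finally have a: "8 * (real (nat (j - n)))\<^sup>2 * X \<le> 8 * (W * E)" .
  have "2 * real (nat (j - n)) * Y \<le> 2 * real (nat (j - n)) * (M * (jw j)\<^sup>2 * jE q j)"
    by (intro mult_left_mono Y) auto
  also have "\<dots> = 2 * M * ((real (nat (j - n)) * (jw j)\<^sup>2) * jE q j)" by simp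
  also have "\<dots> \<le> 2 * M * (W * jE q j)"
    using jw_kernel_sq(1)[OF n] jE_ge_1[of q j] M by (intro mult_left_mono mult_right_mono) (auto simp: W_def)
  finally have b: "2 * real (nat (j - n)) * Y \<le> 2 * M * (W * jE q j)" .
  have "\<bar>q j\<bar> * (8 * (real (nat (j - n)))\<^sup>2 * X + 2 * real (nat (j - n)) * Y)
     \<le> \<bar>q j\<bar> * (8 * (W * E) + 2 * M * (W * jE q j))"
    by (intro mult_left_mono add_mono a b) auto
  also have "\<dots> = (jw n)\<^sup>2 * (4 * E * jp q j + M * (jp q j * jE q j))"
    by (simp add: W_def jp_def algebra_simps)
  finally show ?thesis .
qed

text \<open>\<open>M\<close> is chosen so that the inhomogeneous term \<open>4 * E * jp\<close> sums
  to at most \<open>M\<close>, which fills the gap left by the 1 in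
  \<open>jE q n - 1\<close>.\<close>

lemma JB_bound2_aux':
  assumes dec: "decaying q" and M: "M \<ge> 0" and E: "\<And>j. jE q j \<le> E" and M': "M = 4 * E * (\<Sum>\<^sub>\<infinity>j. jp q j)"
  shows "(\<lambda>j. (jw n)\<^sup>2 * (4 * E * jp q j + M * (jp q j * jE q j))) summable_on {n<..}"
    and "(\<Sum>\<^sub>\<infinity>j\<in>{n<..}. (jw n)\<^sup>2 * (4 * E * jp q j + M * (jp q j * jE q j))) \<le> M * (jw n)\<^sup>2 * jE q n"
proof -
  have E0: "E \<ge> 0" using E[of 0] jE_ge_1[of q 0] by linarith
  have s: "(\<lambda>j. 4 * E * jp q j) summable_on {n<..}" "(\<lambda>j. M * (jp q j * jE q j)) summable_on {n<..}"
    by (intro summable_on_cmult_right jE_sum jp_summable dec)+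
  show "(\<lambda>j. (jw n)\<^sup>2 * (4 * E * jp q j + M * (jp q j * jE q j))) summable_on {n<..}"
    by (intro summable_on_cmult_right summable_on_add s)
  have "(\<Sum>\<^sub>\<infinity>j\<in>{n<..}. (jw n)\<^sup>2 * (4 * E * jp q j + M * (jp q j * jE q j)))
      = (jw n)\<^sup>2 * (4 * E * (\<Sum>\<^sub>\<infinity>j\<in>{n<..}. jp q j) + M * (\<Sum>\<^sub>\<infinity>j\<in>{n<..}. jp q j * jE q j))"
    by (simp add: infsum_cmult_right' infsum_add[OF s])
  also have "\<dots> \<le> (jw n)\<^sup>2 * (4 * E * (\<Sum>\<^sub>\<infinity>j. jp q j) + M * (jE q n - 1))"
    using E0 M by (intro mult_left_mono add_mono infsum_mono2 jp_summable dec jE_sum jp_nonneg) auto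
  also have "\<dots> = M * (jw n)\<^sup>2 * jE q n"
    by (simp add: M' algebra_simps)
  finally show "(\<Sum>\<^sub>\<infinity>j\<in>{n<..}. (jw n)\<^sup>2 * (4 * E * jp q j + M * (jp q j * jE q j))) \<le> M * (jw n)\<^sup>2 * jE q n" .
qed

text \<open>To first order in \<open>q\<close>, the coefficient of order \<open>k + 1\<close> for
  even \<open>k\<close> collects \<open>q j\<close> with \<open>j - n > k / 2\<close>. Two moments
  of \<open>q\<close> thus give a summable first moment and a bounded, in general not summable,
  second moment.\<close>

lemma JB_bound12:
  assumes dec: "decaying q"
  shows "\<exists>C\<ge>0. \<forall>n K. (\<Sum>k\<le>K. \<bar>JB q k n\<bar>) \<le> C * jw n \<and> (\<Sum>k\<le>K. real k * \<bar>JB q k n\<bar>) \<le> C * (jw n)\<^sup>2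
            \<and> (real K)\<^sup>2 * \<bar>JB q K n\<bar> \<le> C * (jw n)\<^sup>2"
proof -
  define E where "E = exp (\<Sum>\<^sub>\<infinity>j. jp q j)"
  define M where "M = 4 * E * (\<Sum>\<^sub>\<infinity>j. jp q j)"
  have E: "jE q j \<le> E" for j unfolding E_def by (rule jE_le[OF dec])
  have E0: "E \<ge> 0" by (simp add: E_def)
  have P0: "(\<Sum>\<^sub>\<infinity>j. jp q j) \<ge> 0" by (intro infsum_nonneg jp_nonneg)
  have M: "M \<ge> 0" using E0 P0 by (simp add: M_def)
  note aux' = JB_bound2_aux'[OF dec M E M_def]
  have G: "\<bar>q j\<bar> * (8 * (real (nat (j - n)))\<^sup>2 * (\<Sum>k\<le>K. \<bar>JB q k j\<bar>) + 2 * real (nat (j - n)) * Y)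
       \<le> (jw n)\<^sup>2 * (4 * E * jp q j + M * (jp q j * jE q j))"
    if "n < j" "Y \<le> M * (jw j)\<^sup>2 * jE q j" for n j K Y
    by (rule JB_bound2_aux[OF that(1) JB_bound0(1)[OF dec] that(2) M E])
  have fin: "(\<Sum>k\<in>A. \<phi> k * \<bar>JB q (Suc k) n\<bar>) \<le> M * (jw n)\<^sup>2 * jE q n"
    if A: "finite A" "\<And>k. k \<in> A \<Longrightarrow> \<phi> k \<ge> 0"
      and Y: "\<And>j. 0 \<le> Y j" "\<And>j. Y j \<le> M * (jw j)\<^sup>2 * jE q j"
      and le: "\<And>j. j > n \<Longrightarrow> (\<Sum>k\<in>A. \<phi> k * (\<Sum>i<nat (j - n). if 2 * i \<le> k then \<bar>JB q (k - 2 * i) j\<bar> else 0))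
         \<le> 8 * (real (nat (j - n)))\<^sup>2 * (\<Sum>k\<le>K. \<bar>JB q k j\<bar>) + 2 * real (nat (j - n)) * Y j"
    for A \<phi> Y K n
  proof -
    have s: "(\<lambda>j. \<bar>q j\<bar> * (8 * (real (nat (j - n)))\<^sup>2 * (\<Sum>k\<le>K. \<bar>JB q k j\<bar>) + 2 * real (nat (j - n)) * Y j)) summable_on {n<..}"
      by (rule summable_on_comparison_test[OF aux'(1)]) 
         (use G Y in \<open>auto intro!: mult_nonneg_nonneg add_nonneg_nonneg sum_nonneg\<close>)
    have "(\<Sum>k\<in>A. \<phi> k * \<bar>JB q (Suc k) n\<bar>) \<le> (\<Sum>\<^sub>\<infinity>j\<in>{n<..}. \<bar>q j\<bar> *
        (8 * (real (nat (j - n)))\<^sup>2 * (\<Sum>k\<le>K. \<bar>JB q k j\<bar>) + 2 * real (nat (j - n)) * Y j))"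
      by (rule JB_step[OF A le s])
    also have "\<dots> \<le> (\<Sum>\<^sub>\<infinity>j\<in>{n<..}. (jw n)\<^sup>2 * (4 * E * jp q j + M * (jp q j * jE q j)))"
      by (rule infsum_mono[OF s aux'(1)]) (use G Y in auto)
    also have "\<dots> \<le> M * (jw n)\<^sup>2 * jE q n" by (rule aux'(2))
    finally show ?thesis .
  qed
  have n1: "(\<Sum>k\<le>K. real k * \<bar>JB q k n\<bar>) \<le> M * (jw n)\<^sup>2 * jE q n" for n K
  proof (induction K arbitrary: n)
    case 0
    show ?case using M jE_ge_1[of q n] by simp
  next
    case (Suc K)
    have "(\<Sum>k\<le>Suc K. real k * \<bar>JB q k n\<bar>) = (\<Sum>k\<le>K. real (Suc k) * \<bar>JB q (Suc k) n\<bar>)"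
      by (subst sum.atMost_Suc_shift) simp
    also have "\<dots> \<le> M * (jw n)\<^sup>2 * jE q n"
    proof (rule fin[where Y="\<lambda>j. \<Sum>k\<le>K. real k * \<bar>JB q k j\<bar>" and K=K])
      fix j assume j: "j > n"
      define m where "m = nat (j - n)"
      define c where "c l = (2 * real m + real l) * \<bar>JB q l j\<bar>" for l
      have c0: "c l \<ge> 0" for l by (simp add: c_def)
      have "(\<Sum>k\<le>K. real (Suc k) * (\<Sum>i<m. if 2 * i \<le> k then \<bar>JB q (k - 2 * i) j\<bar> else 0))
         \<le> (\<Sum>k\<le>K. \<Sum>i<m. if 2 * i \<le> k then c (k - 2 * i) else 0)"
        unfolding sum_distrib_left
      proof (intro sum_mono)
        fix k i assume "i \<in> {..<m}"
        \<comment> \<open>With \<open>i < m\<close> the weight \<open>k + 1\<close> splits into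
          kernel length and the weight of the recursive coefficient.\<close>
        hence "real (Suc k) \<le> 2 * real m + real (k - 2 * i)" if "2 * i \<le> k" using that by auto
        thus "real (Suc k) * (if 2 * i \<le> k then \<bar>JB q (k - 2 * i) j\<bar> else 0) \<le> (if 2 * i \<le> k then c (k - 2 * i) else 0)"
          unfolding c_def by (auto intro!: mult_right_mono simp del: of_nat_Suc)
      qed
      also have "\<dots> \<le> real m * (\<Sum>l\<le>K. c l)" by (rule inner_sum_le[OF c0])
      also have "\<dots> = 2 * (real m)\<^sup>2 * (\<Sum>k\<le>K. \<bar>JB q k j\<bar>) + real m * (\<Sum>k\<le>K. real k * \<bar>JB q k j\<bar>)"
        by (simp add: c_def ring_distribs sum.distrib power2_eq_square mult.assoc flip: sum_distrib_left)
      also have "\<dots> \<le> 8 * (real m)\<^sup>2 * (\<Sum>k\<le>K. \<bar>JB q k j\<bar>) + 2 * real m * (\<Sum>k\<le>K. real k * \<bar>JB q k j\<bar>)"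
        by (intro add_mono mult_right_mono sum_nonneg) auto
      finally show "(\<Sum>k\<le>K. real (Suc k) * (\<Sum>i<nat (j - n). if 2 * i \<le> k then \<bar>JB q (k - 2 * i) j\<bar> else 0))
         \<le> 8 * (real (nat (j - n)))\<^sup>2 * (\<Sum>k\<le>K. \<bar>JB q k j\<bar>) + 2 * real (nat (j - n)) * (\<Sum>k\<le>K. real k * \<bar>JB q k j\<bar>)"
        unfolding m_def .
    qed (use Suc in \<open>auto intro!: sum_nonneg\<close>)
    finally show ?case .
  qed
  have n2: "(real K)\<^sup>2 * \<bar>JB q K n\<bar> \<le> M * (jw n)\<^sup>2 * jE q n" for n K
  \<comment> \<open>A single coefficient draws on every order \<open>k - 2 * i\<close>, hence strong
    induction.\<close>
  proof (induction K arbitrary: n rule: less_induct)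
    case (less K)
    show ?case
    proof (cases K)
      case 0
      thus ?thesis using M jE_ge_1[of q n] by simp
    next
      case (Suc k)
      have "(\<Sum>k\<in>{k}. (real (Suc k))\<^sup>2 * \<bar>JB q (Suc k) n\<bar>) \<le> M * (jw n)\<^sup>2 * jE q n"
      proof (rule fin[where Y="\<lambda>j. M * (jw j)\<^sup>2 * jE q j" and K=k])
        fix j assume j: "j > n"
        define m where "m = nat (j - n)"
        define x where "x l = \<bar>JB q l j\<bar>" for l
        define Y where "Y = M * (jw j)\<^sup>2 * jE q j"
        have "(real (Suc k))\<^sup>2 * (\<Sum>i<m. if 2 * i \<le> k then x (k - 2 * i) else 0)
            \<le> (\<Sum>i<m. 8 * (real m)\<^sup>2 * (if 2 * i \<le> k then x (k - 2 * i) else 0) + 2 * Y)"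
          unfolding sum_distrib_left
        proof (rule sum_mono)
          fix i assume i: "i \<in> {..<m}"
          show "(real (Suc k))\<^sup>2 * (if 2 * i \<le> k then x (k - 2 * i) else 0)
             \<le> 8 * (real m)\<^sup>2 * (if 2 * i \<le> k then x (k - 2 * i) else 0) + 2 * Y"
          proof (cases "2 * i \<le> k")
            case True
            define l where "l = k - 2 * i"
            have "real (Suc k) \<le> 2 * real m + real l" using True i by (auto simp: l_def)
            hence "(real (Suc k))\<^sup>2 \<le> (2 * real m + real l)\<^sup>2" by (intro power_mono) auto
            also have "\<dots> \<le> 8 * (real m)\<^sup>2 + 2 * (real l)\<^sup>2"
              using zero_le_power2[of "2 * real m - real l"] by (simp add: power2_eq_square algebra_simps)
            finally have "(real (Suc k))\<^sup>2 * x l \<le> (8 * (real m)\<^sup>2 + 2 * (real l)\<^sup>2) * x l"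
              by (intro mult_right_mono) (auto simp: x_def)
            also have "\<dots> = 8 * (real m)\<^sup>2 * x l + 2 * ((real l)\<^sup>2 * x l)" by (simp add: algebra_simps)
            also have "(real l)\<^sup>2 * x l \<le> Y" unfolding x_def Y_def
              by (rule less) (auto simp: Suc l_def)
            finally show ?thesis using True by (simp add: l_def)
          next
            case False
            thus ?thesis using M jE_ge_1[of q j] by (simp add: Y_def)
          qed
        qed
        also have "\<dots> = 8 * (real m)\<^sup>2 * (\<Sum>i<m. if 2 * i \<le> k then x (k - 2 * i) else 0) + 2 * real m * Y"
          by (simp add: sum.distrib sum_distrib_left)
        also have "\<dots> \<le> 8 * (real m)\<^sup>2 * (\<Sum>l\<le>k. x l) + 2 * real m * Y"
          by (intro add_mono mult_left_mono inner_sum_le') (auto simp: x_def)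
        finally show "(\<Sum>k\<in>{k}. (real (Suc k))\<^sup>2 * (\<Sum>i<nat (j - n). if 2 * i \<le> k then \<bar>JB q (k - 2 * i) j\<bar> else 0))
         \<le> 8 * (real (nat (j - n)))\<^sup>2 * (\<Sum>k\<le>k. \<bar>JB q k j\<bar>) + 2 * real (nat (j - n)) * (M * (jw j)\<^sup>2 * jE q j)"
          unfolding m_def x_def Y_def by simp
      next
        show "0 \<le> M * (jw j)\<^sup>2 * jE q j" for j using M jE_ge_1[of q j] by simp
      qed auto
      thus ?thesis by (simp add: Suc)
    qed
  qed
  define C where "C = E + M * E"
  have C: "C \<ge> 0" "E \<le> C" "M * E \<le> C" using E0 M by (auto simp: C_def)
  have "x \<le> C * (jw n)\<^sup>2" if "x \<le> M * (jw n)\<^sup>2 * jE q n" for x n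
  proof -
    have "M * (jw n)\<^sup>2 * jE q n \<le> M * (jw n)\<^sup>2 * E" using M E by (intro mult_left_mono) auto
    also have "\<dots> = M * E * (jw n)\<^sup>2" by simp
    also have "\<dots> \<le> C * (jw n)\<^sup>2" using C by (intro mult_right_mono) auto
    finally show ?thesis using that by simp
  qed
  moreover have "x \<le> C * jw n" if "x \<le> jw n * jE q n" for x n
  proof -
    have "jw n * jE q n \<le> jw n * C" using jw_ge_1[of n] E[of n] C by (intro mult_left_mono) auto
    thus ?thesis using that by (simp add: mult.commute)
  qed
  ultimately show ?thesis using C(1) n1 n2 JB_bound0(1)[OF dec] by (intro exI[of _ C] conjI allI) auto
qed

text \<open>Summability has to be known explicitly, since \<open>infsum\<close> defaults to 0. The
  kernel is based at \<open>n\<close> while the sum may run over a smaller half-line, as required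
  for comparing neighbouring sites.\<close>

lemma JB_summable:
  assumes "decaying q" "n \<le> n'"
  shows "(\<lambda>j. q j * (\<Sum>i<nat (j - n). if 2 * i \<le> k then JB q (k - 2 * i) j else 0)) summable_on {n'<..}" 
proof -
  have le: "norm (q j * (\<Sum>i<nat (j - n). if 2 * i \<le> k then JB q (k - 2 * i) j else 0)) \<le> jw n * (jp q j * jE q j)"
    if "n < j" for j
  proof -
    have "\<bar>\<Sum>i<nat (j - n). if 2 * i \<le> k then JB q (k - 2 * i) j else 0\<bar> 
       \<le> (\<Sum>i<nat (j - n). if 2 * i \<le> k then \<bar>JB q (k - 2 * i) j\<bar> else 0)"
      by (rule order_trans[OF sum_abs]) (intro sum_mono, auto)
    also have "\<dots> \<le> (\<Sum>k\<le>k. \<Sum>i<nat (j - n). if 2 * i \<le> k then \<bar>JB q (k - 2 * i) j\<bar> else 0)"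
      by (rule member_le_sum[where f="\<lambda>k. \<Sum>i<nat (j - n). if 2 * i \<le> k then \<bar>JB q (k - 2 * i) j\<bar> else 0"])
         (auto intro!: sum_nonneg)
    also have "\<dots> \<le> real (nat (j - n)) * (\<Sum>l\<le>k. \<bar>JB q l j\<bar>)" by (rule inner_sum_le) auto
    finally have "norm (q j * (\<Sum>i<nat (j - n). if 2 * i \<le> k then JB q (k - 2 * i) j else 0)) 
       \<le> \<bar>q j\<bar> * (real (nat (j - n)) * (\<Sum>l\<le>k. \<bar>JB q l j\<bar>))"
      unfolding real_norm_def abs_mult by (rule mult_left_mono) auto
    also have "\<dots> \<le> jw n * (jp q j * jE q j)"
      by (rule JB_bound0_aux[OF that JB_bound0(1)[OF assms(1)]])
    finally show ?thesis .
  qed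
  have "(\<lambda>j. jw n * (jp q j * jE q j)) summable_on {n<..}"
    by (intro summable_on_cmult_right jE_sum assms(1))
  hence "(\<lambda>j. q j * (\<Sum>i<nat (j - n). if 2 * i \<le> k then JB q (k - 2 * i) j else 0)) summable_on {n<..}"
    by (intro abs_summable_summable[OF Infinite_Sum.abs_summable_on_comparison_test'[OF _ le]]) auto
  thus ?thesis by (rule summable_on_subset_banach) (use assms(2) in auto)
qed

text \<open>The kernel based at \<open>n - 1\<close> has one term more than that based at
  \<open>n\<close>, namely \<open>i = j - n\<close>; everything else cancels. At
  \<open>j = n\<close> it is the only term.\<close>

lemma JB_diff:
  assumes dec: "decaying q"
  shows "JB q (Suc k) (n - 1) - JB q (Suc k) n =
         (\<Sum>\<^sub>\<infinity>j\<in>{n-1<..}. q j * (if 2 * nat (j - n) \<le> k then JB q (k - 2 * nat (j - n)) j else 0))"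
    and "(\<lambda>j. q j * (if 2 * nat (j - n) \<le> k then JB q (k - 2 * nat (j - n)) j else 0)) summable_on {n-1<..}"
proof -
  define T where "T j m = (\<Sum>i<m. if 2 * i \<le> k then JB q (k - 2 * i) j else 0)" for j m
  define t where "t j = q j * (if 2 * nat (j - n) \<le> k then JB q (k - 2 * nat (j - n)) j else 0)" for j
  have ins: "{n - 1<..} = insert n {n<..}" by auto
  have s1: "(\<lambda>j. q j * T j (nat (j - (n - 1)))) summable_on {n<..}"
    and s2: "(\<lambda>j. q j * T j (nat (j - n))) summable_on {n<..}"
    unfolding T_def by (rule JB_summable[OF dec], simp)+
  have t: "t j = q j * T j (nat (j - (n - 1))) - q j * T j (nat (j - n))" if "j \<ge> n" for j
  proof -
    have "nat (j - (n - 1)) = Suc (nat (j - n))" using that by auto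
    thus ?thesis by (simp add: T_def t_def algebra_simps)
  qed
  have ht: "(t has_sum ((\<Sum>\<^sub>\<infinity>j\<in>{n<..}. q j * T j (nat (j - (n - 1)))) + - (\<Sum>\<^sub>\<infinity>j\<in>{n<..}. q j * T j (nat (j - n))))) {n<..}"
    using has_sum_add[OF has_sum_infsum[OF s1] has_sum_uminusI[OF has_sum_infsum[OF s2]]]
    by (rule has_sum_cong[THEN iffD1, rotated]) (use t in auto)
  hence st: "t summable_on {n<..}" by (rule has_sum_imp_summable)
  have tn: "q n * T n (nat (n - (n - 1))) = t n" using t[of n] by (simp add: T_def)
  have "JB q (Suc k) (n - 1) = t n + (\<Sum>\<^sub>\<infinity>j\<in>{n<..}. q j * T j (nat (j - (n - 1))))"
    unfolding JB.simps ins T_def[symmetric] using s1 tn by (subst infsum_insert) auto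
  moreover have "JB q (Suc k) n = (\<Sum>\<^sub>\<infinity>j\<in>{n<..}. q j * T j (nat (j - n)))"
    unfolding JB.simps T_def[symmetric] ..
  ultimately have "JB q (Suc k) (n - 1) - JB q (Suc k) n = t n + (\<Sum>\<^sub>\<infinity>j\<in>{n<..}. t j)"
    using infsumI[OF ht] by simp
  also have "\<dots> = (\<Sum>\<^sub>\<infinity>j\<in>{n-1<..}. t j)"
    unfolding ins using st by (subst infsum_insert) auto
  finally show "JB q (Suc k) (n - 1) - JB q (Suc k) n =
         (\<Sum>\<^sub>\<infinity>j\<in>{n-1<..}. q j * (if 2 * nat (j - n) \<le> k then JB q (k - 2 * nat (j - n)) j else 0))"
    by (simp only: t_def)
  show "(\<lambda>j. q j * (if 2 * nat (j - n) \<le> k then JB q (k - 2 * nat (j - n)) j else 0)) summable_on {n-1<..}"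
    unfolding t_def[symmetric] ins using st by (simp add: summable_on_insert_iff)
qed

text \<open>Beyond the site \<open>j = n\<close>, the sum in \<open>JB_diff\<close> at order
  \<open>k\<close> is the same sum at order \<open>k - 2\<close> based at \<open>n + 1\<close>,
  hence a difference of coefficients one site further right.\<close>

lemma JB_recurrence:
  assumes dec: "decaying q"
  shows "JB q (Suc k) (n - 1) - JB q (Suc k) n =
     q n * JB q k n + (if k = 0 then 0 else JB q (k - 1) n - JB q (k - 1) (n + 1))"
proof -
  define t where "t k n j = q j * (if 2 * nat (j - n) \<le> k then JB q (k - 2 * nat (j - n)) j else 0)" for k n j
  have ins: "{n - 1<..} = insert n {n<..}" by auto
  have d: "JB q (Suc k) (n - 1) - JB q (Suc k) n = (\<Sum>\<^sub>\<infinity>j\<in>{n-1<..}. t k n j)" 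
    and s: "t k n summable_on {n-1<..}" for k n
    using JB_diff[OF dec, where k=k and n=n] by (simp_all add: t_def[abs_def])
  have "t k n summable_on {n<..}" using s[of k n] by (rule summable_on_subset_banach) auto
  hence eq: "JB q (Suc k) (n - 1) - JB q (Suc k) n = q n * JB q k n + (\<Sum>\<^sub>\<infinity>j\<in>{n<..}. t k n j)"
    unfolding d ins by (subst infsum_insert) (auto simp: t_def)
  show ?thesis
  proof (cases "k \<ge> 2")
    case False
    \<comment> \<open>For \<open>k < 2\<close> the condition \<open>2 * (j - n) \<le> k\<close>
      fails for all \<open>j > n\<close>. At \<open>k = 1\<close> the difference on the right-hand
      side vanishes too, since coefficients of order 0 are constantly 1.\<close>
    have "(\<Sum>\<^sub>\<infinity>j\<in>{n<..}. t k n j) = 0"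
      by (rule infsum_0) (use False in \<open>auto simp: t_def\<close>)
    moreover have "k = 0 \<or> k = 1" using False by auto
    ultimately show ?thesis using eq by auto
  next
    case True
    then obtain k' where k': "k = Suc (Suc k')" by (metis Suc_le_D numeral_2_eq_2 Suc_le_mono)
    have "(\<Sum>\<^sub>\<infinity>j\<in>{n<..}. t k n j) = (\<Sum>\<^sub>\<infinity>j\<in>{(n + 1) - 1<..}. t k' (n + 1) j)"
    proof (rule infsum_cong_neutral)
      fix j assume "j \<in> {n<..} \<inter> {(n + 1) - 1<..}"
      hence "nat (j - n) = Suc (nat (j - (n + 1)))" by auto
      thus "t k n j = t k' (n + 1) j" by (simp add: t_def k')
    qed auto
    thus ?thesis using eq d[of k' "n + 1"] by (simp add: k')
  qed
qed


subsection \<open>Absolutely convergent power series on the closed unit disc\<close>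

definition ps :: "(nat \<Rightarrow> complex) \<Rightarrow> complex \<Rightarrow> complex" where
  "ps a z = (\<Sum>k. a k * z ^ k)"

definition pd :: "(nat \<Rightarrow> complex) \<Rightarrow> complex \<Rightarrow> complex" where
  "pd a z = (\<Sum>k. a k * (of_nat k * z ^ (k - 1)))"

definition conv :: "(nat \<Rightarrow> complex) \<Rightarrow> (nat \<Rightarrow> complex) \<Rightarrow> nat \<Rightarrow> complex" where
  "conv a b k = (\<Sum>i\<le>k. a i * b (k - i))"

text \<open>The bounds of \<open>JB_bound12\<close> with the site dependence isolated in
  \<open>v\<close>: sums of coefficients cost one factor \<open>v\<close>, the first and second
  moments cost two.\<close>

definition cls :: "real \<Rightarrow> real \<Rightarrow> (nat \<Rightarrow> complex) \<Rightarrow> bool" where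
  "cls M v a \<longleftrightarrow> (\<forall>K. (\<Sum>k\<le>K. cmod (a k)) \<le> M * v) \<and> (\<forall>K. (\<Sum>k\<le>K. real k * cmod (a k)) \<le> M * v\<^sup>2)
      \<and> (\<forall>k. (real k)\<^sup>2 * cmod (a k) \<le> M * v\<^sup>2)"

lemma clsD:
  assumes "cls M v a"
  shows "(\<Sum>k\<le>K. cmod (a k)) \<le> M * v" "(\<Sum>k\<le>K. real k * cmod (a k)) \<le> M * v\<^sup>2"
    "(real k)\<^sup>2 * cmod (a k) \<le> M * v\<^sup>2"
  using assms by (auto simp: cls_def)

lemma summable_suminf_atMost_bound:
  fixes f :: "nat \<Rightarrow> real"
  assumes "\<And>k. f k \<ge> 0" "\<And>K. (\<Sum>k\<le>K. f k) \<le> B"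
  shows "summable f" "suminf f \<le> B"
proof -
  have le: "(\<Sum>k<n. f k) \<le> B" for n
  proof -
    have "(\<Sum>k<n. f k) \<le> (\<Sum>k\<le>n. f k)" using assms(1) by (intro sum_mono2) auto
    thus ?thesis using assms(2)[of n] by linarith
  qed
  show "summable f" using assms(1) le by (rule summableI_nonneg_bounded)
  thus "suminf f \<le> B" using le by (intro suminf_le_const) auto
qed

lemma cls_summable:
  assumes "cls M v a"
  shows "summable (\<lambda>k. cmod (a k))" "(\<Sum>k. cmod (a k)) \<le> M * v" 
    "summable (\<lambda>k. real k * cmod (a k))" "(\<Sum>k. real k * cmod (a k)) \<le> M * v\<^sup>2"
  using summable_suminf_atMost_bound[of "\<lambda>k. cmod (a k)"] summable_suminf_atMost_bound[of "\<lambda>k. real k * cmod (a k)"]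
    clsD[OF assms] by auto

lemma ps_term_le:
  assumes "cmod z \<le> 1"
  shows "cmod (a k * z ^ k) \<le> cmod (a k)"
  using assms by (simp add: norm_mult norm_power mult_left_le power_le_one)

lemma ps_summable:
  assumes "summable (\<lambda>k. cmod (a k))" "cmod z \<le> 1"
  shows "summable (\<lambda>k. cmod (a k * z ^ k))" 
  by (rule summable_comparison_test[OF _ assms(1)]) (use ps_term_le[OF assms(2)] in auto)

lemma ps_sums:
  assumes "summable (\<lambda>k. cmod (a k))" "cmod z \<le> 1"
  shows "(\<lambda>k. a k * z ^ k) sums ps a z"
  unfolding ps_def by (intro summable_sums summable_norm_cancel[OF ps_summable[OF assms]])

lemma ps_bound:
  assumes "summable (\<lambda>k. cmod (a k))" "cmod z \<le> 1"
  shows "cmod (ps a z) \<le> (\<Sum>k. cmod (a k))"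
proof -
  have "cmod (ps a z) \<le> (\<Sum>k. cmod (a k * z ^ k))"
    unfolding ps_def by (rule summable_norm[OF ps_summable[OF assms]])
  also have "\<dots> \<le> (\<Sum>k. cmod (a k))"
    by (intro suminf_le ps_term_le ps_summable assms)
  finally show ?thesis .
qed

lemma cls_ps_bound: "cls M v a \<Longrightarrow> cmod z \<le> 1 \<Longrightarrow> cmod (ps a z) \<le> M * v"
  using ps_bound[of a z] cls_summable[of M v a] by force

lemma ps_mult:
  assumes "summable (\<lambda>k. cmod (a k))" "summable (\<lambda>k. cmod (b k))" "cmod z \<le> 1"
  shows "ps a z * ps b z = ps (conv a b) z"
proof -
  have "ps a z * ps b z = (\<Sum>k. \<Sum>i\<le>k. (a i * z ^ i) * (b (k - i) * z ^ (k - i)))"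
    unfolding ps_def by (rule Cauchy_product; rule ps_summable) (use assms in auto)
  also have "\<dots> = ps (conv a b) z"
    unfolding ps_def conv_def
  proof (rule arg_cong[where f=suminf], rule ext)
    fix k
    show "(\<Sum>i\<le>k. (a i * z ^ i) * (b (k - i) * z ^ (k - i))) = (\<Sum>i\<le>k. a i * b (k - i)) * z ^ k"
      unfolding sum_distrib_right
    proof (rule sum.cong)
      fix i assume "i \<in> {..k}"
      hence "z ^ k = z ^ i * z ^ (k - i)" by (simp flip: power_add)
      thus "(a i * z ^ i) * (b (k - i) * z ^ (k - i)) = a i * b (k - i) * z ^ k" by simp
    qed simp
  qed
  finally show ?thesis .
qed

lemma ps_diff:
  assumes "summable (\<lambda>k. cmod (a k))" "summable (\<lambda>k. cmod (b k))" "cmod z \<le> 1"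
  shows "ps a z - ps b z = ps (\<lambda>k. a k - b k) z"
  using sums_diff[OF ps_sums[OF assms(1,3)] ps_sums[OF assms(2,3)]]
  by (simp add: ps_def sums_iff algebra_simps)

lemma triangle_sum_le:
  fixes x y :: "nat \<Rightarrow> real"
  assumes "\<And>k. x k \<ge> 0" "\<And>k. y k \<ge> 0"
  shows "(\<Sum>k\<le>K. \<Sum>i\<le>k. x i * y (k - i)) \<le> (\<Sum>k\<le>K. x k) * (\<Sum>k\<le>K. y k)"
proof -
  have "(\<Sum>k\<le>K. \<Sum>i\<le>k. x i * y (k - i)) = (\<Sum>(i,j)\<in>{(i,j). i + j \<le> K}. x i * y j)"
    by (rule sum.triangle_reindex_eq[symmetric])
  also have "\<dots> \<le> (\<Sum>(i,j)\<in>{..K} \<times> {..K}. x i * y j)"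
    by (rule sum_mono2) (use assms in auto)
  also have "\<dots> = (\<Sum>k\<le>K. x k) * (\<Sum>k\<le>K. y k)"
    by (simp add: sum_product sum.cartesian_product)
  finally show ?thesis .
qed

lemma conv_norm_le: "cmod (conv a b k) \<le> (\<Sum>i\<le>k. cmod (a i) * cmod (b (k - i)))"
  unfolding conv_def by (rule order_trans[OF norm_sum]) (simp add: norm_mult)

lemma conv_atMost_le:
  "(\<Sum>k\<le>K. cmod (conv a b k)) \<le> (\<Sum>k\<le>K. cmod (a k)) * (\<Sum>k\<le>K. cmod (b k))"
  by (rule order_trans[OF sum_mono[OF conv_norm_le] triangle_sum_le]) auto

text \<open>Only one factor may carry growth, which for the two Jost factors can always be arranged
  (\<open>jPc_cls\<close>). The second moment uses
  \<open>k\<^sup>2 \<le> 2 * i\<^sup>2 + 2 * (k - i)\<^sup>2\<close>, pairing the pointwise bound of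
  one sequence with the summability of the other.\<close>

lemma cls_conv:
  assumes a: "cls M v a" and b: "cls M' 1 b" and v: "v \<ge> 1"
  shows "cls (4 * M * M') v (conv a b)"
proof -
  have M: "M * v \<ge> 0" "M' \<ge> 0" using clsD(1)[OF a, of 0] clsD(1)[OF b, of 0] by (auto intro: order_trans[OF norm_ge_zero])
  hence M0: "M \<ge> 0" using v by (simp add: zero_le_mult_iff)
  have vv: "v \<le> v\<^sup>2" using v by (intro self_le_power) auto
  have MM: "M * v * M' \<le> M * M' * v\<^sup>2"
    using mult_left_mono[OF vv, of "M * M'"] M M0 by (simp add: mult_ac)
  have nn: "M * M' * v\<^sup>2 \<ge> 0" using M M0 by simp
  have nn': "M * M' * v \<ge> 0" using M M0 v by simp
  show ?thesis unfolding cls_def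
  proof (intro conjI allI)
    fix K
    have "(\<Sum>k\<le>K. cmod (conv a b k)) \<le> (\<Sum>k\<le>K. cmod (a k)) * (\<Sum>k\<le>K. cmod (b k))"
      by (rule conv_atMost_le)
    also have "\<dots> \<le> (M * v) * (M' * 1)"
      by (intro mult_mono clsD(1)[OF a] clsD(1)[OF b] M sum_nonneg) auto
    finally show "(\<Sum>k\<le>K. cmod (conv a b k)) \<le> 4 * M * M' * v" using nn' by (simp add: mult_ac)
  next
    fix K
    have "(\<Sum>k\<le>K. real k * cmod (conv a b k)) \<le> (\<Sum>k\<le>K. (\<Sum>i\<le>k. (real i * cmod (a i)) * cmod (b (k - i))) + (\<Sum>i\<le>k. cmod (a i) * (real (k - i) * cmod (b (k - i)))))"
    proof (rule sum_mono)
      fix k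
      have "real k * cmod (conv a b k) \<le> real k * (\<Sum>i\<le>k. cmod (a i) * cmod (b (k - i)))"
        by (intro mult_left_mono conv_norm_le) auto
      also have "\<dots> = (\<Sum>i\<le>k. (real i * cmod (a i)) * cmod (b (k - i))) + (\<Sum>i\<le>k. cmod (a i) * (real (k - i) * cmod (b (k - i))))"
        unfolding sum.distrib[symmetric] sum_distrib_left
        by (intro sum.cong) (auto simp: of_nat_diff algebra_simps)
      finally show "real k * cmod (conv a b k) \<le> (\<Sum>i\<le>k. (real i * cmod (a i)) * cmod (b (k - i))) + (\<Sum>i\<le>k. cmod (a i) * (real (k - i) * cmod (b (k - i))))" .
    qed
    also have "\<dots> \<le> (\<Sum>k\<le>K. real k * cmod (a k)) * (\<Sum>k\<le>K. cmod (b k)) + (\<Sum>k\<le>K. cmod (a k)) * (\<Sum>k\<le>K. real k * cmod (b k))"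
      unfolding sum.distrib 
      using triangle_sum_le[of "\<lambda>i. real i * cmod (a i)" "\<lambda>j. cmod (b j)" K] 
        triangle_sum_le[of "\<lambda>i. cmod (a i)" "\<lambda>j. real j * cmod (b j)" K] by simp
    also have "\<dots> \<le> (M * v\<^sup>2) * (M' * 1) + (M * v) * (M' * 1\<^sup>2)"
      using M M0 by (intro add_mono mult_mono clsD[OF a] clsD[OF b] sum_nonneg) auto
    finally show "(\<Sum>k\<le>K. real k * cmod (conv a b k)) \<le> 4 * M * M' * v\<^sup>2"
      using MM nn by (simp add: mult_ac)
  next
    fix k
    have "(real k)\<^sup>2 * cmod (conv a b k) \<le> (real k)\<^sup>2 * (\<Sum>i\<le>k. cmod (a i) * cmod (b (k - i)))"
      by (intro mult_left_mono conv_norm_le) auto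
    also have "\<dots> \<le> (\<Sum>i\<le>k. 2 * (M * v\<^sup>2) * cmod (b (k - i)) + 2 * M' * cmod (a i))"
      unfolding sum_distrib_left
    proof (rule sum_mono)
      fix i assume i: "i \<in> {..k}"
      have "(real k)\<^sup>2 \<le> 2 * (real i)\<^sup>2 + 2 * (real (k - i))\<^sup>2"
        using zero_le_power2[of "real i - real (k - i)"] i by (simp add: of_nat_diff power2_eq_square algebra_simps)
      hence "(real k)\<^sup>2 * (cmod (a i) * cmod (b (k - i))) \<le> (2 * (real i)\<^sup>2 + 2 * (real (k - i))\<^sup>2) * (cmod (a i) * cmod (b (k - i)))"
        by (intro mult_right_mono) auto
      also have "\<dots> = 2 * ((real i)\<^sup>2 * cmod (a i)) * cmod (b (k - i)) + 2 * ((real (k - i))\<^sup>2 * cmod (b (k - i))) * cmod (a i)"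
        by (simp add: algebra_simps)
      also have "\<dots> \<le> 2 * (M * v\<^sup>2) * cmod (b (k - i)) + 2 * M' * cmod (a i)"
        using clsD(3)[OF a, of i] clsD(3)[OF b, of "k - i"] by (intro add_mono mult_right_mono mult_left_mono) auto
      finally show "(real k)\<^sup>2 * (cmod (a i) * cmod (b (k - i))) \<le> 2 * (M * v\<^sup>2) * cmod (b (k - i)) + 2 * M' * cmod (a i)" .
    qed
    also have "\<dots> = 2 * (M * v\<^sup>2) * (\<Sum>j\<le>k. cmod (b j)) + 2 * M' * (\<Sum>i\<le>k. cmod (a i))"
    proof -
      have "(\<Sum>i\<le>k. cmod (b (k - i))) = (\<Sum>j\<le>k. cmod (b j))"
        by (rule sum.reindex_bij_witness[where i="\<lambda>j. k - j" and j="\<lambda>j. k - j"]) auto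
      thus ?thesis by (simp add: sum.distrib flip: sum_distrib_left)
    qed
    also have "\<dots> \<le> 2 * (M * v\<^sup>2) * (M' * 1) + 2 * M' * (M * v)"
      using M M0 by (intro add_mono mult_left_mono clsD[OF a] clsD[OF b]) auto
    finally show "(real k)\<^sup>2 * cmod (conv a b k) \<le> 4 * M * M' * v\<^sup>2"
      using MM nn by (simp add: mult_ac)
  qed
qed

lemma cls_mono:
  assumes "cls M v a" "M \<le> M'" "v \<ge> 1"
  shows "cls M' v a"
proof -
  have "M * v \<le> M' * v" "M * v\<^sup>2 \<le> M' * v\<^sup>2" using assms by (auto intro!: mult_right_mono)
  thus ?thesis using clsD[OF assms(1)] unfolding cls_def by (meson order_trans)
qed

lemma cls_diff:
  assumes a: "cls M v a" and b: "cls M' v b"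
  shows "cls (M + M') v (\<lambda>k. a k - b k)"
  unfolding cls_def
proof (intro conjI allI)
  fix K
  have "(\<Sum>k\<le>K. cmod (a k - b k)) \<le> (\<Sum>k\<le>K. cmod (a k) + cmod (b k))" by (intro sum_mono norm_triangle_ineq4)
  thus "(\<Sum>k\<le>K. cmod (a k - b k)) \<le> (M + M') * v"
    using clsD(1)[OF a, of K] clsD(1)[OF b, of K] by (simp add: sum.distrib algebra_simps)
  have "(\<Sum>k\<le>K. real k * cmod (a k - b k)) \<le> (\<Sum>k\<le>K. real k * (cmod (a k) + cmod (b k)))"
    by (intro sum_mono mult_left_mono norm_triangle_ineq4) auto
  thus "(\<Sum>k\<le>K. real k * cmod (a k - b k)) \<le> (M + M') * v\<^sup>2"
    using clsD(2)[OF a, of K] clsD(2)[OF b, of K] by (simp add: sum.distrib algebra_simps)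
next
  fix k
  have "(real k)\<^sup>2 * cmod (a k - b k) \<le> (real k)\<^sup>2 * (cmod (a k) + cmod (b k))"
    by (intro mult_left_mono norm_triangle_ineq4) auto
  thus "(real k)\<^sup>2 * cmod (a k - b k) \<le> (M + M') * v\<^sup>2"
    using clsD(3)[OF a, of k] clsD(3)[OF b, of k] by (simp add: algebra_simps)
qed

lemma cls_monomial: "cls 4 1 (\<lambda>k. if k = 2 then 1 else 0)"
proof -
  have "(\<Sum>k\<le>K. real k * cmod (if k = 2 then 1 else 0)) = (if 2 \<le> K then 2 else 0)" for K
    by (induction K) auto
  moreover have "(\<Sum>k\<le>K. cmod (if k = 2 then 1 else 0)) = (if 2 \<le> K then 1 else 0)" for K :: nat
    by (induction K) auto
  ultimately show ?thesis unfolding cls_def by auto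
qed

lemma ps_monomial: "ps (\<lambda>k. if k = 2 then 1 else 0) z = z\<^sup>2"
proof -
  have "(\<lambda>k. (if k = 2 then 1 else 0) * z ^ k) = (\<lambda>k. if k = 2 then z ^ k else 0)" by auto
  thus ?thesis unfolding ps_def using sums_single[of 2 "\<lambda>k. z ^ k"] by (simp add: sums_iff)
qed

text \<open>The derivative is taken relative to the closed disc, boundary included, since the kernel
  lives on the circle; the first moment is the uniform majorant of the differentiated
  series.\<close>

lemma ps_has_derivative:
  assumes a: "summable (\<lambda>k. cmod (a k))" "summable (\<lambda>k. real k * cmod (a k))" and z: "cmod z \<le> 1"
  shows "(ps a has_field_derivative pd a z) (at z within cball 0 1)"
proof -
  have "\<exists>g. \<forall>x\<in>cball 0 1. (\<lambda>k. a k * x ^ k) sums g x \<and> (g has_field_derivative pd a x) (at x within cball 0 1)"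
  proof (rule has_field_derivative_series[where f'="\<lambda>k x. a k * (of_nat k * x ^ (k - 1))" and ?x0.0=0])
    show "uniform_limit (cball 0 1) (\<lambda>n x. \<Sum>i<n. a i * (of_nat i * x ^ (i - 1))) (pd a) sequentially"
      unfolding pd_def
    proof (rule Weierstrass_m_test[OF _ a(2)])
      fix k and x :: complex assume "x \<in> cball 0 1"
      hence "cmod x ^ (k - 1) \<le> 1" by (intro power_le_one) auto
      hence "real k * cmod (a k) * cmod x ^ (k - 1) \<le> real k * cmod (a k) * 1"
        by (intro mult_left_mono) auto
      thus "norm (a k * (of_nat k * x ^ (k - 1))) \<le> real k * cmod (a k)"
        by (simp add: norm_mult norm_power mult_ac)
    qed
    show "summable (\<lambda>k. a k * 0 ^ k)" using ps_sums[OF a(1), of 0] by (simp add: sums_iff)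
  qed (auto intro!: derivative_eq_intros)
  then obtain g where g: "\<And>x. x \<in> cball 0 1 \<Longrightarrow> (\<lambda>k. a k * x ^ k) sums g x"
     "\<And>x. x \<in> cball 0 1 \<Longrightarrow> (g has_field_derivative pd a x) (at x within cball 0 1)" by blast
  show ?thesis unfolding has_field_derivative_def
  proof (rule has_derivative_transform[OF _ _ g(2)[unfolded has_field_derivative_def]])
    show "ps a x = g x" if "x \<in> cball 0 1" for x
      using sums_unique2[OF g(1)[OF that] ps_sums[OF a(1), of x]] that by simp
  qed (use z in auto)
qed

lemma ps_continuous_on:
  assumes a: "summable (\<lambda>k. cmod (a k))"
  shows "continuous_on (cball 0 1) (ps a)"
proof (rule uniform_limit_theorem)
  show "uniform_limit (cball 0 1) (\<lambda>n x. \<Sum>i<n. a i * x ^ i) (ps a) sequentially"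
    unfolding ps_def by (rule Weierstrass_m_test[OF _ a]) (simp add: ps_term_le)
qed (auto intro!: continuous_intros always_eventually)

lemma z_pd_summable:
  assumes "summable (\<lambda>k. real k * cmod (a k))"
  shows "summable (\<lambda>k. cmod (of_nat k * a k))"
  using assms by (simp add: norm_mult)

text \<open>Multiplication by \<open>z\<close> keeps the derivative among series of the same kind;
  on the circle this is the angular derivative up to the factor \<open>\<i>\<close>.\<close>

lemma z_pd:
  assumes "summable (\<lambda>k. real k * cmod (a k))" "cmod z \<le> 1"
  shows "z * pd a z = ps (\<lambda>k. of_nat k * a k) z"
proof -
  have "summable (\<lambda>k. a k * (of_nat k * z ^ (k - 1)))"
  proof (rule summable_norm_cancel, rule summable_comparison_test[OF _ assms(1)], intro exI allI impI)
    fix k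
    have "cmod z ^ (k - 1) \<le> 1" using assms by (intro power_le_one) auto
    hence "real k * cmod (a k) * cmod z ^ (k - 1) \<le> real k * cmod (a k) * 1"
      by (intro mult_left_mono) auto
    thus "norm (norm (a k * (of_nat k * z ^ (k - 1)))) \<le> real k * cmod (a k)"
      by (simp add: norm_mult norm_power mult_ac)
  qed
  hence "z * pd a z = (\<Sum>k. z * (a k * (of_nat k * z ^ (k - 1))))"
    unfolding pd_def by (rule suminf_mult[symmetric])
  also have "\<dots> = ps (\<lambda>k. of_nat k * a k) z"
    unfolding ps_def
  proof (rule arg_cong[where f=suminf], rule ext)
    show "z * (a k * (of_nat k * z ^ (k - 1))) = of_nat k * a k * z ^ k" for k
      by (cases k) auto
  qed
  finally show ?thesis .
qed

subsection \<open>The Jost solutions\<close>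

definition jh :: "(int \<Rightarrow> real) \<Rightarrow> int \<Rightarrow> complex \<Rightarrow> complex" where
  "jh q n = ps (JBc q n)"

definition jf :: "(int \<Rightarrow> real) \<Rightarrow> complex \<Rightarrow> int \<Rightarrow> complex" where
  "jf q z n = z powi n * jh q n z"

definition om :: "complex \<Rightarrow> complex" where "om z = 2 - z - inverse z"

lemma JB_cls:
  assumes "decaying q"
  shows "\<exists>C\<ge>0. \<forall>n. cls C (jw n) (JBc q n)"
proof -
  obtain C where "C \<ge> 0 \<and> (\<forall>n K. (\<Sum>k\<le>K. \<bar>JB q k n\<bar>) \<le> C * jw n \<and> 
      (\<Sum>k\<le>K. real k * \<bar>JB q k n\<bar>) \<le> C * (jw n)\<^sup>2 \<and> (real K)\<^sup>2 * \<bar>JB q K n\<bar> \<le> C * (jw n)\<^sup>2)"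
    using JB_bound12[OF assms] by (rule exE)
  hence C: "C \<ge> 0" "\<And>n K. (\<Sum>k\<le>K. \<bar>JB q k n\<bar>) \<le> C * jw n \<and> 
      (\<Sum>k\<le>K. real k * \<bar>JB q k n\<bar>) \<le> C * (jw n)\<^sup>2 \<and> (real K)\<^sup>2 * \<bar>JB q K n\<bar> \<le> C * (jw n)\<^sup>2"
    by simp_all
  have "cls C (jw n) (JBc q n)" for n
    unfolding cls_def norm_of_real using C(2)[of n] by simp
  thus ?thesis using C(1) by auto
qed

lemma JB_abs_summable:
  assumes "decaying q"
  shows "summable (\<lambda>k. cmod (complex_of_real (JB q k n)))" 
proof -
  obtain C where C: "cls C (jw n) (JBc q n)" using JB_cls[OF assms] by auto
  show ?thesis by (rule cls_summable(1)[OF C])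
qed

lemma jh_continuous_on: "decaying q \<Longrightarrow> continuous_on (cball 0 1) (jh q n)"
  unfolding jh_def by (intro ps_continuous_on JB_abs_summable)

lemma jh_holomorphic_on:
  assumes "decaying q"
  shows "jh q n holomorphic_on ball 0 1"
proof -
  obtain C where C: "cls C (jw n) (JBc q n)" using JB_cls[OF assms] by auto
  show ?thesis unfolding holomorphic_on_open[OF open_ball]
  proof
    fix z :: complex assume z: "z \<in> ball 0 1"
    have "(jh q n has_field_derivative pd (JBc q n) z) (at z within ball 0 1)"
      unfolding jh_def
      by (rule has_field_derivative_subset[OF ps_has_derivative[OF cls_summable(1,3)[OF C]]]) (use z in auto)
    thus "\<exists>f'. (jh q n has_field_derivative f') (at z)"
      using at_within_open[OF z open_ball] by auto
  qed
qed

lemma jh_0: "jh q n 0 = 1"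
proof -
  have "(\<lambda>k. complex_of_real (JB q k n) * 0 ^ k) = (\<lambda>k. if k = 0 then complex_of_real (JB q k n) else 0)" by auto
  thus ?thesis unfolding jh_def ps_def using sums_single[of 0 "\<lambda>k. complex_of_real (JB q k n)"] by (simp add: sums_iff)
qed

lemma jh_cnj:
  assumes "decaying q" "cmod z \<le> 1"
  shows "jh q n (cnj z) = cnj (jh q n z)"
proof -
  have "(\<lambda>k. cnj (complex_of_real (JB q k n) * z ^ k)) sums cnj (jh q n z)"
    unfolding sums_cnj jh_def by (intro ps_sums JB_abs_summable assms)
  thus ?thesis by (simp add: jh_def ps_def sums_iff)
qed

lemma jh_bound:
  assumes "decaying q"
  shows "\<exists>C\<ge>0. \<forall>n z. cmod z \<le> 1 \<longrightarrow> cmod (jh q n z) \<le> C * jw n"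
proof -
  obtain C where C: "C \<ge> 0" "\<And>n. cls C (jw n) (JBc q n)" using JB_cls[OF assms] by auto
  show ?thesis unfolding jh_def using C(1) cls_ps_bound[OF C(2)] by (intro exI[of _ C]) simp
qed

lemma jh_minus_1_bound:
  assumes "decaying q" "cmod z \<le> 1"
  shows "cmod (jh q n z - 1) \<le> jw n * (jE q n - 1)"
proof -
  have s: "(\<lambda>k. complex_of_real (JB q k n) * z ^ k) sums jh q n z"
    unfolding jh_def by (intro ps_sums JB_abs_summable assms)
  hence "(\<lambda>k. complex_of_real (JB q (Suc k) n) * z ^ Suc k) sums (jh q n z - 1)"
    using sums_Suc_iff[of "\<lambda>k. complex_of_real (JB q k n) * z ^ k"] by simp
  hence eq: "jh q n z - 1 = (\<Sum>k. complex_of_real (JB q (Suc k) n) * z ^ Suc k)" 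
    by (simp only: sums_iff)
  have b: "summable (\<lambda>k. \<bar>JB q (Suc k) n\<bar>)" "(\<Sum>k. \<bar>JB q (Suc k) n\<bar>) \<le> jw n * (jE q n - 1)"
    using summable_suminf_atMost_bound[of "\<lambda>k. \<bar>JB q (Suc k) n\<bar>"] JB_bound0(2)[OF assms(1)] by auto
  have le: "cmod (complex_of_real (JB q (Suc k) n) * z ^ Suc k) \<le> \<bar>JB q (Suc k) n\<bar>" for k
    using ps_term_le[OF assms(2), of "\<lambda>k. complex_of_real (JB q k n)" "Suc k"] by simp
  have sn: "summable (\<lambda>k. cmod (complex_of_real (JB q (Suc k) n) * z ^ Suc k))"
    by (rule summable_comparison_test[OF _ b(1)]) (use le in auto)
  have "cmod (jh q n z - 1) \<le> (\<Sum>k. cmod (complex_of_real (JB q (Suc k) n) * z ^ Suc k))"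
    unfolding eq by (rule summable_norm[OF sn])
  also have "\<dots> \<le> (\<Sum>k. \<bar>JB q (Suc k) n\<bar>)" by (intro suminf_le le sn b)
  finally show ?thesis using b(2) by linarith
qed

lemma jh_tendsto:
  assumes "decaying q" "cmod z \<le> 1"
  shows "(\<lambda>N. jh q (int N) z) \<longlonglongrightarrow> 1"
proof -
  have "(\<lambda>N. jE q (int N) - 1) \<longlonglongrightarrow> 1 - 1"
    by (rule tendsto_diff[OF jE_tendsto[OF assms(1)] tendsto_const])
  moreover have le: "cmod (jh q (int N) z - 1) \<le> jE q (int N) - 1" for N
    using jh_minus_1_bound[OF assms, of "int N"] by (simp add: jw_def)
  ultimately have "(\<lambda>N. jh q (int N) z - 1) \<longlonglongrightarrow> 0"
    by (intro Lim_null_comparison[OF always_eventually[OF allI[OF le]]]) simp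
  thus ?thesis by (simp add: LIM_zero_iff)
qed

text \<open>Comparison of Taylor coefficients. \<open>JB_recurrence\<close> lives at order
  \<open>Suc k\<close>, so the constant coefficients, all equal to 1, are split off.\<close>

lemma jh_recurrence:
  assumes dec: "decaying q" and z: "cmod z \<le> 1"
  shows "jh q (n - 1) z - jh q n z = z * q n * jh q n z + z\<^sup>2 * (jh q n z - jh q (n + 1) z)"
proof -
  define b where "b k n = complex_of_real (JB q k n)" for k n
  have s: "(\<lambda>k. b k n * z ^ k) sums jh q n z" for n
    unfolding jh_def b_def by (intro ps_sums JB_abs_summable assms)
  have "(\<lambda>k. b k (n - 1) * z ^ k - b k n * z ^ k) sums (jh q (n - 1) z - jh q n z)"
    by (intro sums_diff s)
  hence l: "(\<lambda>k. b (Suc k) (n - 1) * z ^ Suc k - b (Suc k) n * z ^ Suc k) sums (jh q (n - 1) z - jh q n z)"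
    using sums_Suc_iff[of "\<lambda>k. b k (n - 1) * z ^ k - b k n * z ^ k"] by (simp add: b_def)
  define g where "g k = (if k = 0 then 0 else (b (k - 1) n - b (k - 1) (n + 1)) * z ^ Suc k)" for k
  have "(\<lambda>k. z\<^sup>2 * (b k n * z ^ k - b k (n + 1) * z ^ k)) sums (z\<^sup>2 * (jh q n z - jh q (n + 1) z))"
    by (intro sums_mult sums_diff s)
  hence "(\<lambda>k. g (Suc k)) sums (z\<^sup>2 * (jh q n z - jh q (n + 1) z))"
    by (simp add: g_def power2_eq_square algebra_simps)
  hence "g sums (z\<^sup>2 * (jh q n z - jh q (n + 1) z))"
    using sums_Suc_iff[of g] by (simp add: g_def)
  moreover have "(\<lambda>k. z * q n * (b k n * z ^ k)) sums (z * q n * jh q n z)"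
    by (intro sums_mult s)
  ultimately have "(\<lambda>k. z * q n * (b k n * z ^ k) + g k) sums (z * q n * jh q n z + z\<^sup>2 * (jh q n z - jh q (n + 1) z))"
    by (intro sums_add)
  moreover have "z * q n * (b k n * z ^ k) + g k = b (Suc k) (n - 1) * z ^ Suc k - b (Suc k) n * z ^ Suc k" for k
  proof -
    have "b (Suc k) (n - 1) - b (Suc k) n = of_real (q n) * b k n + (if k = 0 then 0 else b (k - 1) n - b (k - 1) (n + 1))"
      using arg_cong[OF JB_recurrence[OF dec, of k n], of complex_of_real] by (auto simp: b_def)
    hence "(b (Suc k) (n - 1) - b (Suc k) n) * z ^ Suc k = (of_real (q n) * b k n + (if k = 0 then 0 else b (k - 1) n - b (k - 1) (n + 1))) * z ^ Suc k"
      by simp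
    thus ?thesis by (auto simp: g_def algebra_simps)
  qed
  ultimately show ?thesis using sums_unique2[OF l] by simp
qed

lemma jf_solution:
  assumes dec: "decaying q" and z: "cmod z \<le> 1" "z \<noteq> 0"
  shows "Hop q (jf q z) = (\<lambda>n. om z * jf q z n)"
proof
  fix n
  have "jh q (n - 1) z = jh q n z + z * q n * jh q n z + z\<^sup>2 * (jh q n z - jh q (n + 1) z)"
    using jh_recurrence[OF dec z(1), of n] by (simp add: algebra_simps)
  hence "inverse z * jh q (n - 1) z = inverse z * jh q n z + q n * jh q n z + z * (jh q n z - jh q (n + 1) z)"
    using z by (simp add: field_simps power2_eq_square)
  moreover have "z powi (n + 1) = z powi n * z" "z powi (n - 1) = z powi n * inverse z"
    using z by (simp_all add: power_int_add power_int_diff divide_inverse)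
  ultimately have "jf q z (n - 1) = z powi n * (inverse z * jh q n z + q n * jh q n z + z * (jh q n z - jh q (n + 1) z))"
    "jf q z (n + 1) = z powi n * (z * jh q (n + 1) z)"
    "jf q z n = z powi n * jh q n z"
    by (simp_all add: jf_def mult.assoc)
  thus "Hop q (jf q z) n = om z * jf q z n"
    unfolding Hop_def om_def by (simp only:) (simp add: algebra_simps)
qed

lemma jf_cnj:
  assumes "decaying q" "cmod z \<le> 1"
  shows "jf q (cnj z) n = cnj (jf q z n)"
  using jh_cnj[OF assms] by (simp add: jf_def)

definition reflected :: "(int \<Rightarrow> 'a) \<Rightarrow> int \<Rightarrow> 'a" where "reflected q n = q (- n)"

lemma decaying_reflected: "decaying q \<Longrightarrow> decaying (reflected q)"
proof -
  assume "decaying q"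
  moreover have b: "bij_betw (\<lambda>n. - n) UNIV (UNIV :: int set)"
    by (rule bij_betwI[where g="\<lambda>n. - n"]) auto
  ultimately show ?thesis
    using summable_on_reindex_bij_betw[OF b, of "\<lambda>n. (wt n)\<^sup>2 * \<bar>q n\<bar>"]
    by (simp add: decaying_def reflected_def)
qed

text \<open>The Jost solution behaving like \<open>z powi (- n)\<close> at
  \<open>-\<infinity>\<close>. Defining it by reflection transfers every estimate on
  \<open>jf\<close>.\<close>

definition jg :: "(int \<Rightarrow> real) \<Rightarrow> complex \<Rightarrow> int \<Rightarrow> complex" where
  "jg q z n = jf (reflected q) z (- n)"

lemma jg_solution:
  assumes dec: "decaying q" and z: "cmod z \<le> 1" "z \<noteq> 0"
  shows "Hop q (jg q z) = (\<lambda>n. om z * jg q z n)"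
proof
  fix n
  have "Hop (reflected q) (jf (reflected q) z) (- n) = om z * jf (reflected q) z (- n)"
    using jf_solution[OF decaying_reflected[OF dec] z] by simp
  moreover have "- n + 1 = - (n - 1)" "- n - 1 = - (n + 1)" by auto
  ultimately show "Hop q (jg q z) n = om z * jg q z n"
    unfolding Hop_def jg_def by (simp add: reflected_def algebra_simps)
qed


subsection \<open>An oscillatory integral\<close>

context
  fixes t :: real and e :: nat
  assumes t: "t \<ge> 1" and e: "real e \<le> t"
begin

text \<open>The derivative of the phase \<open>2 * t * cos \<theta> + e * \<theta>\<close>.\<close>

qualified definition pp :: "real \<Rightarrow> real" where "pp \<theta> = real e - 2 * t * sin \<theta>"
text \<open>The remainder \<open>1 - pp * R\<close> for the quotient
  \<open>R = pp / (pp\<^sup>2 + t)\<close>. It is of order 1 only where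
  \<open>\<bar>pp\<bar>\<close> is at most of order \<open>sqrt t\<close>, that is near the
  stationary points.\<close>

qualified definition SS :: "real \<Rightarrow> real" where "SS \<theta> = t / ((pp \<theta>)\<^sup>2 + t)"

lemma den_pos: "(pp \<theta>)\<^sup>2 + t > 0"
  using t by (intro add_nonneg_pos) auto

lemma SS_nonneg: "SS \<theta> \<ge> 0"
  using den_pos[of \<theta>] t by (simp add: SS_def)

lemma SS_continuous: "continuous_on A SS"
proof -
  have "(pp \<theta>)\<^sup>2 + t \<noteq> 0" for \<theta> using den_pos[of \<theta>] by simp
  thus ?thesis unfolding SS_def[abs_def] pp_def by (intro continuous_intros) auto
qed

text \<open>Since \<open>e \<le> t\<close>, stationary points have
  \<open>sin \<theta> = e / (2 * t) \<le> 1 / 2\<close> and stay away from the zeros of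
  \<open>cos\<close>. Where \<open>\<bar>cos \<theta>\<bar> < 1 / 2\<close>,
  \<open>\<bar>pp \<theta>\<bar>\<close> is at least \<open>t / 2\<close>, which gives the remainder
  \<open>4 / t\<close>.\<close>

lemma SS_pointwise: "SS \<theta> \<le> 2 * (\<bar>cos \<theta>\<bar> * SS \<theta>) + 4 / t"
proof -
  define D where "D = pp \<theta> / t"
  have one: "1 \<le> 2 * \<bar>cos \<theta>\<bar> + 4 * D\<^sup>2"
  proof (cases "\<bar>cos \<theta>\<bar> \<ge> 1 / 2")
    case False
    hence "(cos \<theta>)\<^sup>2 \<le> (1/2)\<^sup>2" by (intro abs_le_square_iff[THEN iffD1]) auto
    hence s: "(sin \<theta>)\<^sup>2 \<ge> 3 / 4" using sin_cos_squared_add[of \<theta>] by (simp add: power2_eq_square)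
    have x: "0 \<le> real e / t" "real e / t \<le> 1" using t e by auto
    have D: "D = real e / t - 2 * sin \<theta>" using t by (simp add: D_def pp_def field_simps)
    have "\<bar>sin \<theta>\<bar> \<ge> 3 / 4"
    proof (rule ccontr)
      assume "\<not> \<bar>sin \<theta>\<bar> \<ge> 3 / 4"
      hence "(sin \<theta>)\<^sup>2 \<le> (3/4)\<^sup>2" by (intro abs_le_square_iff[THEN iffD1]) auto
      thus False using s by (simp add: power2_eq_square)
    qed
    hence "\<bar>D\<bar> \<ge> 1 / 2" using x unfolding D by linarith
    hence "D\<^sup>2 \<ge> (1/2)\<^sup>2" by (intro abs_le_square_iff[THEN iffD1]) auto
    thus ?thesis by (simp add: power2_eq_square)
  qed (auto intro: add_increasing2)
  have "4 * D\<^sup>2 * SS \<theta> \<le> 4 / t"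
  proof -
    have "4 * D\<^sup>2 * SS \<theta> = 4 / t * ((pp \<theta>)\<^sup>2 / ((pp \<theta>)\<^sup>2 + t))"
      using t by (simp add: D_def SS_def power2_eq_square)
    also have "\<dots> \<le> 4 / t * 1"
      using t den_pos[of \<theta>] by (intro mult_left_mono) auto
    finally show ?thesis by simp
  qed
  moreover have "1 * SS \<theta> \<le> (2 * \<bar>cos \<theta>\<bar> + 4 * D\<^sup>2) * SS \<theta>"
    by (intro mult_right_mono one SS_nonneg)
  ultimately show ?thesis by (simp add: ring_distribs)
qed

text \<open>\<open>cos * SS\<close> is an exact derivative, of an arctangent of
  \<open>pp / sqrt t\<close> up to a factor; the range of the arctangent bounds the integral on any
  interval where \<open>cos\<close> keeps its sign.\<close>

lemma SS_piece:
  assumes uv: "u \<le> v" and s: "(\<forall>\<theta>\<in>{u..v}. cos \<theta> \<ge> 0) \<or> (\<forall>\<theta>\<in>{u..v}. cos \<theta> \<le> 0)"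
  shows "integral {u..v} (\<lambda>\<theta>. \<bar>cos \<theta>\<bar> * SS \<theta>) \<le> pi / (2 * sqrt t)"
proof -
  define a where "a \<theta> = - (arctan (pp \<theta> / sqrt t) / (2 * sqrt t))" for \<theta>
  have st: "sqrt t > 0" "sqrt t * sqrt t = t" "(sqrt t)\<^sup>2 = t" using t by auto
  have da: "(a has_vector_derivative cos \<theta> * SS \<theta>) (at \<theta> within {u..v})" for \<theta>
  proof -
    have pos: "1 + (pp \<theta> / sqrt t)\<^sup>2 = ((pp \<theta>)\<^sup>2 + t) / t"
      using st t by (simp add: power_divide field_simps)
    have "(a has_real_derivative - (inverse (1 + (pp \<theta> / sqrt t)\<^sup>2) * (- 2 * t * cos \<theta> / sqrt t) / (2 * sqrt t))) (at \<theta> within {u..v})"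
      unfolding a_def pp_def using st by (auto intro!: derivative_eq_intros simp: algebra_simps)
    also have "- (inverse (1 + (pp \<theta> / sqrt t)\<^sup>2) * (- 2 * t * cos \<theta> / sqrt t) / (2 * sqrt t)) = cos \<theta> * SS \<theta>"
      unfolding pos SS_def using st t den_pos[of \<theta>] by (simp add: divide_simps)
    finally show ?thesis by (simp add: has_real_derivative_iff_has_vector_derivative)
  qed
  have I: "((\<lambda>\<theta>. cos \<theta> * SS \<theta>) has_integral (a v - a u)) {u..v}"
    by (rule fundamental_theorem_of_calculus[OF uv da])
  have bd: "\<bar>a v - a u\<bar> \<le> pi / (2 * sqrt t)"
  proof -
    have "\<bar>arctan x - arctan y\<bar> \<le> pi" for x y using arctan_bounded[of x] arctan_bounded[of y] by linarith
    hence "\<bar>arctan (pp u / sqrt t) - arctan (pp v / sqrt t)\<bar> / (2 * sqrt t) \<le> pi / (2 * sqrt t)"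
      using st by (intro divide_right_mono) auto
    moreover have "a v - a u = (arctan (pp u / sqrt t) - arctan (pp v / sqrt t)) / (2 * sqrt t)"
      by (simp add: a_def diff_divide_distrib)
    ultimately show ?thesis using st by (simp add: abs_divide)
  qed
  from s show ?thesis
  proof
    assume "\<forall>\<theta>\<in>{u..v}. cos \<theta> \<ge> 0"
    hence "((\<lambda>\<theta>. \<bar>cos \<theta>\<bar> * SS \<theta>) has_integral (a v - a u)) {u..v}"
      by (intro has_integral_eq[OF _ I]) auto
    thus ?thesis using bd by (simp add: integral_unique)
  next
    assume "\<forall>\<theta>\<in>{u..v}. cos \<theta> \<le> 0"
    hence "((\<lambda>\<theta>. \<bar>cos \<theta>\<bar> * SS \<theta>) has_integral - (a v - a u)) {u..v}"
      by (intro has_integral_eq[OF _ has_integral_neg[OF I]]) auto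
    thus ?thesis using bd by (simp add: integral_unique)
  qed
qed

text \<open>Three intervals of constant sign of \<open>cos\<close> contribute
  \<open>pi / (2 * sqrt t)\<close> each, doubled to \<open>3 * pi / sqrt t\<close>; the term
  \<open>4 / t \<le> 4 / sqrt t\<close> contributes \<open>8 * pi / sqrt t\<close> over the
  period.\<close>

lemma SS_integral: "integral {0..2*pi} SS \<le> 11 * pi / sqrt t"
proof -
  let ?f = "\<lambda>\<theta>. \<bar>cos \<theta>\<bar> * SS \<theta>"
  have c: "continuous_on A ?f" for A by (intro continuous_intros SS_continuous)
  have int: "?f integrable_on {u..v}" for u v by (rule integrable_continuous_real[OF c])
  have "integral {0..pi/2} ?f \<le> pi / (2 * sqrt t)"
    by (rule SS_piece) (auto intro!: cos_ge_zero)
  moreover have "integral {pi/2..3*pi/2} ?f \<le> pi / (2 * sqrt t)"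
  proof (rule SS_piece)
    have "cos \<theta> \<le> 0" if "\<theta> \<in> {pi/2..3*pi/2}" for \<theta>
      using cos_ge_zero[of "\<theta> - pi"] that by (simp add: cos_diff)
    thus "(\<forall>\<theta>\<in>{pi/2..3*pi/2}. cos \<theta> \<ge> 0) \<or> (\<forall>\<theta>\<in>{pi/2..3*pi/2}. cos \<theta> \<le> 0)" by blast
  qed simp
  moreover have "integral {3*pi/2..2*pi} ?f \<le> pi / (2 * sqrt t)"
  proof (rule SS_piece)
    have "cos \<theta> \<ge> 0" if "\<theta> \<in> {3*pi/2..2*pi}" for \<theta>
      using cos_ge_zero[of "\<theta> - 2 * pi"] that by (simp add: cos_diff)
    thus "(\<forall>\<theta>\<in>{3*pi/2..2*pi}. cos \<theta> \<ge> 0) \<or> (\<forall>\<theta>\<in>{3*pi/2..2*pi}. cos \<theta> \<le> 0)" by blast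
  qed simp
  moreover have "integral {0..2*pi} ?f = integral {0..pi/2} ?f + integral {pi/2..3*pi/2} ?f + integral {3*pi/2..2*pi} ?f"
  proof -
    have "integral {0..2*pi} ?f = integral {0..3*pi/2} ?f + integral {3*pi/2..2*pi} ?f"
      by (rule Henstock_Kurzweil_Integration.integral_combine[symmetric, OF _ _ int]) auto
    moreover have "integral {0..3*pi/2} ?f = integral {0..pi/2} ?f + integral {pi/2..3*pi/2} ?f"
      by (rule Henstock_Kurzweil_Integration.integral_combine[symmetric, OF _ _ int]) auto
    ultimately show ?thesis by simp
  qed
  ultimately have f: "integral {0..2*pi} ?f \<le> 3 * (pi / (2 * sqrt t))" by linarith
  have "integral {0..2*pi} SS \<le> integral {0..2*pi} (\<lambda>\<theta>. 2 * ?f \<theta> + 4 / t)"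
    by (intro integral_le integrable_continuous_real continuous_intros SS_continuous SS_pointwise)
  also have "\<dots> = 2 * integral {0..2*pi} ?f + (4 / t) * (2 * pi)"
    by (subst integral_add) (auto intro!: int integrable_on_cmult_left integrable_const_ivl)
  also have "\<dots> \<le> 2 * (3 * (pi / (2 * sqrt t))) + (4 / sqrt t) * (2 * pi)"
  proof -
    have "sqrt t \<le> t" using t by (simp add: sqrt_le_D real_sqrt_le_iff real_le_lsqrt power2_eq_square)
    hence "4 / t \<le> 4 / sqrt t" using t by (intro divide_left_mono) auto
    hence "4 / t * (2 * pi) \<le> 4 / sqrt t * (2 * pi)" by (intro mult_right_mono) auto
    thus ?thesis using f by linarith
  qed
  also have "\<dots> = 11 * pi / sqrt t" by (simp add: field_simps)
  finally show ?thesis .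
qed

text \<open>Integration by parts with the regularized quotient \<open>p / (p\<^sup>2 + t)\<close> in place of \<open>1 / p\<close>,
  where \<open>p\<close> is the derivative of the phase; this needs no case distinction at the stationary points.\<close>

lemma oscillatory_integral:
  fixes Y Y' :: "real \<Rightarrow> complex"
  assumes Y: "\<And>\<theta>. \<theta> \<in> {0..2*pi} \<Longrightarrow> (Y has_vector_derivative Y' \<theta>) (at \<theta> within {0..2*pi})"
      and per: "Y (2 * pi) = Y 0" and Y': "continuous_on {0..2*pi} Y'"
      and bd: "\<And>\<theta>. \<theta> \<in> {0..2*pi} \<Longrightarrow> cmod (Y \<theta>) \<le> A" "\<And>\<theta>. \<theta> \<in> {0..2*pi} \<Longrightarrow> cmod (Y' \<theta>) \<le> A"
  shows "cmod (integral {0..2*pi} (\<lambda>\<theta>. exp (\<i> * of_real (2 * t * cos \<theta> + real e * \<theta>)) * Y \<theta>)) \<le> 110 * A / sqrt t"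
proof -
  define \<psi> where "\<psi> \<theta> = exp (\<i> * complex_of_real (2 * t * cos \<theta> + real e * \<theta>))" for \<theta> :: real
  define R where "R \<theta> = pp \<theta> / ((pp \<theta>)\<^sup>2 + t)" for \<theta>
  define R' where "R' \<theta> = (- 2 * t * cos \<theta>) * (t - (pp \<theta>)\<^sup>2) / ((pp \<theta>)\<^sup>2 + t)\<^sup>2" for \<theta>
  have ne: "(pp \<theta>)\<^sup>2 + t \<noteq> 0" for \<theta> using den_pos[of \<theta>] by simp
  have A: "A \<ge> 0" using order_trans[OF norm_ge_zero bd(1)[of 0]] by simp
  have Yc: "continuous_on {0..2*pi} Y"
    using Y has_vector_derivative_continuous continuous_on_eq_continuous_within by blast
  have d\<psi>: "(\<psi> has_vector_derivative (\<i> * of_real (pp \<theta>) * \<psi> \<theta>)) (at \<theta> within S)" for \<theta> S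
  proof -
    have "((\<lambda>w. exp (\<i> * (2 * of_real t * cos w + of_nat e * w))) has_field_derivative
        \<i> * of_real (pp \<theta>) * \<psi> \<theta>) (at (of_real \<theta>))"
      unfolding pp_def \<psi>_def by (auto intro!: derivative_eq_intros simp: algebra_simps cos_of_real sin_of_real)
    from has_vector_derivative_real_field[OF this, of S] show ?thesis
      by (simp add: \<psi>_def[abs_def] cos_of_real)
  qed
  have dR: "(R has_real_derivative R' \<theta>) (at \<theta> within S)" for \<theta> S
  proof -
    have "(pp has_real_derivative (- 2 * t * cos \<theta>)) (at \<theta> within S)"
      unfolding pp_def[abs_def] by (auto intro!: derivative_eq_intros)
    hence "(R has_real_derivative ((- 2 * t * cos \<theta>) * ((pp \<theta>)\<^sup>2 + t) - pp \<theta> * (2 * pp \<theta> * (- 2 * t * cos \<theta>))) / (((pp \<theta>)\<^sup>2 + t) * ((pp \<theta>)\<^sup>2 + t))) (at \<theta> within S)"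
      unfolding R_def[abs_def] using ne by (auto intro!: derivative_eq_intros)
    moreover have "((- 2 * t * cos \<theta>) * ((pp \<theta>)\<^sup>2 + t) - pp \<theta> * (2 * pp \<theta> * (- 2 * t * cos \<theta>))) = (- 2 * t * cos \<theta>) * (t - (pp \<theta>)\<^sup>2)"
      by (simp add: power2_eq_square algebra_simps)
    ultimately show ?thesis by (simp add: R'_def power2_eq_square)
  qed
  have dRc: "((\<lambda>\<theta>. complex_of_real (R \<theta>)) has_vector_derivative of_real (R' \<theta>)) (at \<theta> within S)" for \<theta> S
    using dR[of \<theta> S] by (simp add: has_vector_derivative_of_real has_real_derivative_iff_has_vector_derivative)
  define G where "G \<theta> = \<psi> \<theta> * (of_real (R \<theta>) * Y \<theta>)" for \<theta>
  define rest where "rest \<theta> = \<i> * \<psi> \<theta> * (of_real (R' \<theta>) * Y \<theta> + of_real (R \<theta>) * Y' \<theta>) + of_real (SS \<theta>) * \<psi> \<theta> * Y \<theta>" for \<theta>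
  have dG: "(G has_vector_derivative (\<psi> \<theta> * (of_real (R \<theta>) * Y' \<theta> + of_real (R' \<theta>) * Y \<theta>) + \<i> * of_real (pp \<theta>) * \<psi> \<theta> * (of_real (R \<theta>) * Y \<theta>))) (at \<theta> within {0..2*pi})"
    if "\<theta> \<in> {0..2*pi}" for \<theta>
    unfolding G_def[abs_def] by (intro has_vector_derivative_mult d\<psi> dRc Y that)
  have "((\<lambda>\<theta>. \<psi> \<theta> * (of_real (R \<theta>) * Y' \<theta> + of_real (R' \<theta>) * Y \<theta>) + \<i> * of_real (pp \<theta>) * \<psi> \<theta> * (of_real (R \<theta>) * Y \<theta>)) has_integral (G (2 * pi) - G 0)) {0..2*pi}"
    by (rule fundamental_theorem_of_calculus[OF _ dG]) auto
  moreover have "G (2 * pi) = G 0"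
  proof -
    \<comment> \<open>Integrality of the frequency \<open>e\<close> makes the oscillating factor
      periodic, so no boundary term appears.\<close>
    have "\<psi> (2 * pi) = \<psi> 0"
    proof -
      have "\<psi> (2 * pi) = exp (\<i> * of_real (2 * t)) * exp (of_nat e * (2 * of_real pi * \<i>))"
      proof -
        have "\<i> * complex_of_real (2 * t * cos (2 * pi) + real e * (2 * pi)) =
           \<i> * of_real (2 * t) + of_nat e * (2 * of_real pi * \<i>)" by (simp add: algebra_simps)
        thus ?thesis by (simp only: \<psi>_def exp_add)
      qed
      also have "exp (of_nat e * (2 * of_real pi * \<i>)) = 1"
        by (simp only: exp_of_nat_mult exp_two_pi_i power_one)
      finally show ?thesis by (simp add: \<psi>_def)
    qed
    moreover have "R (2 * pi) = R 0" by (simp add: R_def pp_def)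
    ultimately show ?thesis using per by (simp add: G_def)
  qed
  ultimately have zero: "((\<lambda>\<theta>. \<psi> \<theta> * (of_real (R \<theta>) * Y' \<theta> + of_real (R' \<theta>) * Y \<theta>) + \<i> * of_real (pp \<theta>) * \<psi> \<theta> * (of_real (R \<theta>) * Y \<theta>)) has_integral 0) {0..2*pi}"
    by simp
  have \<psi>c: "continuous_on S \<psi>" for S
    unfolding \<psi>_def[abs_def] by (intro continuous_intros)
  have Rc: "continuous_on S R" "continuous_on S R'" for S
    unfolding R_def[abs_def] R'_def[abs_def] pp_def using ne by (auto intro!: continuous_intros simp: pp_def)
  have restc: "continuous_on {0..2*pi} rest"
    unfolding rest_def[abs_def] by (intro continuous_intros \<psi>c Rc Yc Y' SS_continuous)
  \<comment> \<open>The part with \<open>pp * R\<close> is a total derivative up to terms with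
    \<open>R\<close> or its derivative; the part with \<open>SS\<close> is small in the
    mean.\<close>
  have one: "pp \<theta> * R \<theta> + SS \<theta> = 1" for \<theta>
    using ne[of \<theta>] by (simp add: R_def SS_def power2_eq_square flip: add_divide_distrib)
  have eq: "\<psi> \<theta> * Y \<theta> = (- \<i>) * (\<psi> \<theta> * (of_real (R \<theta>) * Y' \<theta> + of_real (R' \<theta>) * Y \<theta>) + \<i> * of_real (pp \<theta>) * \<psi> \<theta> * (of_real (R \<theta>) * Y \<theta>)) + rest \<theta>" for \<theta>
  proof -
    have "\<psi> \<theta> * Y \<theta> = complex_of_real (pp \<theta> * R \<theta> + SS \<theta>) * (\<psi> \<theta> * Y \<theta>)" unfolding one by simp
    thus ?thesis by (simp add: rest_def algebra_simps)
  qed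
  have "((\<lambda>\<theta>. \<psi> \<theta> * Y \<theta>) has_integral ((- \<i>) * 0 + integral {0..2*pi} rest)) {0..2*pi}"
    unfolding eq by (intro has_integral_add has_integral_mult_right zero integrable_integral integrable_continuous_real restc)
  hence "cmod (integral {0..2*pi} (\<lambda>\<theta>. \<psi> \<theta> * Y \<theta>)) = cmod (integral {0..2*pi} rest)"
    by (simp add: integral_unique)
  also have "\<dots> \<le> integral {0..2*pi} (\<lambda>\<theta>. 3 * A * SS \<theta> + A / (2 * sqrt t))"
  proof (rule integral_norm_bound_integral)
    fix \<theta> assume th: "\<theta> \<in> {0..2*pi}"
    have n\<psi>: "cmod (\<psi> \<theta>) = 1" by (simp add: \<psi>_def)
    have R: "\<bar>R \<theta>\<bar> \<le> 1 / (2 * sqrt t)"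
    proof -
      have "0 \<le> (\<bar>pp \<theta>\<bar> - sqrt t)\<^sup>2" by simp
      hence "2 * sqrt t * \<bar>pp \<theta>\<bar> \<le> (pp \<theta>)\<^sup>2 + t"
        using t by (simp add: power2_diff algebra_simps)
      moreover have "\<bar>R \<theta>\<bar> = \<bar>pp \<theta>\<bar> / ((pp \<theta>)\<^sup>2 + t)" using den_pos[of \<theta>] by (simp add: R_def abs_divide)
      moreover have "sqrt t > 0" using t by simp
      moreover have "x / D \<le> 1 / (2 * s)" if "2 * s * x \<le> D" "D > 0" "s > 0" for x D s :: real
        using that by (simp add: field_simps)
      ultimately show ?thesis using den_pos[of \<theta>] by simp
    qed
    have R': "\<bar>R' \<theta>\<bar> \<le> 2 * SS \<theta>"
    proof -
      have "\<bar>R' \<theta>\<bar> = (2 * t * \<bar>cos \<theta>\<bar>) * \<bar>t - (pp \<theta>)\<^sup>2\<bar> / ((pp \<theta>)\<^sup>2 + t)\<^sup>2"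
        using t by (simp add: R'_def abs_mult abs_divide)
      also have "\<dots> \<le> (2 * t * 1) * ((pp \<theta>)\<^sup>2 + t) / ((pp \<theta>)\<^sup>2 + t)\<^sup>2"
        using t by (intro divide_right_mono mult_mono) (auto simp: abs_if)
      also have "\<dots> = 2 * SS \<theta>" using ne[of \<theta>] by (simp add: SS_def power2_eq_square)
      finally show ?thesis .
    qed
    have "cmod (rest \<theta>) \<le> cmod (\<i> * \<psi> \<theta> * (of_real (R' \<theta>) * Y \<theta> + of_real (R \<theta>) * Y' \<theta>)) + cmod (of_real (SS \<theta>) * \<psi> \<theta> * Y \<theta>)"
      unfolding rest_def by (rule norm_triangle_ineq)
    also have "\<dots> = cmod (of_real (R' \<theta>) * Y \<theta> + of_real (R \<theta>) * Y' \<theta>) + SS \<theta> * cmod (Y \<theta>)"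
      using SS_nonneg[of \<theta>] by (simp add: norm_mult n\<psi>)
    also have "\<dots> \<le> (\<bar>R' \<theta>\<bar> * cmod (Y \<theta>) + \<bar>R \<theta>\<bar> * cmod (Y' \<theta>)) + SS \<theta> * cmod (Y \<theta>)"
      using norm_triangle_ineq[of "of_real (R' \<theta>) * Y \<theta>" "of_real (R \<theta>) * Y' \<theta>"] by (simp add: norm_mult)
    also have "\<dots> \<le> (2 * SS \<theta> * A + 1 / (2 * sqrt t) * A) + SS \<theta> * A"
      using R R' SS_nonneg[of \<theta>] bd[OF th] t by (intro add_mono mult_mono) auto
    finally show "cmod (rest \<theta>) \<le> 3 * A * SS \<theta> + A / (2 * sqrt t)" by (simp add: algebra_simps)
  qed (auto intro!: integrable_continuous_real restc continuous_intros SS_continuous)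
  also have "\<dots> = 3 * A * integral {0..2*pi} SS + A / (2 * sqrt t) * (2 * pi)"
    by (subst integral_add) (auto intro!: integrable_continuous_real continuous_intros SS_continuous)
  also have "\<dots> \<le> 3 * A * (11 * pi / sqrt t) + A / (2 * sqrt t) * (2 * pi)"
    using A t by (intro add_mono mult_left_mono SS_integral) auto
  \<comment> \<open>\<open>3 * 11 + 1 = 34\<close>, and \<open>34 * pi\<close> is just below
    107.\<close>
  also have "\<dots> = 34 * pi * (A / sqrt t)" using t by (simp add: field_simps)
  also have "\<dots> \<le> 110 * (A / sqrt t)"
  proof (intro mult_right_mono)
    show "34 * pi \<le> 110" using pi_approx by simp
  qed (use A t in auto)
  finally show ?thesis by (simp add: \<psi>_def)
qed

end

section \<open>Fourier modes: orthogonality and summation\<close>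

lemma integral_exp_int:
  assumes "m \<noteq> (0::int)"
  shows "((\<lambda>\<theta>. exp (\<i> * of_int m * of_real \<theta>)) has_integral 0) {0..2*pi}"
proof -
  have d: "((\<lambda>\<theta>. exp (\<i> * of_int m * of_real \<theta>) / (\<i> * of_int m)) has_vector_derivative exp (\<i> * of_int m * of_real \<theta>)) (at \<theta> within {0..2*pi})" for \<theta> :: real
  proof -
    have "((\<lambda>w. exp (\<i> * of_int m * w) / (\<i> * of_int m)) has_field_derivative exp (\<i> * of_int m * of_real \<theta>)) (at (of_real \<theta>))"
      using assms by (auto intro!: derivative_eq_intros)
    from has_vector_derivative_real_field[OF this] show ?thesis .
  qed
  have "((\<lambda>\<theta>. exp (\<i> * of_int m * of_real \<theta>)) has_integral
      exp (\<i> * of_int m * of_real (2 * pi)) / (\<i> * of_int m) - exp (\<i> * of_int m * of_real 0) / (\<i> * of_int m)) {0..2*pi}"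
    by (rule fundamental_theorem_of_calculus[OF _ d]) auto
  moreover have "exp (\<i> * of_int m * of_real (2 * pi)) = 1"
    using exp_eq_1[of "\<i> * of_int m * of_real (2 * pi)"] by auto
  ultimately show ?thesis by simp
qed

text \<open>Parseval for finite sums of modes; only the diagonal of the expanded square survives
  integration.\<close>

lemma trig_poly_norm_integral:
  assumes "finite I"
  shows "((\<lambda>\<theta>. (cmod (\<Sum>k\<in>I. a k * cis \<theta> ^ k))\<^sup>2) has_integral (2 * pi * (\<Sum>k\<in>I. (cmod (a k))\<^sup>2))) {0..2*pi}"
proof -
  have 1: "((\<lambda>\<theta>. exp (\<i> * of_int (int k - int l) * of_real \<theta>)) has_integral (if k = l then 2 * pi else 0)) {0..2*pi}" for k l
    using integral_exp_int[of "int k - int l"] has_integral_const_real[of "1::complex" 0 "2*pi"] 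
    by (auto simp: scaleR_conv_of_real)
  have "((\<lambda>\<theta>. \<Sum>k\<in>I. \<Sum>l\<in>I. a k * cnj (a l) * exp (\<i> * of_int (int k - int l) * of_real \<theta>)) has_integral
     (\<Sum>k\<in>I. \<Sum>l\<in>I. a k * cnj (a l) * of_real (if k = l then 2 * pi else 0))) {0..2*pi}"
    by (intro has_integral_sum has_integral_mult_right 1 assms)
  also have "(\<lambda>\<theta>. \<Sum>k\<in>I. \<Sum>l\<in>I. a k * cnj (a l) * exp (\<i> * of_int (int k - int l) * of_real \<theta>)) =
     (\<lambda>\<theta>. complex_of_real ((cmod (\<Sum>k\<in>I. a k * cis \<theta> ^ k))\<^sup>2))"
  proof
    fix \<theta>
    have eq: "a k * cis \<theta> ^ k * cnj (a l * cis \<theta> ^ l) = a k * cnj (a l) * exp (\<i> * of_int (int k - int l) * of_real \<theta>)" for k l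
    proof -
      have "cis \<theta> ^ k * cnj (cis \<theta> ^ l) = exp (\<i> * of_int (int k - int l) * of_real \<theta>)"
      proof -
        have "cis \<theta> ^ k * cnj (cis \<theta> ^ l) = cis (real k * \<theta> - real l * \<theta>)"
          by (simp add: Complex.DeMoivre cis_cnj cis_mult)
        also have "\<dots> = exp (\<i> * of_int (int k - int l) * of_real \<theta>)"
          unfolding cis_conv_exp by (simp add: algebra_simps)
        finally show ?thesis .
      qed
      thus ?thesis by (simp add: mult_ac)
    qed
    thus "(\<Sum>k\<in>I. \<Sum>l\<in>I. a k * cnj (a l) * exp (\<i> * of_int (int k - int l) * of_real \<theta>)) = complex_of_real ((cmod (\<Sum>k\<in>I. a k * cis \<theta> ^ k))\<^sup>2)"
      unfolding complex_norm_square cnj_sum sum_product by (simp only: eq)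
  qed
  also have "(\<Sum>k\<in>I. \<Sum>l\<in>I. a k * cnj (a l) * of_real (if k = l then 2 * pi else 0)) = complex_of_real (2 * pi * (\<Sum>k\<in>I. (cmod (a k))\<^sup>2))"
  proof -
    have "(\<Sum>l\<in>I. a k * cnj (a l) * of_real (if k = l then 2 * pi else 0)) = a k * cnj (a k) * of_real (2 * pi)" if "k \<in> I" for k
    proof -
      have "(\<Sum>l\<in>I. a k * cnj (a l) * of_real (if k = l then 2 * pi else 0)) = (\<Sum>l\<in>I. if k = l then a k * cnj (a l) * of_real (2 * pi) else 0)"
        by (intro sum.cong) auto
      thus ?thesis using that assms by (simp add: sum.delta)
    qed
    thus ?thesis by (simp add: sum_distrib_left mult_ac complex_norm_square[symmetric] del: of_real_power) 
  qed
  finally have "((\<lambda>\<theta>. Re (complex_of_real ((cmod (\<Sum>k\<in>I. a k * cis \<theta> ^ k))\<^sup>2))) has_integral Re (complex_of_real (2 * pi * (\<Sum>k\<in>I. (cmod (a k))\<^sup>2)))) {0..2*pi}"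
    by (rule has_integral_Re)
  thus ?thesis by simp
qed

text \<open>Telescoping against \<open>2 / N\<close>: one step gains
  \<open>2 / (N * (N + 1))\<close>, at least \<open>1 / N\<^sup>2\<close>.\<close>

lemma sum_inverse_squares_le:
  assumes "K \<ge> 1"
  shows "(\<Sum>k=K..<N. 1 / (real k)\<^sup>2) \<le> 2 / real K"
proof (cases "K \<le> N")
  case True
  have "(\<Sum>k=K..<N. 1 / (real k)\<^sup>2) \<le> 2 / real K - 2 / real N"
    using True
  proof (induction N rule: dec_induct)
    case (step N)
    have N: "real N \<ge> 1" using step assms by simp
    have "1 / (real N)\<^sup>2 \<le> 2 / real N - 2 / real (Suc N)"
      using N by (simp add: divide_simps) (simp add: power2_eq_square algebra_simps)
    thus ?case using step by simp
  qed simp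
  moreover have "2 / real N \<ge> 0" by simp
  ultimately show ?thesis by linarith
qed (use assms in auto)

text \<open>\<open>oscillatory_integral\<close> admits total frequencies up to \<open>t\<close>.
  With \<open>e \<le> t / 2 + 1\<close> and \<open>t \<ge> 4\<close> this leaves room for the modes
  up to \<open>t / 4\<close>, and the decay of the coefficients is asked for only beyond that
  cutoff.\<close>

lemma oscillatory_series:
  fixes Y Y' :: "real \<Rightarrow> complex" and t :: real
  assumes Y: "\<And>\<theta>. \<theta> \<in> {0..2*pi} \<Longrightarrow> (Y has_vector_derivative Y' \<theta>) (at \<theta> within {0..2*pi})"
      and per: "Y (2 * pi) = Y 0" and Y': "continuous_on {0..2*pi} Y'"
      and bd: "\<And>\<theta>. \<theta> \<in> {0..2*pi} \<Longrightarrow> cmod (Y \<theta>) \<le> A" "\<And>\<theta>. \<theta> \<in> {0..2*pi} \<Longrightarrow> cmod (Y' \<theta>) \<le> A"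
      and t: "t \<ge> 4" and e: "real e \<le> t / 2 + 1" and M: "M > 0"
      and a: "summable (\<lambda>k. cmod (a k))" "(\<Sum>k. cmod (a k)) \<le> M" "\<And>k. t / 4 \<le> real k \<Longrightarrow> real k * cmod (a k) \<le> M"
  shows "cmod (integral {0..2*pi} (\<lambda>\<theta>. exp (\<i> * of_real (2 * t * cos \<theta>)) * (cis \<theta> ^ e * ps a (cis \<theta>) * Y \<theta>)))
           \<le> 150 * A * M / sqrt t"
proof -
  define E where "E \<theta> = exp (\<i> * of_real (2 * t * cos \<theta>))" for \<theta>
  have A: "A \<ge> 0" using order_trans[OF norm_ge_zero bd(1)[of 0]] by simp
  have Yc: "continuous_on {0..2*pi} Y"
    using Y has_vector_derivative_continuous continuous_on_eq_continuous_within by blast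
  have Ec: "continuous_on S E" for S unfolding E_def by (intro continuous_intros)
  have cisc: "continuous_on S cis" for S by (intro continuous_intros)
  have nE: "cmod (E \<theta>) = 1" for \<theta> by (simp add: E_def)
  define K where "K = nat \<lceil>t / 4\<rceil>"
  have K: "real K \<ge> t / 4" "K \<ge> 1" using t unfolding K_def by linarith+
  have Kl: "real k < t / 4" if "k < K" for k using that unfolding K_def by linarith
  define F where "F I \<theta> = E \<theta> * (cis \<theta> ^ e * (\<Sum>k\<in>I. a k * cis \<theta> ^ k) * Y \<theta>)" for I \<theta>
  have Fc: "continuous_on {0..2*pi} (F I)" for I
    unfolding F_def[abs_def] by (intro continuous_intros Ec Yc cisc)
  have Fi: "F I integrable_on {0..2*pi}" for I by (rule integrable_continuous_real[OF Fc])
  have low: "cmod (integral {0..2*pi} (F I)) \<le> 110 * A * M / sqrt t" if I: "I \<subseteq> {..<K}" for I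
  proof -
    have fin: "finite I" using I finite_subset by blast
    let ?\<psi> = "\<lambda>k \<theta>. exp (\<i> * of_real (2 * t * cos \<theta> + real (e + k) * \<theta>)) * Y \<theta>"
    have Feq: "F I \<theta> = (\<Sum>k\<in>I. a k * ?\<psi> k \<theta>)" for \<theta>
    proof -
      have "E \<theta> * cis \<theta> ^ e * cis \<theta> ^ k = exp (\<i> * of_real (2 * t * cos \<theta> + real (e + k) * \<theta>))" for k
      proof -
        have "cis \<theta> ^ e * cis \<theta> ^ k = exp (\<i> * complex_of_real (real (e + k) * \<theta>))"
          unfolding cis_conv_exp[symmetric] by (simp add: Complex.DeMoivre cis_mult algebra_simps)
        thus ?thesis by (simp only: E_def mult.assoc exp_add[symmetric] of_real_add ring_distribs)
      qed
      thus ?thesis unfolding F_def sum_distrib_left sum_distrib_right 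
        by (intro sum.cong) (auto simp: mult_ac)
    qed
    have c: "continuous_on {0..2*pi} (?\<psi> k)" for k by (intro continuous_intros Yc)
    have "integral {0..2*pi} (F I) = (\<Sum>k\<in>I. a k * integral {0..2*pi} (?\<psi> k))"
      unfolding Feq using integrable_continuous_real[OF c] fin
      by (subst integral_sum) (auto intro!: integrable_on_mult_right)
    also have "cmod \<dots> \<le> (\<Sum>k\<in>I. cmod (a k) * (110 * A / sqrt t))"
    proof (rule order_trans[OF norm_sum], rule sum_mono)
      fix k assume "k \<in> I"
      hence "real (e + k) \<le> t" using Kl[of k] I e t by auto
      hence "cmod (integral {0..2*pi} (?\<psi> k)) \<le> 110 * A / sqrt t"
        using t by (intro oscillatory_integral[OF _ _ Y per Y' bd]) auto
      thus "cmod (a k * integral {0..2*pi} (?\<psi> k)) \<le> cmod (a k) * (110 * A / sqrt t)"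
        unfolding norm_mult by (rule mult_left_mono) auto
    qed
    also have "\<dots> = (\<Sum>k\<in>I. cmod (a k)) * (110 * A / sqrt t)" by (rule sum_distrib_right[symmetric])
    also have "\<dots> \<le> M * (110 * A / sqrt t)"
    proof (intro mult_right_mono)
      have "(\<Sum>k\<in>I. cmod (a k)) \<le> (\<Sum>k. cmod (a k))" by (intro sum_le_suminf a fin) auto
      thus "(\<Sum>k\<in>I. cmod (a k)) \<le> M" using a(2) by linarith
    qed (use A t in auto)
    finally show ?thesis by (simp add: mult_ac)
  qed
  have high: "cmod (integral {0..2*pi} (F {K..<N})) \<le> 40 * A * M / sqrt t" for N
  proof -
    define g where "g \<theta> = (\<Sum>k=K..<N. a k * cis \<theta> ^ k)" for \<theta>
    have st: "sqrt t > 0" "sqrt t * sqrt t = t" using t by auto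
    have gi: "((\<lambda>\<theta>. (cmod (g \<theta>))\<^sup>2) has_integral (2 * pi * (\<Sum>k=K..<N. (cmod (a k))\<^sup>2))) {0..2*pi}"
      unfolding g_def by (rule trig_poly_norm_integral) simp
    have sq: "(\<Sum>k=K..<N. (cmod (a k))\<^sup>2) \<le> 8 * M\<^sup>2 / t"
    proof -
      have "(\<Sum>k=K..<N. (cmod (a k))\<^sup>2) \<le> (\<Sum>k=K..<N. M\<^sup>2 * (1 / (real k)\<^sup>2))"
      proof (rule sum_mono)
        fix k assume k: "k \<in> {K..<N}"
        hence k0: "real k > 0" "real k \<ge> real K" using K by auto
        have "(real k * cmod (a k))\<^sup>2 \<le> M\<^sup>2"
          using a(3)[of k] k0 K(1) by (intro power_mono) auto
        thus "(cmod (a k))\<^sup>2 \<le> M\<^sup>2 * (1 / (real k)\<^sup>2)" using k0 by (simp add: power_mult_distrib field_simps)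
      qed
      also have "\<dots> \<le> M\<^sup>2 * (2 / real K)"
        unfolding sum_distrib_left[symmetric] by (intro mult_left_mono sum_inverse_squares_le K) auto
      also have "\<dots> \<le> M\<^sup>2 * (2 / (t / 4))"
        using K t by (intro mult_left_mono divide_left_mono) auto
      finally show ?thesis by (simp add: mult.commute)
    qed
    have "cmod (integral {0..2*pi} (F {K..<N})) \<le> integral {0..2*pi} (\<lambda>\<theta>. A * (sqrt t / (2 * M) * (cmod (g \<theta>))\<^sup>2 + M / (2 * sqrt t)))"
    proof (rule integral_norm_bound_integral[OF Fi])
      show "(\<lambda>\<theta>. A * (sqrt t / (2 * M) * (cmod (g \<theta>))\<^sup>2 + M / (2 * sqrt t))) integrable_on {0..2*pi}"
        unfolding g_def by (intro integrable_continuous_real continuous_intros cisc)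
      fix \<theta> assume th: "\<theta> \<in> {0..2*pi}"
      have "cmod (F {K..<N} \<theta>) = cmod (g \<theta>) * cmod (Y \<theta>)"
        by (simp add: F_def g_def norm_mult norm_power nE)
      also have "\<dots> \<le> cmod (g \<theta>) * A" using bd[OF th] by (intro mult_left_mono) auto
      \<comment> \<open>Young's inequality in place of Cauchy-Schwarz for the integral. Its weight
        balances the mean square of \<open>g\<close>, of order \<open>M\<^sup>2 / t\<close>, against
        the constant term.\<close>
      also have "cmod (g \<theta>) \<le> sqrt t / (2 * M) * (cmod (g \<theta>))\<^sup>2 + M / (2 * sqrt t)"
      proof -
        have "0 \<le> (sqrt t * cmod (g \<theta>) - M)\<^sup>2 / (2 * M * sqrt t)" using M st by (intro divide_nonneg_nonneg) auto
        also have "\<dots> = sqrt t / (2 * M) * (cmod (g \<theta>))\<^sup>2 + M / (2 * sqrt t) - cmod (g \<theta>)"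
          using M st by (simp add: field_simps power2_eq_square)
        finally show ?thesis by simp
      qed
      finally show "cmod (F {K..<N} \<theta>) \<le> A * (sqrt t / (2 * M) * (cmod (g \<theta>))\<^sup>2 + M / (2 * sqrt t))"
        using A by (simp add: mult_right_mono mult.commute)
    qed
    also have "\<dots> = A * (sqrt t / (2 * M) * (2 * pi * (\<Sum>k=K..<N. (cmod (a k))\<^sup>2)) + M / (2 * sqrt t) * (2 * pi))"
    proof (rule integral_unique, intro has_integral_mult_right has_integral_add gi)
      show "((\<lambda>\<theta>. M / (2 * sqrt t)) has_integral M / (2 * sqrt t) * (2 * pi)) {0..2*pi}"
        using has_integral_const_real[of "M / (2 * sqrt t)" 0 "2*pi"] by (simp add: mult_ac)
    qed
    also have "\<dots> \<le> A * (sqrt t / (2 * M) * (2 * pi * (8 * M\<^sup>2 / t)) + M / (2 * sqrt t) * (2 * pi))"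
      using A M t sq by (intro mult_left_mono add_mono) auto
    also have "\<dots> = 9 * pi * (A * M / sqrt t)"
    proof -
      have "sqrt t / (2 * M) * (2 * pi * (8 * M\<^sup>2 / t)) = 8 * pi * M / sqrt t"
        using M st by (simp add: field_simps power2_eq_square)
      thus ?thesis using st by (simp add: field_simps)
    qed
    also have "\<dots> \<le> 40 * (A * M / sqrt t)"
    proof (rule mult_right_mono)
      show "9 * pi \<le> 40" using pi_approx by simp
    qed (use A M t in auto)
    finally show ?thesis by simp
  qed
  have fin: "cmod (integral {0..2*pi} (F {..<N})) \<le> 150 * A * M / sqrt t" for N
  proof -
    \<comment> \<open>The minimum covers partial sums that stop before the cutoff; then the second
      block is empty.\<close>
    have "{..<N} = {..<min N K} \<union> {K..<N}" "{..<min N K} \<inter> {K..<N} = {}" by auto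
    hence "F {..<N} \<theta> = F {..<min N K} \<theta> + F {K..<N} \<theta>" for \<theta>
      by (simp add: F_def sum.union_disjoint algebra_simps)
    hence "F {..<N} = (\<lambda>\<theta>. F {..<min N K} \<theta> + F {K..<N} \<theta>)" by (rule ext)
    hence "integral {0..2*pi} (F {..<N}) = integral {0..2*pi} (F {..<min N K}) + integral {0..2*pi} (F {K..<N})"
      using integral_add[OF Fi Fi, of "{..<min N K}" "{K..<N}"] by (simp only:)
    hence "cmod (integral {0..2*pi} (F {..<N})) \<le> cmod (integral {0..2*pi} (F {..<min N K})) + cmod (integral {0..2*pi} (F {K..<N}))"
      by (simp add: norm_triangle_ineq)
    also have "\<dots> \<le> 110 * A * M / sqrt t + 40 * A * M / sqrt t" by (intro add_mono low high) auto
    finally show ?thesis by (simp add: add_divide_distrib)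
  qed
  define Flim where "Flim \<theta> = E \<theta> * (cis \<theta> ^ e * ps a (cis \<theta>) * Y \<theta>)" for \<theta>
  have ul: "uniform_limit {0..2*pi} (\<lambda>N. F {..<N}) Flim sequentially"
  proof -
    have 1: "uniform_limit {0..2*pi} (\<lambda>N \<theta>. \<Sum>k<N. a k * cis \<theta> ^ k) (\<lambda>\<theta>. ps a (cis \<theta>)) sequentially"
      unfolding ps_def by (rule Weierstrass_m_test[OF _ a(1)]) (simp add: norm_mult norm_power)
    show ?thesis unfolding uniform_limit_iff
    proof (intro allI impI)
      fix \<epsilon> :: real assume "\<epsilon> > 0"
      hence "\<epsilon> / (A + 1) > 0" using A by auto
      from 1[unfolded uniform_limit_iff, rule_format, OF this]
      show "\<forall>\<^sub>F N in sequentially. \<forall>\<theta>\<in>{0..2*pi}. dist (F {..<N} \<theta>) (Flim \<theta>) < \<epsilon>"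
      proof eventually_elim
        case (elim N)
        show ?case
        proof
          fix \<theta> assume th: "\<theta> \<in> {0..2*pi}"
          have "F {..<N} \<theta> - Flim \<theta> = E \<theta> * (cis \<theta> ^ e * ((\<Sum>k<N. a k * cis \<theta> ^ k) - ps a (cis \<theta>)) * Y \<theta>)"
            by (simp add: F_def Flim_def algebra_simps)
          hence "dist (F {..<N} \<theta>) (Flim \<theta>) = dist (\<Sum>k<N. a k * cis \<theta> ^ k) (ps a (cis \<theta>)) * cmod (Y \<theta>)"
            by (simp add: dist_norm norm_mult norm_power nE)
          also have "\<dots> \<le> dist (\<Sum>k<N. a k * cis \<theta> ^ k) (ps a (cis \<theta>)) * (A + 1)"
            using bd[OF th] by (intro mult_left_mono) auto
          also have "\<dots> < \<epsilon> / (A + 1) * (A + 1)"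
            using elim th A by (intro mult_strict_right_mono) auto
          finally show "dist (F {..<N} \<theta>) (Flim \<theta>) < \<epsilon>" using A by simp
        qed
      qed
    qed
  qed
  obtain I J where IJ: "\<And>N. (F {..<N} has_integral I N) {0..2*pi}" "(Flim has_integral J) {0..2*pi}" "I \<longlonglongrightarrow> J"
    using uniform_limit_integral[OF ul Fc] by auto
  have "cmod (I N) \<le> 150 * A * M / sqrt t" for N
    using fin[of N] IJ(1)[of N] by (simp add: integral_unique)
  hence "cmod J \<le> 150 * A * M / sqrt t"
    by (intro tendsto_upperbound[OF tendsto_norm[OF IJ(3)]]) auto
  thus ?thesis using IJ(2) by (simp add: Flim_def[abs_def] E_def[abs_def] integral_unique)
qed


subsection \<open>Solutions of the difference equation\<close>

lemma Hop_eq_iff: "Hop q u n = w * u n \<longleftrightarrow> u (n + 1) + u (n - 1) = (2 + complex_of_real (q n) - w) * u n"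
  by (auto simp: Hop_def algebra_simps)

lemma Hop_solution_unique:
  assumes u: "Hop q u = (\<lambda>n. w * u n)" and v: "Hop q v = (\<lambda>n. w * v n)" and "u 0 = v 0" "u 1 = v 1"
  shows "u = v"
proof -
  have ru: "u (n + 1) + u (n - 1) = (2 + complex_of_real (q n) - w) * u n" for n
    using fun_cong[OF u, of n] Hop_eq_iff by blast
  have rv: "v (n + 1) + v (n - 1) = (2 + complex_of_real (q n) - w) * v n" for n
    using fun_cong[OF v, of n] Hop_eq_iff by blast
  have ru': "u (n + 1) = (2 + complex_of_real (q n) - w) * u n - u (n - 1)"
    "u (n - 1) = (2 + complex_of_real (q n) - w) * u n - u (n + 1)" for n
    using ru[of n] by (simp_all add: eq_diff_eq add.commute)
  have rv': "v (n + 1) = (2 + complex_of_real (q n) - w) * v n - v (n - 1)"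
    "v (n - 1) = (2 + complex_of_real (q n) - w) * v n - v (n + 1)" for n
    using rv[of n] by (simp_all add: eq_diff_eq add.commute)
  have up: "u (int k) = v (int k) \<and> u (int k + 1) = v (int k + 1)" for k
  proof (induction k)
    case (Suc k)
    have "u (int k + 1 + 1) = v (int k + 1 + 1)"
      unfolding ru'(1)[of "int k + 1"] rv'(1)[of "int k + 1"] using Suc by simp
    thus ?case using Suc by (simp add: algebra_simps)
  qed (use assms in auto)
  have down: "u (- int k) = v (- int k) \<and> u (1 - int k) = v (1 - int k)" for k
  proof (induction k)
    case (Suc k)
    have "u (- int k - 1) = v (- int k - 1)"
      unfolding ru'(2)[of "- int k"] rv'(2)[of "- int k"] using Suc by simp
    moreover have e: "- int (Suc k) = - int k - 1" "1 - int (Suc k) = - int k" by auto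
    ultimately show ?case unfolding e using Suc by blast
  qed (use assms in auto)
  show ?thesis
  proof
    fix n show "u n = v n"
      using up[of "nat n"] down[of "nat (- n)"] by (cases "n \<ge> 0") auto
  qed
qed

definition wronskian :: "(int \<Rightarrow> complex) \<Rightarrow> (int \<Rightarrow> complex) \<Rightarrow> int \<Rightarrow> complex" where
  "wronskian u v n = u n * v (n + 1) - u (n + 1) * v n"

lemma wronskian_const:
  assumes u: "Hop q u = (\<lambda>n. w * u n)" and v: "Hop q v = (\<lambda>n. w * v n)"
  shows "wronskian u v n = wronskian u v m"
proof -
  have step: "wronskian u v n = wronskian u v (n - 1)" for n
  proof -
    define c where "c = 2 + complex_of_real (q n) - w"
    have "u (n + 1) + u (n - 1) = c * u n" "v (n + 1) + v (n - 1) = c * v n"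
      using fun_cong[OF u, of n] fun_cong[OF v, of n] unfolding Hop_eq_iff c_def by auto
    hence h: "u (n + 1) = c * u n - u (n - 1)" "v (n + 1) = c * v n - v (n - 1)"
      by (simp_all add: eq_diff_eq)
    have "wronskian u v n = u n * (c * v n - v (n - 1)) - (c * u n - u (n - 1)) * v n"
      by (simp only: wronskian_def h)
    thus ?thesis by (simp add: wronskian_def algebra_simps)
  qed
  have "wronskian u v n = wronskian u v 0" for n
  proof (induction n rule: int_induct[where k=0])
    case (step1 i)
    thus ?case using step[of "i + 1"] by simp
  next
    case (step2 i)
    thus ?case using step[of i] by simp
  qed simp
  thus ?thesis by metis
qed

text \<open>By uniqueness it suffices that the data at 0 and 1 are proportional. A nonzero solution
  cannot vanish at both sites, so the quotient can be formed at one of them.\<close>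

lemma wronskian_zero_imp_dependent:
  assumes u: "Hop q u = (\<lambda>n. w * u n)" and v: "Hop q v = (\<lambda>n. w * v n)"
      and nz: "u \<noteq> (\<lambda>_. 0)" "v \<noteq> (\<lambda>_. 0)" and W: "wronskian u v 0 = 0"
  shows "\<exists>c. c \<noteq> 0 \<and> u = (\<lambda>n. c * v n)"
proof -
  have W': "u 0 * v 1 = u 1 * v 0" using W by (simp add: wronskian_def)
  have zero: "Hop q (\<lambda>_. 0) = (\<lambda>n. w * 0)" by (simp add: Hop_def)
  have v01: "v 0 \<noteq> 0 \<or> v 1 \<noteq> 0"
    using Hop_solution_unique[OF v zero] nz by auto
  define c where "c = (if v 0 \<noteq> 0 then u 0 / v 0 else u 1 / v 1)"
  have c: "u 0 = c * v 0" "u 1 = c * v 1"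
    using v01 W' by (auto simp: c_def field_simps)
  have cv: "Hop q (\<lambda>n. c * v n) = (\<lambda>n. w * (c * v n))"
  proof
    fix n
    have "Hop q (\<lambda>n. c * v n) n = c * Hop q v n" by (simp add: Hop_def algebra_simps)
    thus "Hop q (\<lambda>n. c * v n) n = w * (c * v n)" by (simp add: v)
  qed
  have "u = (\<lambda>n. c * v n)" by (rule Hop_solution_unique[OF u cv c])
  moreover from this nz have "c \<noteq> 0" by auto
  ultimately show ?thesis by blast
qed

lemma Hop_cnj:
  assumes "Hop q u = (\<lambda>n. w * u n)"
  shows "Hop q (\<lambda>n. cnj (u n)) = (\<lambda>n. cnj w * cnj (u n))"
proof
  fix n
  have "Hop q (\<lambda>n. cnj (u n)) n = cnj (Hop q u n)" by (simp add: Hop_def)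
  thus "Hop q (\<lambda>n. cnj (u n)) n = cnj w * cnj (u n)" by (simp add: assms)
qed

lemma int_summable_on:
  fixes f :: "nat \<Rightarrow> real"
  assumes "summable f" "\<And>k. f k \<ge> 0"
  shows "(\<lambda>n::int. f (nat \<bar>n\<bar>)) summable_on UNIV"
proof -
  have s: "f summable_on UNIV" using assms by (intro summable_nonneg_imp_summable_on) auto
  have 1: "(\<lambda>n::int. f (nat \<bar>n\<bar>)) summable_on {0..}"
  proof -
    have b: "bij_betw int UNIV {0..}" by (rule bij_betwI[where g=nat]) auto
    show ?thesis using summable_on_reindex_bij_betw[OF b, of "\<lambda>n. f (nat \<bar>n\<bar>)"] s by simp
  qed
  have 2: "(\<lambda>n::int. f (nat \<bar>n\<bar>)) summable_on {..0}"
  proof -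
    have b: "bij_betw (\<lambda>k. - int k) UNIV {..0}" by (rule bij_betwI[where g="\<lambda>n. nat (- n)"]) auto
    show ?thesis using summable_on_reindex_bij_betw[OF b, of "\<lambda>n. f (nat \<bar>n\<bar>)"] s by simp
  qed
  have "UNIV = {0..} \<union> {..0::int}" by auto
  thus ?thesis using summable_on_union[OF 1 2] by simp
qed

lemma l2_exponential_decay:
  assumes r: "0 \<le> r" "r < 1" and u: "\<And>n. \<bar>n\<bar> \<ge> N \<Longrightarrow> cmod (u n) \<le> K * r ^ nat \<bar>n\<bar>"
  shows "l2 u"
proof -
  have s: "summable (\<lambda>k. K\<^sup>2 * (r\<^sup>2) ^ k)"
    using r by (intro summable_mult summable_geometric) (auto simp: power_less_one_iff abs_square_less_1)
  have S: "(\<lambda>n::int. K\<^sup>2 * (r\<^sup>2) ^ nat \<bar>n\<bar>) summable_on UNIV"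
    by (rule int_summable_on[OF s]) simp
  have "(\<lambda>n. (cmod (u n))\<^sup>2) summable_on {n. \<bar>n\<bar> \<ge> N}"
  proof (rule summable_on_comparison_test)
    show "(\<lambda>n. K\<^sup>2 * (r\<^sup>2) ^ nat \<bar>n\<bar>) summable_on {n. \<bar>n\<bar> \<ge> N}"
      by (rule summable_on_subset_banach[OF S]) simp
    fix n assume "n \<in> {n. \<bar>n\<bar> \<ge> N}"
    hence "(cmod (u n))\<^sup>2 \<le> (K * r ^ nat \<bar>n\<bar>)\<^sup>2" using u by (intro power_mono) auto
    thus "(cmod (u n))\<^sup>2 \<le> K\<^sup>2 * (r\<^sup>2) ^ nat \<bar>n\<bar>"
      by (simp add: power_mult_distrib power_mult[symmetric] mult.commute)
  qed auto
  moreover have "(\<lambda>n. (cmod (u n))\<^sup>2) summable_on {n. \<bar>n\<bar> < N}"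
  proof (rule summable_on_finite)
    have "{n. \<bar>n\<bar> < N} \<subseteq> {-N..N}" by auto
    thus "finite {n. \<bar>n\<bar> < N}" by (rule finite_subset) simp
  qed
  ultimately have "(\<lambda>n. (cmod (u n))\<^sup>2) summable_on ({n. \<bar>n\<bar> \<ge> N} \<union> {n. \<bar>n\<bar> < N})"
    by (rule summable_on_union)
  moreover have "{n. \<bar>n\<bar> \<ge> N} \<union> {n. \<bar>n\<bar> < N} = UNIV" by auto
  ultimately show ?thesis by (simp add: l2_iff)
qed

subsection \<open>The Wronskian of the Jost solutions\<close>

text \<open>This is \<open>z\<close> times the Wronskian, which makes it holomorphic at \<open>0\<close>.\<close>

definition jV :: "(int \<Rightarrow> real) \<Rightarrow> complex \<Rightarrow> complex" where
  "jV q z = z\<^sup>2 * (jh (reflected q) 0 z * jh q 1 z) - jh (reflected q) (-1) z * jh q 0 z"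

lemma jf_nonzero:
  assumes "decaying q" "cmod z \<le> 1" "z \<noteq> 0"
  shows "\<exists>n. jf q z n \<noteq> 0"
proof -
  have "eventually (\<lambda>N. jh q (int N) z \<noteq> 0) sequentially"
    using jh_tendsto[OF assms(1,2)] by (rule tendsto_imp_eventually_ne) simp
  then obtain N where "jh q (int N) z \<noteq> 0" by (auto simp: eventually_sequentially)
  thus ?thesis using assms by (auto simp: jf_def)
qed

lemma jg_nonzero:
  assumes "decaying q" "cmod z \<le> 1" "z \<noteq> 0"
  shows "\<exists>n. jg q z n \<noteq> 0"
proof -
  obtain n where "jf (reflected q) z n \<noteq> 0"
    using jf_nonzero[OF decaying_reflected[OF assms(1)] assms(2,3)] by auto
  thus ?thesis by (intro exI[of _ "- n"]) (simp add: jg_def)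
qed

lemma jV_wronskian:
  assumes "z \<noteq> 0"
  shows "wronskian (jg q z) (jf q z) 0 = jV q z / z"
  using assms by (simp add: wronskian_def jg_def jf_def jV_def field_simps power2_eq_square power_int_minus)

lemma jV_0: "jV q 0 = -1"
  by (simp add: jV_def jh_0)

lemma jV_continuous_on: "decaying q \<Longrightarrow> continuous_on (cball 0 1) (jV q)"
  unfolding jV_def[abs_def] by (intro continuous_intros jh_continuous_on decaying_reflected)

lemma jV_holomorphic_on: "decaying q \<Longrightarrow> jV q holomorphic_on ball 0 1"
  unfolding jV_def[abs_def] by (intro holomorphic_intros jh_holomorphic_on decaying_reflected)

lemma jV_zero_imp:
  assumes "decaying q" "cmod z \<le> 1" "z \<noteq> 0" "jV q z = 0"
  shows "\<exists>c. c \<noteq> 0 \<and> jg q z = (\<lambda>n. c * jf q z n)"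
proof (rule wronskian_zero_imp_dependent)
  show "Hop q (jg q z) = (\<lambda>n. om z * jg q z n)" "Hop q (jf q z) = (\<lambda>n. om z * jf q z n)"
    by (rule jg_solution[OF assms(1-3)], rule jf_solution[OF assms(1-3)])
  show "jg q z \<noteq> (\<lambda>_. 0)" "jf q z \<noteq> (\<lambda>_. 0)"
    using jg_nonzero[OF assms(1-3)] jf_nonzero[OF assms(1-3)] by auto
  show "wronskian (jg q z) (jf q z) 0 = 0" using jV_wronskian assms by simp
qed

lemma jf_bound:
  assumes dec: "decaying q"
  shows "\<exists>C\<ge>0. \<forall>n z. cmod z \<le> 1 \<longrightarrow> z \<noteq> 0 \<longrightarrow> n \<ge> 0 \<longrightarrow> cmod (jf q z n) \<le> C * cmod z ^ nat n"
proof -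
  obtain C where C: "C \<ge> 0" "\<And>n z. cmod z \<le> 1 \<Longrightarrow> cmod (jh q n z) \<le> C * jw n"
    using jh_bound[OF dec] by auto
  have "cmod (jf q z n) \<le> C * cmod z ^ nat n" if "cmod z \<le> 1" "n \<ge> 0" for n z
  proof -
    have "cmod (jf q z n) = cmod z ^ nat n * cmod (jh q n z)"
      using that by (simp add: jf_def norm_mult norm_power_int power_int_def norm_power)
    also have "\<dots> \<le> cmod z ^ nat n * C"
      using C(2)[OF that(1), of n] that by (intro mult_left_mono) (auto simp: jw_def)
    finally show ?thesis by (simp add: mult.commute)
  qed
  thus ?thesis using C(1) by (intro exI[of _ C]) simp
qed

lemma jg_bound:
  assumes dec: "decaying q"
  shows "\<exists>C\<ge>0. \<forall>n z. cmod z \<le> 1 \<longrightarrow> z \<noteq> 0 \<longrightarrow> n \<le> 0 \<longrightarrow> cmod (jg q z n) \<le> C * cmod z ^ nat (- n)"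
proof -
  obtain C where C: "C \<ge> 0" "\<forall>n z. cmod z \<le> 1 \<longrightarrow> z \<noteq> 0 \<longrightarrow> n \<ge> 0 \<longrightarrow> cmod (jf (reflected q) z n) \<le> C * cmod z ^ nat n"
    using jf_bound[OF decaying_reflected[OF dec]] by auto
  have "cmod (jg q z n) \<le> C * cmod z ^ nat (- n)" if "cmod z \<le> 1" "z \<noteq> 0" "n \<le> 0" for n z
    unfolding jg_def using C(2)[rule_format, OF that(1,2), of "- n"] that(3) by simp
  thus ?thesis using C(1) by (intro exI[of _ C]) simp
qed

text \<open>On the circle \<open>om z\<close> is real, so the conjugate solves the same equation and
  the Wronskian is constant. Its value is read off at \<open>+\<infinity>\<close>, where the Jost
  factor tends to 1.\<close>

lemma jf_cnj_wronskian:
  assumes dec: "decaying q" and z: "cmod z = 1"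
  shows "wronskian (jf q z) (\<lambda>n. cnj (jf q z n)) n = cnj z - z"
proof -
  have z0: "z \<noteq> 0" using z by auto
  have zz: "z * cnj z = 1" using z complex_norm_square[of z] by simp
  have real: "cnj (om z) = om z"
  proof -
    have "inverse z = cnj z" using zz by (rule inverse_unique)
    thus ?thesis by (simp add: om_def)
  qed
  note sol = jf_solution[OF dec _ z0]
  have c: "wronskian (jf q z) (\<lambda>n. cnj (jf q z n)) n = wronskian (jf q z) (\<lambda>n. cnj (jf q z n)) m" for m n
  proof (rule wronskian_const[where w="om z"])
    show "Hop q (jf q z) = (\<lambda>n. om z * jf q z n)" using sol z by simp
    from Hop_cnj[OF this] show "Hop q (\<lambda>n. cnj (jf q z n)) = (\<lambda>n. om z * cnj (jf q z n))"
      by (simp only: real)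
  qed
  have eq: "wronskian (jf q z) (\<lambda>n. cnj (jf q z n)) (int N) =
      cnj z * (jh q (int N) z * cnj (jh q (int (Suc N)) z)) - z * (jh q (int (Suc N)) z * cnj (jh q (int N) z))" for N
  proof -
    have p: "z ^ N * cnj z ^ N = 1" by (simp add: zz flip: power_mult_distrib)
    have "wronskian (jf q z) (\<lambda>n. cnj (jf q z n)) (int N) =
       (z ^ N * cnj z ^ N) * (cnj z * (jh q (int N) z * cnj (jh q (int (Suc N)) z)) - z * (jh q (int (Suc N)) z * cnj (jh q (int N) z)))"
      using z0 by (simp add: wronskian_def jf_def power_int_add algebra_simps)
    thus ?thesis by (simp only: p mult_1)
  qed
  have "(\<lambda>N. cnj z * (jh q (int N) z * cnj (jh q (int (Suc N)) z)) - z * (jh q (int (Suc N)) z * cnj (jh q (int N) z)))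
     \<longlonglongrightarrow> cnj z * (1 * cnj 1) - z * (1 * cnj 1)"
    using jh_tendsto[OF dec, of z] LIMSEQ_Suc[OF jh_tendsto[OF dec, of z]] z by (intro tendsto_intros) auto
  moreover have "(\<lambda>N. wronskian (jf q z) (\<lambda>n. cnj (jf q z n)) (int N)) \<longlonglongrightarrow> wronskian (jf q z) (\<lambda>n. cnj (jf q z n)) n"
  proof -
    have "(\<lambda>N. wronskian (jf q z) (\<lambda>n. cnj (jf q z n)) (int N)) = (\<lambda>_. wronskian (jf q z) (\<lambda>n. cnj (jf q z n)) n)"
      by (rule ext, rule c)
    thus ?thesis by (simp only: tendsto_const)
  qed
  ultimately have "wronskian (jf q z) (\<lambda>n. cnj (jf q z n)) n = cnj z * (1 * cnj 1) - z * (1 * cnj 1)"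
    unfolding eq by (intro LIMSEQ_unique)
  thus ?thesis by simp
qed

text \<open>Reflection reverses the orientation of the Wronskian, hence the opposite sign.\<close>

lemma jg_cnj_wronskian:
  assumes dec: "decaying q" and z: "cmod z = 1"
  shows "wronskian (jg q z) (\<lambda>n. cnj (jg q z n)) n = z - cnj z"
proof -
  have e: "- (n + 1) = - n - 1" "- n - 1 + 1 = - n" by auto
  show ?thesis
    using jf_cnj_wronskian[OF decaying_reflected[OF dec] z, of "- n - 1"]
    unfolding wronskian_def jg_def e by (simp add: algebra_simps)
qed

section \<open>Nonvanishing of the Wronskian on the unit circle\<close>

locale nonresonant =
  fixes q :: "int \<Rightarrow> real"
  assumes dec: "decaying q" and res0: "\<not> resonance q 0" and res4: "\<not> resonance q 4"
begin

text \<open>At a zero \<open>jg\<close> is a multiple \<open>c\<close> of \<open>jf\<close>. Their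
  Wronskians with the conjugates have opposite signs, which forces
  \<open>(1 + (cmod c)\<^sup>2) * Im z = 0\<close>. At \<open>z = \<plusminus>1\<close>
  proportionality makes \<open>jf\<close> bounded on both half-lines, a resonance at 0 or 4.\<close>

lemma jV_nonzero_circle:
  assumes z: "cmod z = 1"
  shows "jV q z \<noteq> 0"
proof
  assume "jV q z = 0"
  have z0: "z \<noteq> 0" using z by auto
  obtain c where c: "c \<noteq> 0" "jg q z = (\<lambda>n. c * jf q z n)"
    using jV_zero_imp[OF dec _ z0 \<open>jV q z = 0\<close>] z by auto
  have "wronskian (jg q z) (\<lambda>n. cnj (jg q z n)) 0 = (c * cnj c) * wronskian (jf q z) (\<lambda>n. cnj (jf q z n)) 0"
    unfolding c(2) by (simp add: wronskian_def algebra_simps)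
  hence "z - cnj z = (c * cnj c) * (cnj z - z)"
    unfolding jg_cnj_wronskian[OF dec z] jf_cnj_wronskian[OF dec z] .
  hence "(1 + c * cnj c) * (z - cnj z) = 0" by (simp add: algebra_simps)
  moreover have "1 + c * cnj c \<noteq> 0"
  proof -
    have "1 + c * cnj c = complex_of_real (1 + (cmod c)\<^sup>2)" by (simp only: complex_norm_square of_real_add of_real_1)
    moreover have "1 + (cmod c)\<^sup>2 \<noteq> 0" using zero_le_power2[of "cmod c"] by linarith
    ultimately show ?thesis by (simp only: of_real_eq_0_iff not_False_eq_True)
  qed
  ultimately have "z = cnj z" by simp
  hence im: "Im z = 0" by (simp add: complex_eq_iff)
  hence "Re z = 1 \<or> Re z = -1" using z by (auto simp: cmod_def)
  hence z1: "z = 1 \<or> z = -1" using im by (auto simp: complex_eq_iff)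
  obtain C1 where C1: "C1 \<ge> 0" "\<forall>n z. cmod z \<le> 1 \<longrightarrow> z \<noteq> 0 \<longrightarrow> n \<ge> 0 \<longrightarrow> cmod (jf q z n) \<le> C1 * cmod z ^ nat n"
    using jf_bound[OF dec] by auto
  obtain C2 where C2: "C2 \<ge> 0" "\<forall>n z. cmod z \<le> 1 \<longrightarrow> z \<noteq> 0 \<longrightarrow> n \<le> 0 \<longrightarrow> cmod (jg q z n) \<le> C2 * cmod z ^ nat (- n)"
    using jg_bound[OF dec] by auto
  have "cmod (jf q z n) \<le> C1 + C2 / cmod c" for n
  proof (cases "n \<ge> 0")
    case True
    hence "cmod (jf q z n) \<le> C1" using C1(2)[rule_format, of z n] z z0 by simp
    moreover have "C2 / cmod c \<ge> 0" using C2(1) by simp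
    ultimately show ?thesis by linarith
  next
    case False
    hence "cmod (jg q z n) \<le> C2" using C2(2)[rule_format, of z n] z z0 by simp
    hence "cmod (jf q z n) \<le> C2 / cmod c" using c by (simp add: norm_mult field_simps)
    thus ?thesis using C1(1) by linarith
  qed
  hence "bounded (range (jf q z))" by (auto intro!: boundedI)
  moreover have "jf q z \<noteq> (\<lambda>_. 0)" using jf_nonzero[OF dec _ z0] z by auto
  moreover have "Hop q (jf q z) = (\<lambda>n. om z * jf q z n)" using jf_solution[OF dec _ z0] z by simp
  ultimately have "resonance q r" if "om z = complex_of_real r" for r
    using that unfolding resonance_def by auto
  moreover have "om z = complex_of_real 0 \<or> om z = complex_of_real 4" using z1 by (auto simp: om_def)
  ultimately show False using res0 res4 by blast
qed


section \<open>The Green kernel and the resolvent bound\<close>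

definition "Q = (SOME Q. \<forall>n. \<bar>q n\<bar> \<le> Q)"

lemma Q: "\<bar>q n\<bar> \<le> Q"
proof -
  have "\<bar>q n\<bar> \<le> (\<Sum>\<^sub>\<infinity>n. (wt n)\<^sup>2 * \<bar>q n\<bar>)" for n
  proof -
    have "1 * \<bar>q n\<bar> \<le> (wt n)\<^sup>2 * \<bar>q n\<bar>"
      by (intro mult_right_mono) (auto simp: power2_eq_square algebra_simps)
    also have "\<dots> = (\<Sum>n\<in>{n}. (wt n)\<^sup>2 * \<bar>q n\<bar>)" by simp
    also have "\<dots> \<le> (\<Sum>\<^sub>\<infinity>n. (wt n)\<^sup>2 * \<bar>q n\<bar>)"
      using dec by (intro finite_sum_le_infsum) (auto simp: decaying_def)
    finally show ?thesis by simp
  qed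
  hence "\<exists>Q. \<forall>n. \<bar>q n\<bar> \<le> Q" by blast
  from someI_ex[OF this] show ?thesis by (auto simp: Q_def)
qed

text \<open>The Green kernel before division by the Wronskian, so that its columns remain available
  at the zeros of \<open>jV\<close>, where they become multiples of an eigenfunction.\<close>

definition jG :: "complex \<Rightarrow> int \<Rightarrow> int \<Rightarrow> complex" where
  "jG z n m = jg q z (min n m) * jf q z (max n m)"

text \<open>Off the diagonal each factor solves the equation; at \<open>n = m\<close> the mismatch
  of the two branches is the Wronskian at \<open>m\<close>, which is constant.\<close>

lemma jG_eq:
  assumes z: "cmod z \<le> 1" "z \<noteq> 0"
  shows "Hop q (\<lambda>n. jG z n m) n = om z * jG z n m - (if n = m then jV q z / z else 0)"
proof -
  define c where "c = 2 + complex_of_real (q n) - om z"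
  have f: "jf q z (n + 1) + jf q z (n - 1) = c * jf q z n"
    using fun_cong[OF jf_solution[OF dec z], of n] unfolding Hop_eq_iff c_def .
  have g: "jg q z (n + 1) + jg q z (n - 1) = c * jg q z n"
    using fun_cong[OF jg_solution[OF dec z], of n] unfolding Hop_eq_iff c_def .
  have H: "Hop q u n = om z * u n + (c * u n - (u (n + 1) + u (n - 1)))" for u
    by (simp add: Hop_def c_def algebra_simps)
  have W: "jV q z / z = jg q z m * jf q z (m + 1) - jg q z (m + 1) * jf q z m"
    using jV_wronskian[OF z(2), of q] wronskian_const[OF jg_solution[OF dec z] jf_solution[OF dec z], of 0 m]
    by (simp add: wronskian_def)
  consider "n < m" | "n = m" | "n > m" by linarith
  hence "c * jG z n m - (jG z (n + 1) m + jG z (n - 1) m) = - (if n = m then jV q z / z else 0)"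
  proof cases
    case 1
    hence "jG z n m = jg q z n * jf q z m" "jG z (n + 1) m = jg q z (n + 1) * jf q z m" "jG z (n - 1) m = jg q z (n - 1) * jf q z m"
      by (auto simp: jG_def min_def max_def)
    hence "c * jG z n m - (jG z (n + 1) m + jG z (n - 1) m) = (c * jg q z n - (jg q z (n + 1) + jg q z (n - 1))) * jf q z m"
      by (simp add: algebra_simps)
    thus ?thesis using 1 g by simp
  next
    case 2
    hence "jG z n m = jg q z m * jf q z m" "jG z (n + 1) m = jg q z m * jf q z (m + 1)" "jG z (n - 1) m = jg q z (m - 1) * jf q z m"
      by (auto simp: jG_def min_def max_def)
    hence "c * jG z n m - (jG z (n + 1) m + jG z (n - 1) m) = (c * jg q z n - (jg q z (n + 1) + jg q z (n - 1))) * jf q z m - jV q z / z"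
      unfolding W using 2 by (simp add: algebra_simps)
    thus ?thesis using 2 g by simp
  next
    case 3
    hence "min n m = m" "max n m = n" "min (n + 1) m = m" "max (n + 1) m = n + 1" "min (n - 1) m = m" "max (n - 1) m = n - 1"
      by auto
    hence "jG z n m = jg q z m * jf q z n" "jG z (n + 1) m = jg q z m * jf q z (n + 1)" "jG z (n - 1) m = jg q z m * jf q z (n - 1)"
      by (simp_all only: jG_def)
    hence "c * jG z n m - (jG z (n + 1) m + jG z (n - 1) m) = jg q z m * (c * jf q z n - (jf q z (n + 1) + jf q z (n - 1)))"
      by (simp add: algebra_simps)
    thus ?thesis using 3 f by simp
  qed
  thus ?thesis using H[of "\<lambda>n. jG z n m"] by simp
qed

text \<open>Beyond \<open>\<bar>m\<bar>\<close> each half-line meets only the Jost solution that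
  decays there geometrically, with ratio \<open>cmod z < 1\<close>.\<close>

lemma jG_l2:
  assumes z: "cmod z < 1" "z \<noteq> 0"
  shows "l2 (\<lambda>n. jG z n m)"
proof -
  obtain C1 where C1: "C1 \<ge> 0" "\<forall>n z. cmod z \<le> 1 \<longrightarrow> z \<noteq> 0 \<longrightarrow> n \<ge> 0 \<longrightarrow> cmod (jf q z n) \<le> C1 * cmod z ^ nat n"
    using jf_bound[OF dec] by auto
  obtain C2 where C2: "C2 \<ge> 0" "\<forall>n z. cmod z \<le> 1 \<longrightarrow> z \<noteq> 0 \<longrightarrow> n \<le> 0 \<longrightarrow> cmod (jg q z n) \<le> C2 * cmod z ^ nat (- n)"
    using jg_bound[OF dec] by auto
  define K where "K = cmod (jg q z m) * C1 + C2 * cmod (jf q z m)"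
  show ?thesis
  proof (rule l2_exponential_decay[of "cmod z" "\<bar>m\<bar> + 1" _ K])
    fix n assume n: "\<bar>m\<bar> + 1 \<le> \<bar>n\<bar>"
    show "cmod (jG z n m) \<le> K * cmod z ^ nat \<bar>n\<bar>"
    proof (cases "n \<ge> 0")
      case True
      hence "jG z n m = jg q z m * jf q z n" using n by (auto simp: jG_def min_def max_def)
      hence "cmod (jG z n m) = cmod (jg q z m) * cmod (jf q z n)" by (simp add: norm_mult)
      also have "\<dots> \<le> cmod (jg q z m) * (C1 * cmod z ^ nat n)"
        using C1(2)[rule_format, of z n] z True by (intro mult_left_mono) auto
      also have "\<dots> \<le> K * cmod z ^ nat \<bar>n\<bar>"
        using True C2(1) C1(1) unfolding K_def mult.assoc[symmetric] by (intro mult_mono) auto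
      finally show ?thesis .
    next
      case False
      hence "jG z n m = jg q z n * jf q z m" using n by (auto simp: jG_def min_def max_def)
      hence "cmod (jG z n m) = cmod (jg q z n) * cmod (jf q z m)" by (simp add: norm_mult)
      also have "\<dots> \<le> (C2 * cmod z ^ nat (- n)) * cmod (jf q z m)"
        using C2(2)[rule_format, of z n] z False by (intro mult_right_mono) auto
      also have "\<dots> = (C2 * cmod (jf q z m)) * cmod z ^ nat \<bar>n\<bar>" using False by simp
      also have "\<dots> \<le> K * cmod z ^ nat \<bar>n\<bar>"
        using C1(1) unfolding K_def by (intro mult_right_mono) auto
      finally show ?thesis .
    qed
  qed (use z in auto)
qed

text \<open>The resolvent bound \<open>\<parallel>(H - \<omega>)\<^sup>-\<^sup>1\<parallel> \<le> 1 / \<bar>Im \<omega>\<bar>\<close>, read off at the diagonal entry \<open>(m, m)\<close>.\<close>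

lemma resolvent_bound:
  assumes z: "cmod z < 1" "z \<noteq> 0"
  shows "\<bar>Im (om z)\<bar> * cmod (jg q z m * jf q z m) \<le> cmod (jV q z / z)"
proof -
  define u where "u = (\<lambda>n. jG z n m)"
  define W where "W = jV q z / z"
  have u: "l2 u" unfolding u_def by (rule jG_l2[OF z])
  have Hu: "Hop q u = (\<lambda>n. om z * u n - (if n = m then W else 0))"
    using jG_eq[of z m] z by (auto simp: u_def W_def)
  have d: "l2 (\<lambda>n. if n = m then W else 0)"
    by (rule l2_exponential_decay[of 0 "\<bar>m\<bar> + 1" _ 0]) auto
  have "l2inner (\<lambda>n. if n = m then W else 0) u = (\<Sum>\<^sub>\<infinity>n\<in>{m}. (if n = m then W else 0) * cnj (u n))"
    unfolding l2inner_def by (rule infsum_cong_neutral) auto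
  hence dm: "l2inner (\<lambda>n. if n = m then W else 0) u = W * cnj (u m)" by simp
  have eq: "l2inner (Hop q u) u = om z * of_real ((wnorm 0 u)\<^sup>2) - W * cnj (u m)"
    unfolding Hu using l2inner_diff_left[OF l2_cmult(1)[OF u] d u, of "om z"] 
    by (simp only: dm l2inner_cmult_left l2inner_self[OF u])
  have "l2inner (Hop q u) u = cnj (l2inner (Hop q u) u)"
    using Hop_symmetric[where q=q, OF u u Q] l2inner_commute[of u "Hop q u"] by simp
  hence "Im (l2inner (Hop q u) u) = 0" by (simp add: complex_eq_iff)
  hence "Im (om z) * (wnorm 0 u)\<^sup>2 = Im (W * cnj (u m))"
    unfolding eq by (simp del: of_real_power)
  hence "\<bar>Im (om z)\<bar> * (wnorm 0 u)\<^sup>2 = \<bar>Im (W * cnj (u m))\<bar>"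
    using abs_mult[of "Im (om z)" "(wnorm 0 u)\<^sup>2"] by simp
  also have "\<dots> \<le> cmod W * cmod (u m)"
    using abs_Im_le_cmod[of "W * cnj (u m)"] by (simp only: norm_mult complex_mod_cnj)
  finally have le: "\<bar>Im (om z)\<bar> * (wnorm 0 u)\<^sup>2 \<le> cmod W * cmod (u m)" .
  have "(cmod (u m))\<^sup>2 \<le> (wnorm 0 u)\<^sup>2" using cmod_le_wnorm_0[OF u] by (intro power_mono) auto
  hence "\<bar>Im (om z)\<bar> * (cmod (u m))\<^sup>2 \<le> cmod W * cmod (u m)"
    using le mult_left_mono[of "(cmod (u m))\<^sup>2" "(wnorm 0 u)\<^sup>2" "\<bar>Im (om z)\<bar>"] by simp
  hence "\<bar>Im (om z)\<bar> * cmod (u m) \<le> cmod W"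
    by (cases "u m = 0") (auto simp: power2_eq_square mult.assoc[symmetric])
  thus ?thesis by (simp add: u_def W_def jG_def)
qed

section \<open>Zeros of the Wronskian inside the disc\<close>

definition "Z = {z \<in> ball 0 1. jV q z = 0}"

lemma Z_D:
  assumes "z \<in> Z"
  shows "cmod z < 1" "z \<noteq> 0" "jV q z = 0"
  using assms jV_0[of q] by (auto simp: Z_def)

text \<open>The zero set in the closed disc is compact and misses the circle, so zeros cannot
  accumulate at the boundary, where holomorphy is lost.\<close>

lemma jV_zeros_radius: "\<exists>r<1. \<forall>z. cmod z \<le> 1 \<longrightarrow> jV q z = 0 \<longrightarrow> cmod z \<le> r"
proof -
  have "closed {z \<in> cball 0 1. jV q z = 0}"
    using continuous_closed_preimage_constant[OF jV_continuous_on[OF dec] closed_cball] by simp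
  moreover have "bounded {z \<in> cball 0 1. jV q z = 0}" by (rule bounded_subset[of "cball 0 1"]) auto
  ultimately have cl: "compact {z \<in> cball 0 1. jV q z = 0}" by (simp add: compact_eq_bounded_closed)
  show ?thesis
  proof (cases "{z \<in> cball 0 1. jV q z = 0} = {}")
    case True
    thus ?thesis by (intro exI[of _ 0]) auto
  next
    case False
    obtain x where x: "x \<in> {z \<in> cball 0 1. jV q z = 0}" "\<forall>y\<in>{z \<in> cball 0 1. jV q z = 0}. cmod y \<le> cmod x"
      using continuous_attains_sup[OF cl False, of cmod] continuous_on_norm_id by blast
    have "cmod x \<noteq> 1" using x(1) jV_nonzero_circle[of x] by auto
    thus ?thesis using x by (intro exI[of _ "cmod x"]) auto
  qed
qed

text \<open>The identity theorem is applied on a smaller closed disc that holds all zeros. A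
  constant \<open>jV\<close> has no zeros, because \<open>jV q 0 = -1\<close>.\<close>

lemma finite_Z: "finite Z"
proof -
  obtain r where r: "r < 1" "\<And>z. cmod z \<le> 1 \<Longrightarrow> jV q z = 0 \<Longrightarrow> cmod z \<le> r" using jV_zeros_radius by auto
  have "Z \<subseteq> {z \<in> cball 0 r. jV q z = 0}" using r by (auto simp: Z_def)
  moreover have "finite {z \<in> cball 0 r. jV q z = 0}" if "\<not> jV q constant_on ball 0 1"
    by (rule holomorphic_compact_finite_zeros[OF jV_holomorphic_on[OF dec]]) (use that r in auto)
  moreover have "Z = {}" if const: "jV q constant_on ball 0 1"
  proof -
    obtain c where c: "\<And>z. z \<in> ball 0 1 \<Longrightarrow> jV q z = c" using const by (auto simp: constant_on_def)
    have "c = -1" using c[of 0] jV_0[of q] by simp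
    thus ?thesis using c by (auto simp: Z_def)
  qed
  ultimately show ?thesis using finite_subset by (cases "jV q constant_on ball 0 1") auto
qed

lemma Z_dependent: 
  assumes "z \<in> Z"
  shows "\<exists>c. c \<noteq> 0 \<and> jg q z = (\<lambda>n. c * jf q z n)"
  using jV_zero_imp[OF dec] Z_D[OF assms] by (meson less_imp_le)

lemma Im_om: "Im (om z) = Im z * (1 / (cmod z)\<^sup>2 - 1)"
  by (simp add: om_def cmod_power2 right_diff_distrib)

lemma om_factor_nonzero:
  assumes "cmod z < 1" "z \<noteq> 0"
  shows "1 / (cmod z)\<^sup>2 - 1 \<noteq> 0"
proof -
  have "(cmod z)\<^sup>2 < 1\<^sup>2" using assms by (intro power_strict_mono) auto
  thus ?thesis using assms by (auto simp: field_simps)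
qed

text \<open>At a zero the right-hand side of \<open>resolvent_bound\<close> vanishes, so
  \<open>om z\<close> is real; inside the disc this happens only for real \<open>z\<close>.\<close>

lemma Z_real:
  assumes "z \<in> Z"
  shows "Im z = 0"
proof -
  note z = Z_D[OF assms]
  obtain c where c: "c \<noteq> 0" "jg q z = (\<lambda>n. c * jf q z n)" using Z_dependent[OF assms] by blast
  obtain m where m: "jf q z m \<noteq> 0" using jf_nonzero[OF dec _ z(2)] z(1) by auto
  have "\<bar>Im (om z)\<bar> * cmod (jg q z m * jf q z m) \<le> 0"
    using resolvent_bound[OF z(1,2), of m] z(3) by simp
  moreover have "cmod (jg q z m * jf q z m) > 0" using c m by simp
  ultimately have "Im (om z) = 0" by (simp add: mult_le_0_iff)
  moreover have "1 / (cmod z)\<^sup>2 - 1 \<noteq> 0"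
    using om_factor_nonzero z by blast
  ultimately show ?thesis unfolding Im_om mult_eq_0_iff by blast
qed

lemma jf_continuous_at:
  assumes "cmod z < 1" "z \<noteq> 0"
  shows "isCont (\<lambda>z. jf q z m) z" "isCont (\<lambda>z. jg q z m) z"
proof -
  have h: "isCont (jh q' m') z" if "decaying q'" for q' m'
  proof -
    have "jh q' m' holomorphic_on ball 0 1" by (rule jh_holomorphic_on[OF that])
    hence "continuous_on (ball 0 1) (jh q' m')" by (rule holomorphic_on_imp_continuous_on)
    thus ?thesis using assms(1) continuous_on_eq_continuous_at[OF open_ball, of 0 1 "jh q' m'"] by simp
  qed
  show "isCont (\<lambda>z. jf q z m) z" unfolding jf_def using assms by (intro continuous_intros h dec) auto
  show "isCont (\<lambda>z. jg q z m) z" unfolding jg_def jf_def using assms by (intro continuous_intros h decaying_reflected dec) auto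
qed

lemma jV_deriv:
  assumes "cmod z < 1"
  shows "(jV q has_field_derivative deriv (jV q) z) (at z)"
  using assms by (intro holomorphic_derivI[OF jV_holomorphic_on[OF dec] open_ball]) auto

text \<open>Approaching a zero vertically, a multiple zero would contradict the resolvent bound.\<close>

lemma Z_simple:
  assumes "z \<in> Z"
  shows "deriv (jV q) z \<noteq> 0"
proof
  assume d0: "deriv (jV q) z = 0"
  note z = Z_D[OF assms]
  obtain c where c: "c \<noteq> 0" "jg q z = (\<lambda>n. c * jf q z n)" using Z_dependent[OF assms] by blast
  obtain m where m: "jf q z m \<noteq> 0" using jf_nonzero[OF dec _ z(2)] z(1) by auto
  define \<zeta> where "\<zeta> e = z + \<i> * complex_of_real e" for e
  have \<zeta>: "(\<zeta> \<longlongrightarrow> z) (at_right 0)"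
  proof -
    have "((\<lambda>e. z + \<i> * complex_of_real e) \<longlongrightarrow> z + \<i> * complex_of_real 0) (at_right 0)" by (intro tendsto_intros)
    thus ?thesis by (simp add: \<zeta>_def[abs_def])
  qed
  have "eventually (\<lambda>e. e > 0) (at_right (0::real))" by (simp add: eventually_at_right_less)
  hence \<zeta>at: "filterlim \<zeta> (at z) (at_right 0)"
    by (intro filterlim_atI \<zeta>) (auto elim!: eventually_mono simp: \<zeta>_def)
  have "((\<lambda>y. (jV q y - jV q z) / (y - z)) \<longlongrightarrow> 0) (at z)"
    using jV_deriv[OF z(1)] unfolding has_field_derivative_iff d0 .
  from filterlim_compose[OF this \<zeta>at]
  have "((\<lambda>e. (jV q (\<zeta> e) - jV q z) / (\<zeta> e - z)) \<longlongrightarrow> 0) (at_right 0)" .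
  hence "((\<lambda>e. cmod ((jV q (\<zeta> e) - jV q z) / (\<zeta> e - z)) / cmod (\<zeta> e)) \<longlongrightarrow> cmod 0 / cmod z) (at_right 0)"
    using z by (intro tendsto_intros \<zeta>) auto
  hence R: "((\<lambda>e. cmod ((jV q (\<zeta> e) - jV q z) / (\<zeta> e - z)) / cmod (\<zeta> e)) \<longlongrightarrow> 0) (at_right 0)" by simp
  have L: "((\<lambda>e. \<bar>1 / (cmod (\<zeta> e))\<^sup>2 - 1\<bar> * cmod (jg q (\<zeta> e) m * jf q (\<zeta> e) m)) \<longlongrightarrow>
      \<bar>1 / (cmod z)\<^sup>2 - 1\<bar> * cmod (jg q z m * jf q z m)) (at_right 0)"
    using z by (intro tendsto_intros \<zeta> isCont_tendsto_compose[OF jf_continuous_at(1)[OF z(1,2)]] 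
         isCont_tendsto_compose[OF jf_continuous_at(2)[OF z(1,2)]]) auto
  have "eventually (\<lambda>e. \<bar>1 / (cmod (\<zeta> e))\<^sup>2 - 1\<bar> * cmod (jg q (\<zeta> e) m * jf q (\<zeta> e) m) \<le>
      cmod ((jV q (\<zeta> e) - jV q z) / (\<zeta> e - z)) / cmod (\<zeta> e)) (at_right 0)"
  proof -
    have "((\<lambda>e. cmod (\<zeta> e)) \<longlongrightarrow> cmod z) (at_right 0)" by (intro tendsto_intros \<zeta>)
    hence "eventually (\<lambda>e. cmod (\<zeta> e) < 1) (at_right 0)" using z(1) by (rule order_tendstoD)
    moreover have "eventually (\<lambda>e. \<zeta> e \<noteq> 0) (at_right 0)" 
      using \<zeta> z(2) by (rule tendsto_imp_eventually_ne)
    moreover have "eventually (\<lambda>e. e > 0) (at_right (0::real))" by (simp add: eventually_at_right_less)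
    ultimately show ?thesis
    proof eventually_elim
      case (elim e)
      \<comment> \<open>As \<open>z\<close> is real, the imaginary part is \<open>e\<close> times a
        factor with nonzero limit; dividing the resolvent bound by \<open>e\<close> produces the
        difference quotient of \<open>jV q\<close>.\<close>
      have "Im (om (\<zeta> e)) = e * (1 / (cmod (\<zeta> e))\<^sup>2 - 1)"
        unfolding Im_om using Z_real[OF assms] by (simp add: \<zeta>_def)
      hence "e * (\<bar>1 / (cmod (\<zeta> e))\<^sup>2 - 1\<bar> * cmod (jg q (\<zeta> e) m * jf q (\<zeta> e) m)) \<le> cmod (jV q (\<zeta> e)) / cmod (\<zeta> e)"
        using resolvent_bound[of "\<zeta> e" m] elim by (simp add: abs_mult norm_divide mult_ac)
      hence "\<bar>1 / (cmod (\<zeta> e))\<^sup>2 - 1\<bar> * cmod (jg q (\<zeta> e) m * jf q (\<zeta> e) m) \<le> cmod (jV q (\<zeta> e)) / cmod (\<zeta> e) / e"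
        using elim by (simp only: pos_le_divide_eq mult.commute)
      moreover have "cmod ((jV q (\<zeta> e) - jV q z) / (\<zeta> e - z)) / cmod (\<zeta> e) = cmod (jV q (\<zeta> e)) / cmod (\<zeta> e) / e"
      proof -
        have "cmod (\<zeta> e - z) = e" using elim by (simp add: \<zeta>_def norm_mult)
        thus ?thesis using z(3) by (simp add: norm_divide)
      qed
      ultimately show ?case by simp
    qed
  qed
  from tendsto_le[OF _ R L this]
  have "\<bar>1 / (cmod z)\<^sup>2 - 1\<bar> * cmod (jg q z m * jf q z m) \<le> 0" by simp
  moreover have "1 / (cmod z)\<^sup>2 - 1 \<noteq> 0" using om_factor_nonzero z by blast
  moreover have "cmod (jg q z m * jf q z m) > 0" using c m by simp
  ultimately show False by (simp add: mult_le_0_iff)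
qed

text \<open>For \<open>m\<close> with \<open>jf q z m \<noteq> 0\<close>, column \<open>m\<close> of
  \<open>jG\<close> is a nonzero multiple of \<open>jf\<close>, and columns are square
  summable.\<close>

lemma Z_eigvec:
  assumes "z \<in> Z"
  shows "eigvec q (jf q z)"
proof -
  note z = Z_D[OF assms]
  obtain c where c: "c \<noteq> 0" "jg q z = (\<lambda>n. c * jf q z n)" using Z_dependent[OF assms] by blast
  obtain m where m: "jf q z m \<noteq> 0" using jf_nonzero[OF dec _ z(2)] z(1) by auto
  have "jG z n m = (c * jf q z m) * jf q z n" for n
    unfolding jG_def c(2) by (auto simp: min_def max_def)
  hence "jf q z n = inverse (c * jf q z m) * jG z n m" for n using c m by (simp add: field_simps)
  hence "jf q z = (\<lambda>n. inverse (c * jf q z m) * jG z n m)" by (rule ext)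
  moreover have "l2 (\<lambda>n. inverse (c * jf q z m) * jG z n m)"
    by (intro l2_cmult jG_l2 z)
  ultimately have "l2 (jf q z)" by (simp only:)
  moreover have "Hop q (jf q z) = (\<lambda>n. om z * jf q z n)" using jf_solution[OF dec _ z(2)] z(1) by simp
  ultimately show ?thesis using m unfolding eigvec_def by auto
qed

lemma Z_jf_real:
  assumes "z \<in> Z"
  shows "cnj (jf q z n) = jf q z n"
proof -
  have "cnj z = z" using Z_real[OF assms] by (simp add: complex_eq_iff)
  thus ?thesis using jf_cnj[OF dec, of z n] Z_D(1)[OF assms] by simp
qed

end


section \<open>Residues, up to the boundary of the disc\<close>

lemma residue_simple_zero_quotient:
  assumes S: "open S" "z \<in> S" and f: "f holomorphic_on S" and g: "g holomorphic_on S"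
      and nz: "\<And>w. w \<in> S - {z} \<Longrightarrow> g w \<noteq> 0" and gz: "g z = 0"
      and d: "(g has_field_derivative g') (at z)" and g': "g' \<noteq> 0"
  shows "residue (\<lambda>w. f w / g w) z = f z / g'"
proof (rule residue_simple'[OF S])
  show "(\<lambda>w. f w / g w) holomorphic_on S - {z}"
    using f g nz by (intro holomorphic_intros) (auto intro: holomorphic_on_subset)
  have "isCont f z"
    using holomorphic_on_imp_continuous_on[OF f] S continuous_on_eq_continuous_at by blast
  hence "(f \<longlongrightarrow> f z) (at z)" by (simp add: isCont_def)
  moreover have "((\<lambda>w. (g w - g z) / (w - z)) \<longlongrightarrow> g') (at z)"
    using d by (simp add: has_field_derivative_iff)
  ultimately have "((\<lambda>w. f w / ((g w - g z) / (w - z))) \<longlongrightarrow> f z / g') (at z)"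
    using g' by (intro tendsto_divide)
  thus "((\<lambda>w. f w / g w * (w - z)) \<longlongrightarrow> f z / g') (at z)"
    by (simp add: gz)
qed

text \<open>Circles of radius \<open>r < 1\<close> are pushed to the boundary, where \<open>f\<close> need not be holomorphic.\<close>

lemma residue_theorem_closed_disc:
  assumes fin: "finite S" "S \<subseteq> ball 0 1" and holo: "f holomorphic_on ball 0 1 - S"
      and cont: "continuous_on (cball 0 1 - S) f"
  shows "integral {0..2*pi} (\<lambda>\<theta>. f (cis \<theta>) * cis \<theta>) = 2 * pi * (\<Sum>p\<in>S. residue f p)"
proof -
  define I where "I r = integral {0..2*pi} (\<lambda>\<theta>. f (of_real r * cis \<theta>) * of_real r * \<i> * cis \<theta>)" for r :: real
  define r0 where "r0 = Max (insert 0 (cmod ` S))"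
  have r0: "0 \<le> r0" "r0 < 1" "\<And>p. p \<in> S \<Longrightarrow> cmod p \<le> r0"
    using fin unfolding r0_def by auto
  have Ir: "I r = 2 * pi * \<i> * (\<Sum>p\<in>S. residue f p)" if r: "r0 < r" "r < 1" for r
  proof -
    have rp: "r > 0" using r r0 by linarith
    have "contour_integral (circlepath 0 r) f = 2 * pi * \<i> * (\<Sum>p\<in>S. winding_number (circlepath 0 r) p * residue f p)"
    proof (rule Residue_theorem[of "ball 0 1"])
      show "path_image (circlepath 0 r) \<subseteq> ball 0 1 - S"
        using r rp r0(3) by fastforce
      show "\<forall>z. z \<notin> ball 0 1 \<longrightarrow> winding_number (circlepath 0 r) z = 0"
        using r rp by (intro allI impI winding_number_zero_outside[of _ "cball 0 r"]) auto
    qed (use fin holo in auto)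
    also have "(\<Sum>p\<in>S. winding_number (circlepath 0 r) p * residue f p) = (\<Sum>p\<in>S. residue f p)"
    proof (intro sum.cong refl)
      fix p assume "p \<in> S"
      hence "cmod (p - 0) < r" using r0(3) r by force
      thus "winding_number (circlepath 0 r) p * residue f p = residue f p"
        by (simp add: winding_number_circlepath)
    qed
    also have "contour_integral (circlepath 0 r) f = I r"
      unfolding circlepath_def I_def by (subst contour_integral_part_circlepath_eq) auto
    finally show ?thesis .
  qed
  define r1 where "r1 = (r0 + 1) / 2"
  have r1: "r0 < r1" "r1 < 1" using r0 by (auto simp: r1_def)
  \<comment> \<open>The circle integral is continuous in the radius up to 1, because the circles
    with radii in \<open>{r1..1}\<close> lie in a region free of \<open>S\<close>.\<close>
  have "continuous_on {r1..1} (\<lambda>r. integral (cbox 0 (2*pi)) (\<lambda>\<theta>. f (of_real r * cis \<theta>) * of_real r * \<i> * cis \<theta>))"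
  proof (rule integral_continuous_on_param)
    have "continuous_on ({r1..1} \<times> cbox 0 (2*pi)) (\<lambda>x. f (of_real (fst x) * cis (snd x)))"
    proof (rule continuous_on_compose2[OF cont])
      show "continuous_on ({r1..1} \<times> cbox 0 (2*pi)) (\<lambda>x. complex_of_real (fst x) * cis (snd x))"
        by (intro continuous_intros)
      have "of_real r * cis \<theta> \<in> cball 0 1 - S" if "r1 \<le> r" "r \<le> 1" for r \<theta> :: real
      proof -
        have "cmod (of_real r * cis \<theta>) = r" using that r0 r1 by (simp add: norm_mult)
        thus ?thesis using that r0(3)[of "of_real r * cis \<theta>"] r1 by auto
      qed
      thus "(\<lambda>x. complex_of_real (fst x) * cis (snd x)) ` ({r1..1} \<times> cbox 0 (2*pi)) \<subseteq> cball 0 1 - S" by auto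
    qed
    thus "continuous_on ({r1..1} \<times> cbox 0 (2*pi)) (\<lambda>(r, \<theta>). f (of_real r * cis \<theta>) * of_real r * \<i> * cis \<theta>)"
      unfolding case_prod_beta by (intro continuous_intros)
  qed
  hence "continuous_on {r1..1} I" unfolding I_def by simp
  hence "(I \<longlongrightarrow> I 1) (at 1 within {r1..1})" using r1 by (simp add: continuous_on_def)
  hence "(I \<longlongrightarrow> I 1) (at_left 1)"
    using r1 at_within_Icc_at_left[of r1 1] by simp
  moreover have "eventually (\<lambda>r. I r = 2 * pi * \<i> * (\<Sum>p\<in>S. residue f p)) (at_left 1)"
    using eventually_at_left_real[OF r1(2)] by eventually_elim (use Ir r1 in auto)
  hence "(I \<longlongrightarrow> 2 * pi * \<i> * (\<Sum>p\<in>S. residue f p)) (at_left 1)" by (rule tendsto_eventually)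
  ultimately have I1: "I 1 = 2 * pi * \<i> * (\<Sum>p\<in>S. residue f p)"
    using tendsto_unique[of "at_left (1::real)"] by auto
  have "I 1 = integral {0..2*pi} (\<lambda>\<theta>. \<i> * (f (cis \<theta>) * cis \<theta>))"
    unfolding I_def by (simp add: mult_ac)
  also have "\<dots> = \<i> * integral {0..2*pi} (\<lambda>\<theta>. f (cis \<theta>) * cis \<theta>)" by simp
  finally have "\<i> * integral {0..2*pi} (\<lambda>\<theta>. f (cis \<theta>) * cis \<theta>) = \<i> * (2 * pi * (\<Sum>p\<in>S. residue f p))"
    using I1 by (simp add: mult_ac)
  thus ?thesis unfolding mult_cancel_left by simp
qed

context nonresonant
begin

subsection \<open>The spectral kernel\<close>

definition jP :: "complex \<Rightarrow> int \<Rightarrow> int \<Rightarrow> complex" where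
  "jP z n m = jh (reflected q) (- min n m) z * jh q (max n m) z"

text \<open>The power absorbs the factors \<open>z powi (\<plusminus> n)\<close> of the Jost solutions, so that \<open>jF z n m\<close> is
  \<open>f\<^sub>- (min n m) * f\<^sub>+ (max n m) / W\<close> without negative powers of \<open>z\<close>.\<close>

definition jF :: "complex \<Rightarrow> int \<Rightarrow> int \<Rightarrow> complex" where
  "jF z n m = z ^ Suc (nat \<bar>n - m\<bar>) * jP z n m / jV q z"

lemma jP_jG:
  assumes "z \<noteq> 0"
  shows "z ^ Suc (nat \<bar>n - m\<bar>) * jP z n m = z * jG z n m"
proof -
  have "z ^ nat \<bar>n - m\<bar> = z powi (max n m - min n m)"
    by (auto simp: power_int_def max_def min_def nat_diff_distrib abs_if)
  also have "\<dots> = z powi (- min n m) * z powi (max n m)"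
    using assms by (simp flip: power_int_add)
  finally show ?thesis by (simp add: jP_def jG_def jg_def jf_def mult_ac)
qed

lemma jF_eq:
  assumes z: "cmod z = 1"
  shows "Hop q (\<lambda>n. jF z n m) n = om z * jF z n m - (if n = m then 1 else 0)"
proof -
  have z0: "z \<noteq> 0" using z by auto
  have V: "jV q z \<noteq> 0" by (rule jV_nonzero_circle[OF z])
  have F: "jF z n m = z / jV q z * jG z n m" for n unfolding jF_def jP_jG[OF z0] by simp
  have "Hop q (\<lambda>n. jF z n m) n = z / jV q z * Hop q (\<lambda>n. jG z n m) n"
    unfolding F Hop_def by (simp add: algebra_simps)
  also have "Hop q (\<lambda>n. jG z n m) n = om z * jG z n m - (if n = m then jV q z / z else 0)"
    using z z0 by (intro jG_eq) auto
  also have "z / jV q z * \<dots> = om z * (z / jV q z * jG z n m) - (if n = m then 1 else 0)"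
    using z0 V by (simp add: right_diff_distrib)
  finally show ?thesis unfolding F .
qed

lemma jP_continuous_on: "continuous_on (cball 0 1) (\<lambda>z. jP z n m)"
  unfolding jP_def by (intro continuous_intros jh_continuous_on decaying_reflected dec)

lemma jP_holomorphic_on: "(\<lambda>z. jP z n m) holomorphic_on ball 0 1"
  unfolding jP_def by (intro holomorphic_intros jh_holomorphic_on decaying_reflected dec)

lemma jF_continuous: "continuous_on S (\<lambda>\<theta>. jF (cis \<theta>) n m)"
proof -
  have "continuous_on (sphere 0 1) (\<lambda>z. jF z n m)"
    unfolding jF_def using jV_nonzero_circle
    by (intro continuous_intros continuous_on_subset[OF jP_continuous_on] continuous_on_subset[OF jV_continuous_on[OF dec]]) auto
  thus ?thesis by (rule continuous_on_compose2) (auto intro!: continuous_intros)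
qed

text \<open>Stone's formula for the kernel of \<open>g (H)\<close> on the continuous spectrum,
  pulled back to the circle by \<open>\<omega> = 2 - 2 * cos \<theta>\<close>:
  \<open>2 * \<i> * sin \<theta> d\<theta>\<close> is \<open>\<i> d\<omega>\<close>, and one full
  turn covers both boundary values of the resolvent.\<close>

definition jK :: "(real \<Rightarrow> complex) \<Rightarrow> int \<Rightarrow> int \<Rightarrow> complex" where
  "jK g n m = integral {0..2*pi} (\<lambda>\<theta>. g (2 - 2 * cos \<theta>) * (2 * \<i> * of_real (sin \<theta>)) * jF (cis \<theta>) n m) / (2 * pi)"

text \<open>The weight of the eigenfunction at the zero \<open>z\<close>, in the form in which the
  residue produces it; the chosen \<open>c\<close> is the ratio of the two Jost solutions. In effect
  it is minus the inverse squared norm of \<open>jf q z\<close>.\<close>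

definition jkap :: "complex \<Rightarrow> complex" where
  "jkap z = (z\<^sup>2 - 1) / (z * deriv (jV q) z) * (SOME c. jg q z = (\<lambda>n. c * jf q z n))"

text \<open>With \<open>z = cis \<theta>\<close> the factor \<open>2 * \<i> * sin \<theta>\<close>
  is \<open>z - 1 / z\<close>, and the integrand extends to the disc with at most simple poles at 0
  and \<open>Z\<close>. At 0, where \<open>jP\<close> is 1, \<open>jV\<close> is -1 and
  \<open>z ^ k\<close> vanishes unless \<open>n = m\<close>, the residue is the identity; the others
  yield the eigenfunctions.\<close>

lemma completeness:
  "jK (\<lambda>_. 1) n m = (if n = m then 1 else 0) + (\<Sum>z\<in>Z. jkap z * jf q z n * jf q z m)"
proof -
  define k where "k = nat \<bar>n - m\<bar>"
  define f where "f z = (z\<^sup>2 - 1) * z ^ k * jP z n m" for z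
  define g where "g z = z * jV q z" for z
  define S where "S = insert 0 Z"
  have S: "finite S" "S \<subseteq> ball 0 1" using finite_Z by (auto simp: S_def Z_def)
  have f: "f holomorphic_on ball 0 1" unfolding f_def by (intro holomorphic_intros jP_holomorphic_on)
  have g: "g holomorphic_on ball 0 1" unfolding g_def by (intro holomorphic_intros jV_holomorphic_on dec)
  have gz: "z \<in> S" if "cmod z \<le> 1" "g z = 0" for z
    using that jV_nonzero_circle[of z] by (cases "cmod z = 1") (auto simp: g_def S_def Z_def)
  have gS: "g z = 0" if "z \<in> S" for z using that by (auto simp: g_def S_def Z_def)
  have fc: "continuous_on (cball 0 1) f" unfolding f_def by (intro continuous_intros jP_continuous_on)
  have gc: "continuous_on (cball 0 1) g" unfolding g_def by (intro continuous_intros jV_continuous_on dec)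
  have "integral {0..2*pi} (\<lambda>\<theta>. f (cis \<theta>) / g (cis \<theta>) * cis \<theta>) = 2 * pi * (\<Sum>p\<in>S. residue (\<lambda>z. f z / g z) p)"
  proof (rule residue_theorem_closed_disc[OF S])
    show "(\<lambda>z. f z / g z) holomorphic_on ball 0 1 - S"
      by (rule holomorphic_on_divide[OF holomorphic_on_subset[OF f] holomorphic_on_subset[OF g]]) (use gz in auto)
    show "continuous_on (cball 0 1 - S) (\<lambda>z. f z / g z)"
      by (rule continuous_on_divide[OF continuous_on_subset[OF fc] continuous_on_subset[OF gc]]) (use gz in auto)
  qed
  moreover have "f (cis \<theta>) / g (cis \<theta>) * cis \<theta> = 1 * (2 * \<i> * of_real (sin \<theta>)) * jF (cis \<theta>) n m" for \<theta>
  proof -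
    have V: "jV q (cis \<theta>) \<noteq> 0" by (rule jV_nonzero_circle) simp
    have "(cis \<theta>)\<^sup>2 - 1 = 2 * \<i> * of_real (sin \<theta>) * cis \<theta>"
    proof -
      have "cis \<theta> * cis (- \<theta>) = 1" by (simp add: cis_mult)
      hence "(cis \<theta>)\<^sup>2 - 1 = (cis \<theta> - cis (- \<theta>)) * cis \<theta>" by (simp add: power2_eq_square algebra_simps)
      also have "cis \<theta> - cis (- \<theta>) = 2 * \<i> * of_real (sin \<theta>)" by (simp add: complex_eq_iff)
      finally show ?thesis .
    qed
    thus ?thesis using V by (simp add: f_def g_def jF_def k_def)
  qed
  ultimately have K: "jK (\<lambda>_. 1) n m = (\<Sum>p\<in>S. residue (\<lambda>z. f z / g z) p)"
    unfolding jK_def by simp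
  have res: "residue (\<lambda>z. f z / g z) p = f p / (jV q p + p * deriv (jV q) p)" if p: "p \<in> S" 
    and nz: "jV q p + p * deriv (jV q) p \<noteq> 0" for p
  proof (rule residue_simple_zero_quotient[of "ball 0 1 - (S - {p})"])
    show "open (ball 0 1 - (S - {p}))" using S by (intro open_Diff finite_imp_closed) auto
    show "p \<in> ball 0 1 - (S - {p})" using p S by auto
    show "f holomorphic_on ball 0 1 - (S - {p})" "g holomorphic_on ball 0 1 - (S - {p})"
      using f g by (auto intro: holomorphic_on_subset)
    show "(g has_field_derivative jV q p + p * deriv (jV q) p) (at p)"
      unfolding g_def using jV_deriv[of p] p S by (auto intro!: derivative_eq_intros)
    show "g p = 0" by (rule gS[OF p])
    show "g w \<noteq> 0" if "w \<in> ball 0 1 - (S - {p}) - {p}" for w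
      using gz[of w] that by auto
  qed (rule nz)
  have "residue (\<lambda>z. f z / g z) 0 = (if n = m then 1 else 0)"
  proof -
    have "residue (\<lambda>z. f z / g z) 0 = f 0 / (jV q 0 + 0 * deriv (jV q) 0)"
      by (rule res) (auto simp: S_def jV_0)
    also have "\<dots> = (if n = m then 1 else 0)"
      by (auto simp: f_def jV_0 k_def jP_def jh_0)
    finally show ?thesis .
  qed
  moreover have "residue (\<lambda>z. f z / g z) z = jkap z * jf q z n * jf q z m" if z: "z \<in> Z" for z
  proof -
    note zD = Z_D[OF z]
    define c where "c = (SOME c. jg q z = (\<lambda>n. c * jf q z n))"
    have "\<exists>c. jg q z = (\<lambda>n. c * jf q z n)" using Z_dependent[OF z] by auto
    from someI_ex[OF this] have c: "jg q z = (\<lambda>n. c * jf q z n)" unfolding c_def .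
    have "z * (z ^ k * jP z n m) = z * jG z n m" using jP_jG[OF zD(2), of n m] by (simp add: k_def mult_ac)
    hence "z ^ k * jP z n m = jG z n m" using zD(2) by simp
    moreover have "jG z n m = c * (jf q z n * jf q z m)"
      unfolding jG_def c by (auto simp: min_def max_def)
    ultimately have fz: "f z = (z\<^sup>2 - 1) * (c * (jf q z n * jf q z m))" by (simp add: f_def mult.assoc)
    have "residue (\<lambda>z. f z / g z) z = f z / (jV q z + z * deriv (jV q) z)"
      by (rule res) (use z zD Z_simple[OF z] in \<open>auto simp: S_def\<close>)
    thus ?thesis unfolding fz using zD(3) by (simp add: jkap_def c_def[symmetric])
  qed
  moreover have "0 \<notin> Z" using Z_D by blast
  ultimately show ?thesis unfolding K S_def using finite_Z by (simp add: sum.insert)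
qed

lemma jK_integrable: 
  assumes "continuous_on {0..4} g"
  shows "(\<lambda>\<theta>. g (2 - 2 * cos \<theta>) * (2 * \<i> * of_real (sin \<theta>)) * jF (cis \<theta>) n m) integrable_on {0..2*pi}"
proof -
  have "continuous_on {0..2*pi} (\<lambda>\<theta>. g (2 - 2 * cos \<theta>))"
  proof (rule continuous_on_compose2[OF assms])
    have "2 - 2 * cos x \<in> {0..4}" for x :: real
      using cos_le_one[of x] cos_ge_minus_one[of x] by (simp del: cos_le_one cos_ge_minus_one)
    thus "(\<lambda>x. 2 - 2 * cos x) ` {0..2*pi} \<subseteq> {0..4}" by blast
  qed (intro continuous_intros)
  thus ?thesis by (intro integrable_continuous_real continuous_intros jF_continuous)
qed

lemma om_cis: "om (cis \<theta>) = of_real (2 - 2 * cos \<theta>)"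
  by (simp add: om_def complex_eq_iff cis_inverse)

text \<open>The inhomogeneity of the Green kernel drops out because its contribution is odd under
  \<open>\<theta> \<mapsto> 2 * pi - \<theta>\<close>.\<close>

lemma jK_Hop:
  assumes g: "continuous_on {0..4} g" and G: "\<And>x. x \<in> {0..4} \<Longrightarrow> (G has_vector_derivative g x) (at x within {0..4})"
  shows "Hop q (\<lambda>n. jK g n m) n = jK (\<lambda>x. of_real x * g x) n m"
proof -
  define w where "w \<theta> = g (2 - 2 * cos \<theta>) * (2 * \<i> * of_real (sin \<theta>))" for \<theta>
  have I: "((\<lambda>\<theta>. w \<theta> * jF (cis \<theta>) n m) has_integral 2 * pi * jK g n m) {0..2*pi}" for n
    using integrable_integral[OF jK_integrable[OF g, of n m]] unfolding w_def jK_def by simp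
  have odd: "(w has_integral 0) {0..2*pi}"
  proof -
    have d: "((\<lambda>\<theta>. \<i> * G (2 - 2 * cos \<theta>)) has_vector_derivative w \<theta>) (at \<theta> within {0..2*pi})" for \<theta>
    proof -
      have r: "2 - 2 * cos x \<in> {0..4}" for x :: real
        using cos_le_one[of x] cos_ge_minus_one[of x] by (simp del: cos_le_one cos_ge_minus_one)
      have "((\<lambda>\<theta>. 2 - 2 * cos \<theta>) has_vector_derivative 2 * sin \<theta>) (at \<theta> within {0..2*pi})"
        unfolding has_real_derivative_iff_has_vector_derivative[symmetric] by (auto intro!: derivative_eq_intros)
      moreover have "(G has_vector_derivative g (2 - 2 * cos \<theta>)) (at (2 - 2 * cos \<theta>) within (\<lambda>\<theta>. 2 - 2 * cos \<theta>) ` {0..2*pi})"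
        by (rule has_vector_derivative_within_subset[OF G[OF r]]) (use r in blast)
      ultimately have "(G \<circ> (\<lambda>\<theta>. 2 - 2 * cos \<theta>) has_vector_derivative (2 * sin \<theta>) *\<^sub>R g (2 - 2 * cos \<theta>)) (at \<theta> within {0..2*pi})"
        by (rule vector_diff_chain_within)
      hence "((\<lambda>\<theta>. \<i> * G (2 - 2 * cos \<theta>)) has_vector_derivative \<i> * ((2 * sin \<theta>) *\<^sub>R g (2 - 2 * cos \<theta>))) (at \<theta> within {0..2*pi})"
        unfolding o_def by (rule has_vector_derivative_mult_right)
      thus ?thesis by (simp add: w_def scaleR_conv_of_real mult_ac)
    qed
    have "(w has_integral (\<i> * G (2 - 2 * cos (2 * pi)) - \<i> * G (2 - 2 * cos 0))) {0..2*pi}"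
      by (rule fundamental_theorem_of_calculus[OF _ d]) auto
    thus ?thesis by simp
  qed
  have "((\<lambda>\<theta>. Hop q (\<lambda>n. w \<theta> * jF (cis \<theta>) n m) n) has_integral Hop q (\<lambda>n. 2 * pi * jK g n m) n) {0..2*pi}"
    unfolding Hop_def by (intro has_integral_add has_integral_neg has_integral_diff has_integral_mult_right I)
  moreover have "Hop q (\<lambda>n. w \<theta> * jF (cis \<theta>) n m) n = of_real (2 - 2 * cos \<theta>) * (w \<theta> * jF (cis \<theta>) n m) - (if n = m then w \<theta> else 0)" for \<theta>
  proof -
    have "Hop q (\<lambda>n. w \<theta> * jF (cis \<theta>) n m) n = w \<theta> * Hop q (\<lambda>n. jF (cis \<theta>) n m) n"
      by (simp add: Hop_def algebra_simps)
    thus ?thesis using jF_eq[of "cis \<theta>" m n] unfolding om_cis by (auto simp: algebra_simps)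
  qed
  ultimately have "((\<lambda>\<theta>. of_real (2 - 2 * cos \<theta>) * (w \<theta> * jF (cis \<theta>) n m) - (if n = m then w \<theta> else 0)) has_integral Hop q (\<lambda>n. 2 * pi * jK g n m) n) {0..2*pi}"
    by simp
  moreover have "((\<lambda>\<theta>. if n = m then w \<theta> else 0) has_integral 0) {0..2*pi}" using odd by (cases "n = m") auto
  ultimately have "((\<lambda>\<theta>. (of_real (2 - 2 * cos \<theta>) * (w \<theta> * jF (cis \<theta>) n m) - (if n = m then w \<theta> else 0)) + (if n = m then w \<theta> else 0)) 
      has_integral Hop q (\<lambda>n. 2 * pi * jK g n m) n + 0) {0..2*pi}"
    by (rule has_integral_add)
  hence "integral {0..2*pi} (\<lambda>\<theta>. of_real (2 - 2 * cos \<theta>) * (w \<theta> * jF (cis \<theta>) n m)) = Hop q (\<lambda>n. 2 * pi * jK g n m) n"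
    by (simp add: integral_unique)
  moreover have "Hop q (\<lambda>n. 2 * pi * jK g n m) n = 2 * pi * Hop q (\<lambda>n. jK g n m) n"
    by (simp add: Hop_def algebra_simps)
  ultimately have "2 * pi * Hop q (\<lambda>n. jK g n m) n = integral {0..2*pi} (\<lambda>\<theta>. of_real (2 - 2 * cos \<theta>) * (w \<theta> * jF (cis \<theta>) n m))"
    by simp
  also have "\<dots> = 2 * pi * jK (\<lambda>x. of_real x * g x) n m"
    unfolding jK_def w_def by (simp add: mult.assoc)
  finally show ?thesis by simp
qed

lemma jK_Hop_pow: "(Hop q ^^ k) (\<lambda>n. jK (\<lambda>_. 1) n m) = (\<lambda>n. jK (\<lambda>x. of_real x ^ k) n m)"
proof (induction k)
  case (Suc k)
  have "Hop q (\<lambda>n. jK (\<lambda>x. of_real x ^ k) n m) n = jK (\<lambda>x. of_real x * of_real x ^ k) n m" for n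
  proof (rule jK_Hop[where G="\<lambda>x. of_real x ^ Suc k / of_nat (Suc k)"])
    show "continuous_on {0..4} (\<lambda>x. complex_of_real x ^ k)" by (intro continuous_intros)
    fix x :: real
    have "((\<lambda>w. w ^ Suc k / of_nat (Suc k)) has_field_derivative (of_nat (Suc k) * of_real x ^ k) / of_nat (Suc k)) (at (complex_of_real x))"
      by (auto intro!: derivative_eq_intros simp del: of_nat_Suc power_Suc)
    hence "((\<lambda>w. w ^ Suc k / of_nat (Suc k)) has_field_derivative of_real x ^ k) (at (complex_of_real x))"
      by (simp del: of_nat_Suc power_Suc)
    from has_vector_derivative_real_field[OF this] 
    show "((\<lambda>x. complex_of_real x ^ Suc k / of_nat (Suc k)) has_vector_derivative complex_of_real x ^ k) (at x within {0..4})" .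
  qed
  thus ?case using Suc by simp
qed simp

text \<open>The series defining \<open>evol\<close> becomes the exponential under the integral;
  uniform convergence over the period justifies the exchange.\<close>

lemma evol_jK: "evol q t (\<lambda>n. jK (\<lambda>_. 1) n m) n = jK (phase t) n m"
proof -
  define w where "w \<theta> = (2 * \<i> * of_real (sin \<theta>)) * jF (cis \<theta>) n m" for \<theta>
  define a where "a k = (- \<i> * complex_of_real t) ^ k / of_nat (fact k)" for k
  have wc: "continuous_on {0..2*pi} w" unfolding w_def by (intro continuous_intros jF_continuous)
  obtain B where "\<forall>\<theta>\<in>{0..2*pi}. cmod (w \<theta>) \<le> B"
    using compact_imp_bounded[OF compact_continuous_image[OF wc compact_Icc]] unfolding bounded_iff by auto
  hence B: "cmod (w \<theta>) \<le> B" if "\<theta> \<in> {0..2*pi}" for \<theta> using that by blast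
  have B0: "B \<ge> 0" using order_trans[OF norm_ge_zero B[of 0]] by simp
  have na: "norm (a k) = \<bar>t\<bar> ^ k / fact k" for k
    by (simp add: a_def norm_divide norm_power norm_mult)
  have ul: "uniform_limit {0..2*pi} (\<lambda>N \<theta>. \<Sum>k<N. a k * of_real (2 - 2 * cos \<theta>) ^ k * w \<theta>)
       (\<lambda>\<theta>. \<Sum>k. a k * of_real (2 - 2 * cos \<theta>) ^ k * w \<theta>) sequentially"
  proof (rule Weierstrass_m_test)
    show "summable (\<lambda>k. (\<bar>t\<bar> * 4) ^ k /\<^sub>R fact k * B)" by (intro summable_mult2 summable_exp_generic)
    fix k \<theta> assume th: "\<theta> \<in> {0..2*pi}"
    have "norm (complex_of_real (2 - 2 * cos \<theta>)) \<le> 4"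
      unfolding norm_of_real using cos_le_one[of \<theta>] cos_ge_minus_one[of \<theta>] by (simp add: abs_le_iff del: cos_le_one cos_ge_minus_one)
    hence "norm (a k * of_real (2 - 2 * cos \<theta>) ^ k * w \<theta>) \<le> (\<bar>t\<bar> ^ k / fact k) * 4 ^ k * B"
      unfolding norm_mult norm_power na using B[OF th] by (intro mult_mono power_mono) auto
    thus "norm (a k * of_real (2 - 2 * cos \<theta>) ^ k * w \<theta>) \<le> (\<bar>t\<bar> * 4) ^ k /\<^sub>R fact k * B"
      by (simp add: power_mult_distrib divide_inverse mult_ac)
  qed
  have lim: "(\<Sum>k. a k * of_real (2 - 2 * cos \<theta>) ^ k * w \<theta>) = exp (- \<i> * of_real t * of_real (2 - 2 * cos \<theta>)) * w \<theta>" for \<theta>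
  proof -
    have "a k * of_real (2 - 2 * cos \<theta>) ^ k * w \<theta> = (- \<i> * of_real t * of_real (2 - 2 * cos \<theta>)) ^ k /\<^sub>R fact k * w \<theta>" for k
      unfolding power_mult_distrib[of "- \<i> * of_real t"] by (simp add: a_def scaleR_conv_of_real field_simps)
    thus ?thesis
      using sums_mult2[OF exp_converges[of "- \<i> * of_real t * of_real (2 - 2 * cos \<theta>)"], of "w \<theta>"] by (simp add: sums_iff)
  qed
  have c: "continuous_on {0..2*pi} (\<lambda>\<theta>. \<Sum>k<N. a k * of_real (2 - 2 * cos \<theta>) ^ k * w \<theta>)" for N
    by (intro continuous_intros wc)
  obtain I J where IJ: "\<And>N. ((\<lambda>\<theta>. \<Sum>k<N. a k * of_real (2 - 2 * cos \<theta>) ^ k * w \<theta>) has_integral I N) {0..2*pi}"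
     "((\<lambda>\<theta>. \<Sum>k. a k * of_real (2 - 2 * cos \<theta>) ^ k * w \<theta>) has_integral J) {0..2*pi}" "I \<longlonglongrightarrow> J"
    using uniform_limit_integral[OF ul c] by auto
  have J: "J = 2 * pi * jK (phase t) n m"
    using integral_unique[OF IJ(2)] unfolding lim by (simp add: jK_def w_def mult.assoc)
  have I: "I N = 2 * pi * (\<Sum>k<N. a k * jK (\<lambda>x. of_real x ^ k) n m)" for N
  proof -
    have "((\<lambda>\<theta>. of_real (2 - 2 * cos \<theta>) ^ k * w \<theta>) has_integral 2 * pi * jK (\<lambda>x. of_real x ^ k) n m) {0..2*pi}" for k
    proof -
      have "continuous_on {0..2*pi} (\<lambda>\<theta>. of_real (2 - 2 * cos \<theta>) ^ k * w \<theta>)" by (intro continuous_intros wc)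
      from integrable_integral[OF integrable_continuous_real[OF this]] show ?thesis
        by (simp add: jK_def w_def mult.assoc)
    qed
    hence "((\<lambda>\<theta>. \<Sum>k<N. a k * (of_real (2 - 2 * cos \<theta>) ^ k * w \<theta>)) has_integral (\<Sum>k<N. a k * (2 * pi * jK (\<lambda>x. of_real x ^ k) n m))) {0..2*pi}"
      by (intro has_integral_sum has_integral_mult_right) auto
    moreover have "(\<Sum>k<N. a k * (2 * pi * jK (\<lambda>x. of_real x ^ k) n m)) = 2 * pi * (\<Sum>k<N. a k * jK (\<lambda>x. of_real x ^ k) n m)"
      unfolding sum_distrib_left by (intro sum.cong) auto
    ultimately have "((\<lambda>\<theta>. \<Sum>k<N. a k * of_real (2 - 2 * cos \<theta>) ^ k * w \<theta>) has_integral 2 * pi * (\<Sum>k<N. a k * jK (\<lambda>x. of_real x ^ k) n m)) {0..2*pi}"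
      by (simp only: mult.assoc)
    from has_integral_unique[OF IJ(1) this] show ?thesis .
  qed
  have "(\<lambda>N. I N / (2 * pi)) \<longlonglongrightarrow> J / (2 * pi)" by (intro tendsto_intros IJ) auto
  hence "(\<lambda>k. a k * jK (\<lambda>x. of_real x ^ k) n m) sums jK (phase t) n m"
    unfolding sums_def I J by simp
  thus ?thesis unfolding evol_def jK_Hop_pow a_def by (simp add: sums_iff)
qed

end


section \<open>Coefficient bounds for the amplitude of the kernel\<close>

lemma conv_commute: "conv a b = conv b a"
proof
  fix k
  show "conv a b k = conv b a k"
    unfolding conv_def
    by (rule sum.reindex_bij_witness[where i="\<lambda>j. k - j" and j="\<lambda>j. k - j"]) (auto simp: mult.commute)
qed

lemma cls_weight_1:
  assumes a: "cls M v a" and v: "v \<ge> 1"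
  shows "cls (M * v\<^sup>2) 1 a"
proof -
  have "0 \<le> M * v" using clsD(1)[OF a, of 0] by (auto intro: order_trans[OF norm_ge_zero])
  hence "M \<ge> 0" using v by (simp add: zero_le_mult_iff)
  moreover have "v \<le> v\<^sup>2" using v by (intro self_le_power) auto
  ultimately have "M * v \<le> M * v\<^sup>2" by (intro mult_left_mono)
  thus ?thesis using clsD[OF a] unfolding cls_def by (auto intro: order_trans)
qed

lemma cis_has_vector_derivative: "(cis has_vector_derivative (\<i> * cis \<theta>)) (at \<theta> within S)"
proof -
  have "((\<lambda>w. exp (\<i> * w)) has_field_derivative \<i> * cis \<theta>) (at (of_real \<theta>))"
    by (auto intro!: derivative_eq_intros simp: cis_conv_exp)
  from has_vector_derivative_real_field[OF this, of S] show ?thesis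
    by (simp add: cis_conv_exp[abs_def])
qed

text \<open>A derivative relative to the closed disc suffices, the circle being contained in
  it.\<close>

lemma circle_chain_rule:
  assumes "(f has_field_derivative f') (at (cis \<theta>) within cball 0 1)"
  shows "((\<lambda>\<theta>. f (cis \<theta>)) has_vector_derivative (\<i> * cis \<theta> * f')) (at \<theta> within S)"
proof -
  have "(f has_field_derivative f') (at (cis \<theta>) within cis ` S)"
    by (rule has_field_derivative_subset[OF assms]) auto
  from field_vector_diff_chain_within[OF cis_has_vector_derivative this] show ?thesis
    by (simp add: o_def)
qed

context nonresonant
begin

definition jPc :: "int \<Rightarrow> int \<Rightarrow> nat \<Rightarrow> complex" where
  "jPc n m = conv (JBc (reflected q) (- min n m)) (JBc q (max n m))"

lemma jP_ps: "cmod z \<le> 1 \<Longrightarrow> jP z n m = ps (jPc n m) z"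
  unfolding jP_def jPc_def jh_def by (intro ps_mult JB_abs_summable decaying_reflected dec)

definition jv :: "int \<Rightarrow> int \<Rightarrow> real" where "jv n m = jw (- min n m) * jw (max n m)"

text \<open>The left Jost factor grows only if \<open>min n m > 0\<close>, the right one only if
  \<open>max n m < 0\<close>, so at most one of them is active. The growth never exceeds the
  distance to 0 of the site nearer to it, which leaves one power of the weight per site.\<close>

lemma jv_bounds:
  shows "jv n m \<ge> 1"
    and "real (Suc (nat \<bar>n - m\<bar>)) * jv n m \<le> (wt n) * (wt m)"
    and "(jv n m)\<^sup>2 \<le> (wt n) * (wt m)"
proof -
  define a b where "a = min n m" and "b = max n m"
  have ab: "a \<le> b" by (simp add: a_def b_def)
  have X: "(wt n) * (wt m) = (wt a) * (wt b)"
    by (auto simp: a_def b_def min_def max_def)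
  have k: "real (Suc (nat \<bar>n - m\<bar>)) = 1 + (real_of_int b - real_of_int a)"
    by (auto simp: a_def b_def min_def max_def)
  have v: "jv n m = jw (- a) * jw b" by (simp add: jv_def a_def b_def)
  show "jv n m \<ge> 1" unfolding v using mult_mono[OF jw_ge_1 jw_ge_1, of "- a" b] jw_ge_1[of "- a"] by simp
  consider "a > 0" | "b < 0" | "a \<le> 0" "b \<ge> 0" by linarith
  hence "(1 + (real_of_int b - real_of_int a)) * (jw (- a) * jw b) \<le> (wt a) * (wt b)
     \<and> (jw (- a) * jw b)\<^sup>2 \<le> (wt a) * (wt b)"
  proof cases
    case 1
    hence w: "jw (- a) * jw b = 1 + real_of_int a" using ab by (simp add: jw_def)
    have "(1 + (real_of_int b - real_of_int a)) * (1 + real_of_int a) \<le> (1 + real_of_int b) * (1 + real_of_int a)"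
      using 1 by (intro mult_right_mono) auto
    moreover have "(1 + real_of_int a)\<^sup>2 \<le> (1 + real_of_int a) * (1 + real_of_int b)"
      unfolding power2_eq_square using 1 ab by (intro mult_left_mono) auto
    ultimately show ?thesis unfolding w using 1 ab by (simp add: mult.commute)
  next
    case 2
    hence w: "jw (- a) * jw b = 1 - real_of_int b" using ab by (simp add: jw_def)
    have "(1 + (real_of_int b - real_of_int a)) * (1 - real_of_int b) \<le> (1 - real_of_int a) * (1 - real_of_int b)"
      using 2 by (intro mult_right_mono) auto
    moreover have "(1 - real_of_int b)\<^sup>2 \<le> (1 - real_of_int a) * (1 - real_of_int b)"
      unfolding power2_eq_square using 2 ab by (intro mult_right_mono) auto
    ultimately show ?thesis unfolding w using 2 ab by simp
  next
    case 3
    hence w: "jw (- a) * jw b = 1" by (simp add: jw_def)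
    have "0 \<le> (- real_of_int a) * real_of_int b" using 3 by (intro mult_nonneg_nonneg) auto
    thus ?thesis unfolding w using 3 by (simp add: algebra_simps)
  qed
  thus "real (Suc (nat \<bar>n - m\<bar>)) * jv n m \<le> (wt n) * (wt m)"
    "(jv n m)\<^sup>2 \<le> (wt n) * (wt m)"
    unfolding X k v by blast+
qed

text \<open>Whichever Jost factor has growth 1 becomes the second argument of
  \<open>cls_conv\<close>; hence the case distinction on the sign of \<open>min n m\<close>.\<close>

lemma jPc_cls: "\<exists>C\<ge>1. \<forall>n m. cls C (jv n m) (jPc n m)"
proof -
  obtain C1 where C1: "C1 \<ge> 0" "\<forall>n. cls C1 (jw n) (JBc q n)"
    using JB_cls[OF dec] by auto
  obtain C2 where C2: "C2 \<ge> 0" "\<forall>n. cls C2 (jw n) (JBc (reflected q) n)"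
    using JB_cls[OF decaying_reflected[OF dec]] by auto
  define C where "C = max 1 (4 * C1 * C2)"
  have "cls C (jv n m) (jPc n m)" for n m
  proof (rule cls_mono[of "4 * C1 * C2"])
    show "cls (4 * C1 * C2) (jv n m) (jPc n m)"
    proof (cases "min n m > 0")
      case True
      hence w: "jw (max n m) = 1" by (auto simp: jw_def)
      have b: "cls C1 1 (JBc q (max n m))"
        using C1(2)[rule_format, of "max n m"] unfolding w .
      from cls_conv[OF C2(2)[rule_format, of "- min n m"] b jw_ge_1] show ?thesis
        unfolding jPc_def jv_def w by (simp add: mult_ac)
    next
      case False
      hence w: "jw (- min n m) = 1" by (auto simp: jw_def)
      have b: "cls C2 1 (JBc (reflected q) (- min n m))"
        using C2(2)[rule_format, of "- min n m"] unfolding w .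
      from cls_conv[OF C1(2)[rule_format, of "max n m"] b jw_ge_1] show ?thesis
        unfolding jPc_def jv_def w by (subst conv_commute) (simp add: mult_ac)
    qed
  qed (auto simp: C_def jv_bounds)
  thus ?thesis by (intro exI[of _ C]) (auto simp: C_def)
qed

definition jVc :: "nat \<Rightarrow> complex" where
  "jVc k = conv (\<lambda>k. if k = 2 then 1 else 0) 
       (conv (JBc (reflected q) 0) (JBc q 1)) k
     - conv (JBc (reflected q) (-1)) (JBc q 0) k"

lemma jVc: 
  shows "\<exists>M\<ge>1. cls M 1 jVc" and "cmod z \<le> 1 \<Longrightarrow> jV q z = ps jVc z"
proof -
  obtain C1 where C1: "C1 \<ge> 0" "\<forall>n. cls C1 (jw n) (JBc q n)"
    using JB_cls[OF dec] by auto
  obtain C2 where C2: "C2 \<ge> 0" "\<forall>n. cls C2 (jw n) (JBc (reflected q) n)"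
    using JB_cls[OF decaying_reflected[OF dec]] by auto
  have w: "jw 0 = 1" "jw 1 = 1" "jw (-1) = 2" by (auto simp: jw_def)
  note c1 = C1(2)[rule_format, of 0, unfolded w] C1(2)[rule_format, of 1, unfolded w]
  note c2 = C2(2)[rule_format, of 0, unfolded w] cls_weight_1[OF C2(2)[rule_format, of "-1", unfolded w]]
  have a: "cls (4 * C2 * C1) 1 (conv (JBc (reflected q) 0) (JBc q 1))"
    by (rule cls_conv[OF c2(1) c1(2)]) simp
  have b: "cls (4 * 4 * (4 * C2 * C1)) 1 (conv (\<lambda>k. if k = 2 then 1 else 0) (conv (JBc (reflected q) 0) (JBc q 1)))"
    by (rule cls_conv[OF cls_monomial a]) simp
  have c: "cls (4 * (C2 * 2\<^sup>2) * C1) 1 (conv (JBc (reflected q) (-1)) (JBc q 0))"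
    by (rule cls_conv[OF c2(2) c1(1)]) auto
  define M where "M = max 1 (4 * 4 * (4 * C2 * C1) + 4 * (C2 * 2\<^sup>2) * C1)"
  have "cls M 1 jVc"
    unfolding jVc_def[abs_def] by (rule cls_mono[OF cls_diff[OF b c]]) (auto simp: M_def)
  thus "\<exists>M\<ge>1. cls M 1 jVc" by (intro exI[of _ M]) (auto simp: M_def)
  assume z: "cmod z \<le> 1"
  have "ps jVc z = ps (conv (\<lambda>k. if k = 2 then 1 else 0) (conv (JBc (reflected q) 0) (JBc q 1))) z
     - ps (conv (JBc (reflected q) (-1)) (JBc q 0)) z"
    unfolding jVc_def[abs_def] by (rule ps_diff[OF cls_summable(1)[OF b] cls_summable(1)[OF c] z, symmetric])
  also have "ps (conv (\<lambda>k. if k = 2 then 1 else 0) (conv (JBc (reflected q) 0) (JBc q 1))) z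
     = z\<^sup>2 * ps (conv (JBc (reflected q) 0) (JBc q 1)) z"
    unfolding ps_monomial[symmetric] by (rule ps_mult[symmetric, OF cls_summable(1)[OF cls_monomial] cls_summable(1)[OF a] z])
  also have "ps (conv (JBc (reflected q) 0) (JBc q 1)) z = jh (reflected q) 0 z * jh q 1 z"
    unfolding jh_def by (rule ps_mult[symmetric, OF _ _ z]; intro JB_abs_summable decaying_reflected dec)
  also have "ps (conv (JBc (reflected q) (-1)) (JBc q 0)) z = jh (reflected q) (-1) z * jh q 0 z"
    unfolding jh_def by (rule ps_mult[symmetric, OF _ _ z]; intro JB_abs_summable decaying_reflected dec)
  finally show "jV q z = ps jVc z" by (simp add: jV_def)
qed

section \<open>The reciprocal Wronskian along the circle and the derivative of the amplitude\<close>

definition jY :: "real \<Rightarrow> complex" where "jY \<theta> = inverse (jV q (cis \<theta>))"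
text \<open>The angular derivative of \<open>jV q (cis \<theta>)\<close>.\<close>

definition jV1 :: "real \<Rightarrow> complex" where "jV1 \<theta> = \<i> * ps (\<lambda>k. of_nat k * jVc k) (cis \<theta>)"

lemma jV_cis_nonzero: "jV q (cis \<theta>) \<noteq> 0"
  by (rule jV_nonzero_circle) simp

lemma jY_derivative: "(jY has_vector_derivative (- jV1 \<theta> * (jY \<theta>)\<^sup>2)) (at \<theta> within S)"
proof -
  obtain M where M: "cls M 1 jVc" using jVc(1) by auto
  note s = cls_summable(1,3)[OF M]
  have "(jV q has_field_derivative pd jVc (cis \<theta>)) (at (cis \<theta>) within cball 0 1)"
  proof (rule has_field_derivative_transform_within[OF ps_has_derivative[OF s]])
    show "ps jVc x = jV q x" if "x \<in> cball 0 1" for x using jVc(2)[of x] that by simp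
  qed (auto intro!: zero_less_one)
  hence "((\<lambda>z. inverse (jV q z)) has_field_derivative - (inverse (jV q (cis \<theta>)) * pd jVc (cis \<theta>) * inverse (jV q (cis \<theta>)))) (at (cis \<theta>) within cball 0 1)"
    by (rule DERIV_inverse') (rule jV_cis_nonzero)
  from circle_chain_rule[OF this, of S] 
  have "(jY has_vector_derivative (\<i> * cis \<theta> * - (inverse (jV q (cis \<theta>)) * pd jVc (cis \<theta>) * inverse (jV q (cis \<theta>))))) (at \<theta> within S)"
    by (simp add: jY_def[abs_def])
  also have "\<i> * cis \<theta> * - (inverse (jV q (cis \<theta>)) * pd jVc (cis \<theta>) * inverse (jV q (cis \<theta>))) = - (\<i> * (cis \<theta> * pd jVc (cis \<theta>))) * (jY \<theta>)\<^sup>2"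
    by (simp add: jY_def power2_eq_square)
  also have "cis \<theta> * pd jVc (cis \<theta>) = ps (\<lambda>k. of_nat k * jVc k) (cis \<theta>)"
    by (rule z_pd[OF s(2)]) simp
  finally show ?thesis by (simp add: jV1_def)
qed

lemma jY_sq_derivative: "((\<lambda>\<theta>. (jY \<theta>)\<^sup>2) has_vector_derivative (2 * jY \<theta> * (- jV1 \<theta> * (jY \<theta>)\<^sup>2))) (at \<theta> within S)"
  using has_vector_derivative_mult[OF jY_derivative jY_derivative, of \<theta> S] by (simp add: power2_eq_square algebra_simps)

lemma jY_continuous: "continuous_on S jY" "continuous_on S jV1"
proof -
  obtain M where M: "cls M 1 jVc" using jVc(1) by auto
  have "continuous_on (sphere 0 1) (jV q)" by (rule continuous_on_subset[OF jV_continuous_on[OF dec]]) auto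
  hence "continuous_on S (\<lambda>\<theta>. jV q (cis \<theta>))"
    by (rule continuous_on_compose2) (auto intro!: continuous_intros)
  thus "continuous_on S jY" unfolding jY_def[abs_def] using jV_cis_nonzero by (intro continuous_intros) auto
  have "summable (\<lambda>k. cmod (of_nat k * jVc k))" by (rule z_pd_summable[OF cls_summable(3)[OF M]])
  from ps_continuous_on[OF this] have "continuous_on S (\<lambda>\<theta>. ps (\<lambda>k. of_nat k * jVc k) (cis \<theta>))"
    by (rule continuous_on_compose2) (auto intro!: continuous_intros)
  thus "continuous_on S jV1" unfolding jV1_def[abs_def] by (intro continuous_intros)
qed

text \<open>Bounds for the amplitudes \<open>1 / jV\<close> and \<open>1 / jV\<^sup>2\<close> and
  for their angular derivatives, as \<open>oscillatory_series\<close> requires them.\<close>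

lemma jY_bounds: "\<exists>A\<ge>0. \<forall>\<theta>\<in>{0..2*pi}. cmod (jY \<theta>) \<le> A \<and> cmod (- jV1 \<theta> * (jY \<theta>)\<^sup>2) \<le> A \<and>
    cmod ((jY \<theta>)\<^sup>2) \<le> A \<and> cmod (2 * jY \<theta> * (- jV1 \<theta> * (jY \<theta>)\<^sup>2)) \<le> A"
proof -
  have bd: "\<exists>B. \<forall>\<theta>\<in>{0..2*pi}. cmod (f \<theta>) \<le> B" if "continuous_on {0..2*pi} f" for f
    using compact_imp_bounded[OF compact_continuous_image[OF that compact_Icc]] unfolding bounded_iff by auto
  note c = jY_continuous[of "{0..2*pi}"]
  obtain B1 where B1: "\<forall>\<theta>\<in>{0..2*pi}. cmod (jY \<theta>) \<le> B1" using bd[OF c(1)] by auto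
  obtain B2 where B2: "\<forall>\<theta>\<in>{0..2*pi}. cmod (jV1 \<theta>) \<le> B2" using bd[OF c(2)] by auto
  have B0: "0 \<le> B1" "0 \<le> B2" using B1 B2 by (auto intro!: order_trans[OF norm_ge_zero] elim!: ballE[of _ _ 0])
  define A where "A = B1 + B2 * B1\<^sup>2 + B1\<^sup>2 + 2 * B1 * (B2 * B1\<^sup>2)"
  have "cmod (jY \<theta>) \<le> A \<and> cmod (- jV1 \<theta> * (jY \<theta>)\<^sup>2) \<le> A \<and>
    cmod ((jY \<theta>)\<^sup>2) \<le> A \<and> cmod (2 * jY \<theta> * (- jV1 \<theta> * (jY \<theta>)\<^sup>2)) \<le> A" if th: "\<theta> \<in> {0..2*pi}" for \<theta>
  proof -
    have n: "cmod (jY \<theta>) \<le> B1" "cmod (jV1 \<theta>) \<le> B2" using B1 B2 th by auto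
    hence s: "cmod ((jY \<theta>)\<^sup>2) \<le> B1\<^sup>2" unfolding norm_power by (intro power_mono) auto
    have p: "cmod (- jV1 \<theta> * (jY \<theta>)\<^sup>2) \<le> B2 * B1\<^sup>2"
      unfolding norm_mult norm_minus_cancel using n s B0 by (intro mult_mono) auto
    have r: "cmod (2 * jY \<theta> * (- jV1 \<theta> * (jY \<theta>)\<^sup>2)) \<le> 2 * B1 * (B2 * B1\<^sup>2)"
      unfolding norm_mult[of "2 * jY \<theta>"] using n p B0 by (intro mult_mono) (auto simp: norm_mult)
    have "0 \<le> B2 * B1\<^sup>2" "0 \<le> B1\<^sup>2" "0 \<le> 2 * B1 * (B2 * B1\<^sup>2)" using B0 by auto
    thus ?thesis using n s p r B0 unfolding A_def by linarith
  qed
  moreover have "A \<ge> 0" using B0 by (auto simp: A_def intro!: add_nonneg_nonneg)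
  ultimately show ?thesis by (intro exI[of _ A]) blast
qed

lemma jY_periodic: "jY (2 * pi) = jY 0"
  by (simp add: jY_def)

text \<open>The derivative falls on the power series, giving coefficients
  \<open>(k + l) * jPc\<close> with amplitude \<open>1 / jV\<close>, or on \<open>1 / jV\<close>,
  where the derivative of \<open>jV\<close> joins the series by convolution and leaves
  \<open>1 / jV\<^sup>2\<close>. The amplitudes themselves can then be differentiated once
  more.\<close>

lemma jF_derivative:
  "((\<lambda>\<theta>. jF (cis \<theta>) n m) has_vector_derivative
     (\<i> * (cis \<theta> ^ Suc (nat \<bar>n - m\<bar>) * ps (\<lambda>l. of_nat (Suc (nat \<bar>n - m\<bar>) + l) * jPc n m l) (cis \<theta>) * jY \<theta>)
      - \<i> * (cis \<theta> ^ Suc (nat \<bar>n - m\<bar>) * ps (conv (jPc n m) (\<lambda>k. of_nat k * jVc k)) (cis \<theta>) * (jY \<theta>)\<^sup>2))) (at \<theta> within S)"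
proof -
  define k where "k = Suc (nat \<bar>n - m\<bar>)"
  obtain C where C: "cls C (jv n m) (jPc n m)" using jPc_cls by auto
  obtain M where M: "cls M 1 jVc" using jVc(1) by auto
  note s = cls_summable(1,3)[OF C] 
  have s': "summable (\<lambda>k. cmod (of_nat k * jVc k))" by (rule z_pd_summable[OF cls_summable(3)[OF M]])
  have "((\<lambda>z. z ^ k * ps (jPc n m) z) has_field_derivative (of_nat k * cis \<theta> ^ (k - 1)) * ps (jPc n m) (cis \<theta>) + pd (jPc n m) (cis \<theta>) * cis \<theta> ^ k) (at (cis \<theta>) within cball 0 1)"
    by (rule DERIV_mult[OF _ ps_has_derivative[OF s]]) (auto intro!: derivative_eq_intros)
  from circle_chain_rule[OF this, of S]
  have "((\<lambda>\<theta>. cis \<theta> ^ k * ps (jPc n m) (cis \<theta>)) has_vector_derivative 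
     \<i> * cis \<theta> * ((of_nat k * cis \<theta> ^ (k - 1)) * ps (jPc n m) (cis \<theta>) + pd (jPc n m) (cis \<theta>) * cis \<theta> ^ k)) (at \<theta> within S)" .
  also have "\<i> * cis \<theta> * ((of_nat k * cis \<theta> ^ (k - 1)) * ps (jPc n m) (cis \<theta>) + pd (jPc n m) (cis \<theta>) * cis \<theta> ^ k)
     = \<i> * (cis \<theta> ^ k * (of_nat k * ps (jPc n m) (cis \<theta>) + cis \<theta> * pd (jPc n m) (cis \<theta>)))"
    by (simp add: k_def algebra_simps)
  also have "of_nat k * ps (jPc n m) (cis \<theta>) + cis \<theta> * pd (jPc n m) (cis \<theta>) = ps (\<lambda>l. of_nat (k + l) * jPc n m l) (cis \<theta>)"
  proof -
    have "(\<lambda>l. of_nat k * (jPc n m l * cis \<theta> ^ l) + of_nat l * jPc n m l * cis \<theta> ^ l) sums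
        (of_nat k * ps (jPc n m) (cis \<theta>) + ps (\<lambda>l. of_nat l * jPc n m l) (cis \<theta>))"
      by (intro sums_add sums_mult ps_sums s z_pd_summable) auto
    moreover have "cis \<theta> * pd (jPc n m) (cis \<theta>) = ps (\<lambda>l. of_nat l * jPc n m l) (cis \<theta>)"
      by (rule z_pd[OF s(2)]) simp
    ultimately show ?thesis by (simp add: ps_def sums_iff algebra_simps)
  qed
  finally have d: "((\<lambda>\<theta>. cis \<theta> ^ k * ps (jPc n m) (cis \<theta>)) has_vector_derivative
     \<i> * (cis \<theta> ^ k * ps (\<lambda>l. of_nat (k + l) * jPc n m l) (cis \<theta>))) (at \<theta> within S)" .
  have D: "((\<lambda>\<theta>. cis \<theta> ^ k * ps (jPc n m) (cis \<theta>) * jY \<theta>) has_vector_derivative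
     (cis \<theta> ^ k * ps (jPc n m) (cis \<theta>) * (- jV1 \<theta> * (jY \<theta>)\<^sup>2) + \<i> * (cis \<theta> ^ k * ps (\<lambda>l. of_nat (k + l) * jPc n m l) (cis \<theta>)) * jY \<theta>)) (at \<theta> within S)"
    by (rule has_vector_derivative_mult[OF d jY_derivative])
  have F: "cis \<theta> ^ k * ps (jPc n m) (cis \<theta>) * jY \<theta> = jF (cis \<theta>) n m" for \<theta>
    by (simp add: jF_def jP_ps k_def jY_def divide_inverse)
  have "ps (jPc n m) (cis \<theta>) * ps (\<lambda>k. of_nat k * jVc k) (cis \<theta>) = ps (conv (jPc n m) (\<lambda>k. of_nat k * jVc k)) (cis \<theta>)"
    by (rule ps_mult[OF s(1) s']) simp
  hence e: "cis \<theta> ^ k * ps (jPc n m) (cis \<theta>) * (- jV1 \<theta> * (jY \<theta>)\<^sup>2) = - \<i> * (cis \<theta> ^ k * ps (conv (jPc n m) (\<lambda>k. of_nat k * jVc k)) (cis \<theta>) * (jY \<theta>)\<^sup>2)"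
    by (simp add: jV1_def mult_ac)
  have alg: "- \<i> * a + \<i> * b * y = \<i> * (b * y) - \<i> * a" for a b y :: complex by simp
  show ?thesis using D unfolding F e alg k_def[symmetric] .
qed

text \<open>The coefficients of the derivative of \<open>jV\<close> are only
  \<open>O (1 / k)\<close>. Writing \<open>l = i + (l - i)\<close> shows that the convolution keeps
  this order: the bounded first moments of \<open>a\<close> meet the summable derivative
  coefficients, and their \<open>O (1 / k)\<close> bound meets the summable
  \<open>a\<close>.\<close>

lemma conv_derivative_bound:
  assumes a: "cls C v a" and v: "v \<ge> 1" and b: "cls M 1 b"
  shows "summable (\<lambda>k. cmod (conv a (\<lambda>k. of_nat k * b k) k))"
    "(\<Sum>k. cmod (conv a (\<lambda>k. of_nat k * b k) k)) \<le> 2 * C * M * v\<^sup>2"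
    "real l * cmod (conv a (\<lambda>k. of_nat k * b k) l) \<le> 2 * C * M * v\<^sup>2"
proof -
  have C: "0 \<le> C * v" "M \<ge> 0" using clsD(1)[OF a, of 0] clsD(1)[OF b, of 0] by (auto intro: order_trans[OF norm_ge_zero])
  hence C0: "C \<ge> 0" using v by (simp add: zero_le_mult_iff)
  have vv: "C * M * v \<le> C * M * v\<^sup>2" using C C0 v by (intro mult_left_mono self_le_power) auto
  have le: "(\<Sum>k\<le>K. cmod (conv a (\<lambda>k. of_nat k * b k) k)) \<le> C * M * v" for K
  proof -
    have "(\<Sum>k\<le>K. cmod (conv a (\<lambda>k. of_nat k * b k) k)) \<le> (\<Sum>k\<le>K. cmod (a k)) * (\<Sum>k\<le>K. cmod (of_nat k * b k))"
      by (rule conv_atMost_le)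
    also have "\<dots> \<le> (C * v) * (M * 1\<^sup>2)"
      using clsD(2)[OF b, of K] C by (intro mult_mono clsD(1)[OF a]) (auto simp: norm_mult intro!: sum_nonneg)
    finally show ?thesis by (simp add: mult_ac)
  qed
  have nn: "0 \<le> C * M * v\<^sup>2" using C C0 by simp
  show "summable (\<lambda>k. cmod (conv a (\<lambda>k. of_nat k * b k) k))"
    by (rule summable_suminf_atMost_bound(1)[OF _ le]) simp
  have "(\<Sum>k. cmod (conv a (\<lambda>k. of_nat k * b k) k)) \<le> C * M * v"
    by (rule summable_suminf_atMost_bound(2)[OF _ le]) simp
  thus "(\<Sum>k. cmod (conv a (\<lambda>k. of_nat k * b k) k)) \<le> 2 * C * M * v\<^sup>2" using vv nn by simp
  have "real l * cmod (conv a (\<lambda>k. of_nat k * b k) l) \<le> real l * (\<Sum>i\<le>l. cmod (a i) * cmod (of_nat (l - i) * b (l - i)))"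
    by (intro mult_left_mono conv_norm_le) auto
  also have "\<dots> \<le> (\<Sum>i\<le>l. (C * v\<^sup>2) * (real (l - i) * cmod (b (l - i))) + cmod (a i) * M)"
    unfolding sum_distrib_left
  proof (rule sum_mono)
    fix i assume i: "i \<in> {..l}"
    have 1: "real i * cmod (a i) \<le> C * v\<^sup>2"
      using member_le_sum[of i "{..i}" "\<lambda>i. real i * cmod (a i)"] clsD(2)[OF a, of i] by simp
    have 2: "(real (l - i))\<^sup>2 * cmod (b (l - i)) \<le> M" using clsD(3)[OF b, of "l - i"] by simp
    have "real l * (cmod (a i) * cmod (of_nat (l - i) * b (l - i))) 
       = (real i * cmod (a i)) * (real (l - i) * cmod (b (l - i))) + cmod (a i) * ((real (l - i))\<^sup>2 * cmod (b (l - i)))"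
    proof -
      obtain j where "l = i + j" using i le_Suc_ex by auto
      thus ?thesis by (simp add: norm_mult power2_eq_square algebra_simps)
    qed
    also have "\<dots> \<le> (C * v\<^sup>2) * (real (l - i) * cmod (b (l - i))) + cmod (a i) * M"
      using 1 2 by (intro add_mono mult_right_mono mult_left_mono) auto
    finally show "real l * (cmod (a i) * cmod (of_nat (l - i) * b (l - i))) \<le> (C * v\<^sup>2) * (real (l - i) * cmod (b (l - i))) + cmod (a i) * M" .
  qed
  also have "\<dots> = (C * v\<^sup>2) * (\<Sum>j\<le>l. real j * cmod (b j)) + (\<Sum>i\<le>l. cmod (a i)) * M"
  proof -
    have "(\<Sum>i\<le>l. real (l - i) * cmod (b (l - i))) = (\<Sum>j\<le>l. real j * cmod (b j))"
      by (rule sum.reindex_bij_witness[where i="\<lambda>j. l - j" and j="\<lambda>j. l - j"]) auto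
    thus ?thesis by (simp add: sum.distrib sum_distrib_right flip: sum_distrib_left)
  qed
  also have "\<dots> \<le> (C * v\<^sup>2) * (M * 1\<^sup>2) + (C * v) * M"
    using C C0 by (intro add_mono mult_left_mono mult_right_mono clsD[OF b] clsD[OF a]) auto
  finally show "real l * cmod (conv a (\<lambda>k. of_nat k * b k) l) \<le> 2 * C * M * v\<^sup>2"
    using vv by (simp add: mult_ac)
qed

text \<open>The growth in \<open>n\<close> and \<open>m\<close> is that of \<open>jv_bounds\<close>:
  the leading power contributes \<open>(\<bar>n - m\<bar> + 1) * jv\<close>, the moments contribute
  \<open>jv\<^sup>2\<close>. Restricting the sites to \<open>t / 4\<close> keeps the leading power
  below \<open>t / 2 + 1\<close>.\<close>

lemma kernel_bound:
  "\<exists>C\<ge>0. \<forall>t n m. t \<ge> 4 \<longrightarrow> \<bar>real_of_int n\<bar> \<le> t / 4 \<longrightarrow> \<bar>real_of_int m\<bar> \<le> t / 4 \<longrightarrow>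
     cmod (jK (phase t) n m) \<le> 
       C * t powr (- 3 / 2) * ((wt n) * (wt m))"
proof -
  obtain C where C: "C \<ge> 1" "\<forall>n m. cls C (jv n m) (jPc n m)" using jPc_cls by auto
  obtain M where M: "M \<ge> 1" "cls M 1 jVc" using jVc(1) by auto
  obtain A where A: "A \<ge> 0" "\<forall>\<theta>\<in>{0..2*pi}. cmod (jY \<theta>) \<le> A \<and> cmod (- jV1 \<theta> * (jY \<theta>)\<^sup>2) \<le> A \<and>
    cmod ((jY \<theta>)\<^sup>2) \<le> A \<and> cmod (2 * jY \<theta> * (- jV1 \<theta> * (jY \<theta>)\<^sup>2)) \<le> A" using jY_bounds by auto
  define B where "B = 150 * A * (4 * C) + 150 * A * (2 * C * M)"
  have "cmod (jK (phase t) n m) \<le> 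
       B * t powr (- 3 / 2) * ((wt n) * (wt m))"
    if t: "t \<ge> 4" and nm: "\<bar>real_of_int n\<bar> \<le> t / 4" "\<bar>real_of_int m\<bar> \<le> t / 4" for t n m
  proof -
    define X where "X = (wt n) * (wt m)"
    have X: "X > 0" by (simp add: X_def)
    define v where "v = jv n m"
    have v: "v \<ge> 1" "v\<^sup>2 \<le> X" "real (Suc (nat \<bar>n - m\<bar>)) * v \<le> X"
      using jv_bounds[of n m] by (auto simp: v_def X_def)
    define k where "k = Suc (nat \<bar>n - m\<bar>)"
    have "real (nat \<bar>n - m\<bar>) = \<bar>real_of_int n - real_of_int m\<bar>" by simp
    hence k: "real k \<le> t / 2 + 1" using nm unfolding k_def by linarith
    define p where "p = jPc n m"
    have p: "cls C v p" using C by (simp add: p_def v_def)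
    define E where "E \<theta> = exp (\<i> * of_real (2 * t * cos \<theta>))" for \<theta>
    define F where "F \<theta> = jF (cis \<theta>) n m" for \<theta>
    define F1 where "F1 \<theta> = cis \<theta> ^ k * ps (\<lambda>l. of_nat (k + l) * p l) (cis \<theta>) * jY \<theta>" for \<theta>
    define F2 where "F2 \<theta> = cis \<theta> ^ k * ps (conv p (\<lambda>k. of_nat k * jVc k)) (cis \<theta>) * (jY \<theta>)\<^sup>2" for \<theta>
    have dE: "(E has_vector_derivative (- 2 * \<i> * t * of_real (sin \<theta>) * E \<theta>)) (at \<theta> within S)" for \<theta> S
    proof -
      have "((\<lambda>w. exp (\<i> * (2 * of_real t * cos w))) has_field_derivative
          (- 2 * \<i> * t * of_real (sin \<theta>) * E \<theta>)) (at (of_real \<theta>))"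
        unfolding E_def by (auto intro!: derivative_eq_intros simp: cos_of_real sin_of_real)
      from has_vector_derivative_real_field[OF this, of S] show ?thesis
        by (simp add: E_def[abs_def] cos_of_real)
    qed
    have dF: "(F has_vector_derivative (\<i> * F1 \<theta> - \<i> * F2 \<theta>)) (at \<theta> within S)" for \<theta> S
      unfolding F_def[abs_def] F1_def F2_def p_def k_def by (rule jF_derivative)
    \<comment> \<open>The derivative of \<open>E\<close> already carries the factor
      \<open>sin \<theta>\<close> of the kernel, so this total derivative expresses
      \<open>t * jK\<close>, up to a factor of fixed modulus, through the integrals of
      \<open>F1\<close> and \<open>F2\<close>.\<close>
    have "((\<lambda>\<theta>. E \<theta> * (\<i> * F1 \<theta> - \<i> * F2 \<theta>) + (- 2 * \<i> * t * of_real (sin \<theta>) * E \<theta>) * F \<theta>) has_integral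
        (E (2 * pi) * F (2 * pi) - E 0 * F 0)) {0..2*pi}"
      by (rule fundamental_theorem_of_calculus[OF _ has_vector_derivative_mult[OF dE dF]]) auto
    hence zero: "((\<lambda>\<theta>. E \<theta> * (\<i> * F1 \<theta> - \<i> * F2 \<theta>) + (- 2 * \<i> * t * of_real (sin \<theta>) * E \<theta>) * F \<theta>) has_integral 0) {0..2*pi}"
      by (simp add: E_def F_def)
    have c1: "summable (\<lambda>l. cmod (of_nat (k + l) * p l))" "(\<Sum>l. cmod (of_nat (k + l) * p l)) \<le> 4 * C * X"
    proof -
      have "(\<Sum>l\<le>L. cmod (of_nat (k + l) * p l)) \<le> 4 * C * X" for L
      proof -
        have "(\<Sum>l\<le>L. cmod (of_nat (k + l) * p l)) = real k * (\<Sum>l\<le>L. cmod (p l)) + (\<Sum>l\<le>L. real l * cmod (p l))"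
          unfolding sum_distrib_left sum.distrib[symmetric]
        proof (intro sum.cong refl)
          fix l
          have "cmod (of_nat (k + l) * p l) = real (k + l) * cmod (p l)" by (simp only: norm_mult norm_of_nat)
          also have "\<dots> = real k * cmod (p l) + real l * cmod (p l)" by (simp add: algebra_simps)
          finally show "cmod (of_nat (k + l) * p l) = real k * cmod (p l) + real l * cmod (p l)" .
        qed
        also have "\<dots> \<le> real k * (C * v) + C * v\<^sup>2"
          by (intro add_mono mult_left_mono clsD[OF p]) auto
        also have "\<dots> \<le> C * X + C * X"
        proof (rule add_mono)
          have "C * (real k * v) \<le> C * X" using v(3) C(1) unfolding k_def by (intro mult_left_mono) auto
          thus "real k * (C * v) \<le> C * X" by (simp only: mult.left_commute)
          show "C * v\<^sup>2 \<le> C * X" using v(2) C(1) by (intro mult_left_mono) auto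
        qed
        also have "\<dots> \<le> 4 * C * X"
        proof -
          have "0 \<le> C * X" using C(1) X by simp
          thus ?thesis by simp
        qed
        finally show ?thesis .
      qed
      thus "summable (\<lambda>l. cmod (of_nat (k + l) * p l))" "(\<Sum>l. cmod (of_nat (k + l) * p l)) \<le> 4 * C * X"
        using summable_suminf_atMost_bound[of "\<lambda>l. cmod (of_nat (k + l) * p l)" "4 * C * X"] by auto
    qed
    have c2: "real l * cmod (of_nat (k + l) * p l) \<le> 4 * C * X" if l: "t / 4 \<le> real l" for l
    proof -
      \<comment> \<open>Past \<open>t / 4\<close> the leading power is dominated:
        \<open>k \<le> t / 2 + 1 \<le> 3 * l\<close>. For smaller \<open>l\<close> the available
        moments would cost extra growth, hence the restricted hypothesis in
        \<open>oscillatory_series\<close>.\<close>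
      have kl: "real (k + l) \<le> 4 * real l" using k l t by simp
      have "real l * cmod (of_nat (k + l) * p l) = real l * real (k + l) * cmod (p l)" by (simp only: norm_mult norm_of_nat mult.assoc)
      also have "\<dots> \<le> real l * (4 * real l) * cmod (p l)"
        by (intro mult_right_mono mult_left_mono kl) auto
      also have "\<dots> = 4 * ((real l)\<^sup>2 * cmod (p l))" by (simp add: power2_eq_square)
      also have "\<dots> \<le> 4 * (C * v\<^sup>2)" by (intro mult_left_mono clsD(3)[OF p]) auto
      also have "\<dots> \<le> 4 * (C * X)" using v C(1) by (intro mult_left_mono) auto
      finally show ?thesis by simp
    qed
    have CX: "2 * C * M * v\<^sup>2 \<le> 2 * C * M * X" using v C(1) M(1) by (intro mult_left_mono) auto
    note d = conv_derivative_bound[OF p v(1) M(2)]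
    have I1: "cmod (integral {0..2*pi} (\<lambda>\<theta>. E \<theta> * F1 \<theta>)) \<le> 150 * A * (4 * C * X) / sqrt t"
      unfolding E_def F1_def
    proof (rule oscillatory_series[OF jY_derivative jY_periodic _ _ _ t k _ c1 c2])
      show "continuous_on {0..2*pi} (\<lambda>\<theta>. - jV1 \<theta> * (jY \<theta>)\<^sup>2)" by (intro continuous_intros jY_continuous)
    qed (use A C X in auto)
    have I2: "cmod (integral {0..2*pi} (\<lambda>\<theta>. E \<theta> * F2 \<theta>)) \<le> 150 * A * (2 * C * M * X) / sqrt t"
      unfolding E_def F2_def
    proof (rule oscillatory_series[OF jY_sq_derivative _ _ _ _ t k _ d(1) order_trans[OF d(2) CX] order_trans[OF d(3) CX]])
      show "continuous_on {0..2*pi} (\<lambda>\<theta>. 2 * jY \<theta> * (- jV1 \<theta> * (jY \<theta>)\<^sup>2))" by (intro continuous_intros jY_continuous)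
    qed (use A C X M jY_periodic in auto)
    have Ec: "continuous_on S E" for S unfolding E_def by (intro continuous_intros)
    have cisc: "continuous_on S cis" for S by (intro continuous_intros)
    have psc: "continuous_on S (\<lambda>\<theta>. ps a (cis \<theta>))" if "summable (\<lambda>k. cmod (a k))" for a S
      using ps_continuous_on[OF that] by (rule continuous_on_compose2) (auto intro!: continuous_intros)
    have "continuous_on {0..2*pi} (\<lambda>\<theta>. E \<theta> * F1 \<theta>)" "continuous_on {0..2*pi} (\<lambda>\<theta>. E \<theta> * F2 \<theta>)"
      unfolding F1_def F2_def by (intro continuous_intros Ec cisc jY_continuous psc c1 d(1))+
    note Fi = this[THEN integrable_continuous_real, THEN integrable_integral]
    define J where "J = integral {0..2*pi} (\<lambda>\<theta>. E \<theta> * F1 \<theta>) - integral {0..2*pi} (\<lambda>\<theta>. E \<theta> * F2 \<theta>)"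
    have "((\<lambda>\<theta>. \<i> * (E \<theta> * F1 \<theta> - E \<theta> * F2 \<theta>)) has_integral \<i> * J) {0..2*pi}"
      unfolding J_def by (intro has_integral_mult_right has_integral_diff Fi)
    from has_integral_diff[OF this zero]
    have "((\<lambda>\<theta>. (2 * \<i> * of_real t * of_real (sin \<theta>) * E \<theta>) * F \<theta>) has_integral \<i> * J) {0..2*pi}"
      by (simp add: algebra_simps)
    hence J2: "((\<lambda>\<theta>. (exp (- 2 * \<i> * of_real t) / of_real t) * ((2 * \<i> * of_real t * of_real (sin \<theta>) * E \<theta>) * F \<theta>)) has_integral 
          (exp (- 2 * \<i> * of_real t) / of_real t) * (\<i> * J)) {0..2*pi}"
      by (rule has_integral_mult_right)
    have eq: "(exp (- 2 * \<i> * of_real t) / of_real t) * ((2 * \<i> * of_real t * of_real (sin \<theta>) * E \<theta>) * F \<theta>) =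
        exp (- \<i> * of_real t * of_real (2 - 2 * cos \<theta>)) * (2 * \<i> * of_real (sin \<theta>)) * jF (cis \<theta>) n m" for \<theta>
    proof -
      have "exp (- \<i> * of_real t * of_real (2 - 2 * cos \<theta>)) = exp (- 2 * \<i> * of_real t) * E \<theta>"
        unfolding E_def exp_add[symmetric] by (simp add: algebra_simps)
      thus ?thesis using t by (simp add: F_def)
    qed
    have "integral {0..2*pi} (\<lambda>\<theta>. exp (- \<i> * of_real t * of_real (2 - 2 * cos \<theta>)) * (2 * \<i> * of_real (sin \<theta>)) * jF (cis \<theta>) n m) = 
          (exp (- 2 * \<i> * of_real t) / of_real t) * (\<i> * J)"
      using J2 unfolding eq by (rule integral_unique)
    hence "cmod (jK (phase t) n m) = cmod (exp (- 2 * \<i> * of_real t)) * cmod J / t / (2 * pi)"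
      using t unfolding jK_def by (simp add: norm_divide norm_mult)
    also have "cmod (exp (- 2 * \<i> * of_real t)) = 1" by (simp add: norm_exp_eq_Re)
    also have "1 * cmod J / t / (2 * pi) \<le> cmod J / t"
    proof -
      have "cmod J / t / (2 * pi) \<le> cmod J / t / 1"
        using t pi_gt3 by (intro divide_left_mono) auto
      thus ?thesis by simp
    qed
    also have "\<dots> \<le> (B * X / sqrt t) / t"
    proof (intro divide_right_mono)
      have "cmod J \<le> 150 * A * (4 * C * X) / sqrt t + 150 * A * (2 * C * M * X) / sqrt t"
        unfolding J_def by (rule order_trans[OF norm_triangle_ineq4 add_mono[OF I1 I2]])
      also have "\<dots> = B * X / sqrt t" by (simp add: B_def add_divide_distrib ring_distribs)
      finally show "cmod J \<le> B * X / sqrt t" .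
    qed (use t in auto)
    also have "\<dots> = B * t powr (- 3 / 2) * X"
    proof -
      have "t powr (- 3 / 2) = t powr (- (1 / 2) + - 1)" by simp
      also have "\<dots> = t powr (- (1 / 2)) * t powr (- 1)" by (rule powr_add)
      also have "t powr (- (1 / 2)) = 1 / sqrt t" using t powr_half_sqrt[of t] by (simp only: powr_minus_divide)
      also have "t powr (- 1) = 1 / t" using t by (simp only: powr_minus_divide powr_one)
      finally show ?thesis by simp
    qed
    finally show ?thesis by (simp add: X_def)
  qed
  moreover have "B \<ge> 0" using A C M by (simp add: B_def)
  ultimately show ?thesis by (intro exI[of _ B]) blast
qed

end


section \<open>Linearity of the evolution\<close>

lemma evol_cmult: "evol q t (\<lambda>n. c * u n) = (\<lambda>n. c * evol q t u n)"
  if "l2 u" "\<And>n. \<bar>q n\<bar> \<le> Q" for Q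
proof
  fix n
  have P: "(Hop q ^^ k) (\<lambda>n. c * u n) = (\<lambda>n. c * (Hop q ^^ k) u n)" for k
    by (induction k) (auto simp: Hop_def algebra_simps)
  show "evol q t (\<lambda>n. c * u n) n = c * evol q t u n"
    using suminf_mult[OF summable_norm_cancel[OF evol_l2(2)[where q=q and t=t and n=n, OF that]], of c]
    by (simp add: evol_def P mult_ac)
qed

lemma evol_sum:
  assumes "finite S" "\<And>m. m \<in> S \<Longrightarrow> l2 (f m)" "\<And>n. \<bar>q n\<bar> \<le> Q"
  shows "evol q t (\<lambda>n. \<Sum>m\<in>S. c m * f m n) = (\<lambda>n. \<Sum>m\<in>S. c m * evol q t (f m) n)"
  using assms(1,2)
proof (induction rule: finite_induct)
  case empty
  have "(Hop q ^^ k) (\<lambda>_. 0) = (\<lambda>_. 0)" for k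
    by (induction k) (auto simp: Hop_def)
  thus ?case by (simp add: evol_def)
next
  case (insert a A)
  have 1: "l2 (\<lambda>n. c a * f a n)" using insert by (intro l2_cmult) auto
  have 2: "l2 (\<lambda>n. \<Sum>m\<in>A. c m * f m n)"
    using l2_sum[of A "\<lambda>m n. c m * f m n"] insert l2_cmult by auto
  have "evol q t (\<lambda>n. c a * f a n + (\<Sum>m\<in>A. c m * f m n)) = (\<lambda>n. evol q t (\<lambda>n. c a * f a n) n + evol q t (\<lambda>n. \<Sum>m\<in>A. c m * f m n) n)"
    by (rule evol_add[OF 1 2 assms(3)])
  moreover have "evol q t (\<lambda>n. c a * f a n) = (\<lambda>n. c a * evol q t (f a) n)"
    by (rule evol_cmult) (use insert assms(3) in auto)
  ultimately show ?case using insert by simp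
qed

subsection \<open>Weighted norms\<close>

lemma in_l2w_wnorm_sq: "(wnorm \<sigma> u)\<^sup>2 = (\<Sum>\<^sub>\<infinity>n. (wt n) powr (2 * \<sigma>) * (cmod (u n))\<^sup>2)"
  by (auto simp: wnorm_def intro!: infsum_nonneg)

lemma finite_sum_le_wnorm_sq:
  assumes "in_l2w \<sigma> u" "finite F"
  shows "(\<Sum>n\<in>F. (wt n) powr (2 * \<sigma>) * (cmod (u n))\<^sup>2) \<le> (wnorm \<sigma> u)\<^sup>2"
  unfolding in_l2w_wnorm_sq using assms by (intro finite_sum_le_infsum) (auto simp: in_l2w_def)

lemma in_l2wI_finite_sums:
  assumes "b \<ge> 0" "\<And>F. finite F \<Longrightarrow> (\<Sum>n\<in>F. (wt n) powr (2 * \<sigma>) * (cmod (u n))\<^sup>2) \<le> b\<^sup>2"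
  shows "in_l2w \<sigma> u" "wnorm \<sigma> u \<le> b"
proof -
  show s: "in_l2w \<sigma> u" unfolding in_l2w_def
    by (rule nonneg_bdd_above_summable_on) (auto intro!: bdd_aboveI2[where M="b\<^sup>2"] assms)
  have "(wnorm \<sigma> u)\<^sup>2 \<le> b\<^sup>2"
    unfolding in_l2w_wnorm_sq using s assms(2) by (intro infsum_le_finite_sums) (auto simp: in_l2w_def)
  thus "wnorm \<sigma> u \<le> b" using assms(1) by (simp add: power2_le_iff_abs_le)
qed

lemma in_l2w_mono:
  assumes "in_l2w \<sigma> u" "\<And>n. cmod (v n) \<le> cmod (u n)"
  shows "in_l2w \<sigma> v" "wnorm \<sigma> v \<le> wnorm \<sigma> u"
proof -
  have "(\<Sum>n\<in>F. (wt n) powr (2 * \<sigma>) * (cmod (v n))\<^sup>2) \<le> (wnorm \<sigma> u)\<^sup>2" if "finite F" for F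
  proof -
    have "(\<Sum>n\<in>F. (wt n) powr (2 * \<sigma>) * (cmod (v n))\<^sup>2) \<le> (\<Sum>n\<in>F. (wt n) powr (2 * \<sigma>) * (cmod (u n))\<^sup>2)"
      by (intro sum_mono mult_left_mono power_mono assms) auto
    also have "\<dots> \<le> (wnorm \<sigma> u)\<^sup>2" by (rule finite_sum_le_wnorm_sq[OF assms(1) that])
    finally show ?thesis .
  qed
  thus "in_l2w \<sigma> v" "wnorm \<sigma> v \<le> wnorm \<sigma> u"
    using in_l2wI_finite_sums[of "wnorm \<sigma> u" \<sigma> v] wnorm_nonneg by auto
qed

lemma l2_tail_bound:
  assumes u: "in_l2w \<sigma> u" and \<sigma>: "\<sigma> > 0" and R: "R > 0" and v: "\<And>n. v n = (if \<bar>real_of_int n\<bar> < R then 0 else u n)"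
  shows "l2 v" "wnorm 0 v \<le> R powr (- \<sigma>) * wnorm \<sigma> u"
proof -
  have "(\<Sum>n\<in>F. (wt n) powr (2 * 0) * (cmod (v n))\<^sup>2) \<le> (R powr (- \<sigma>) * wnorm \<sigma> u)\<^sup>2" if F: "finite F" for F
  proof -
    have "(\<Sum>n\<in>F. (wt n) powr (2 * 0) * (cmod (v n))\<^sup>2) \<le> (\<Sum>n\<in>F. R powr (- 2 * \<sigma>) * ((wt n) powr (2 * \<sigma>) * (cmod (u n))\<^sup>2))"
    proof (rule sum_mono)
      fix n
      show "(wt n) powr (2 * 0) * (cmod (v n))\<^sup>2 \<le> R powr (- 2 * \<sigma>) * ((wt n) powr (2 * \<sigma>) * (cmod (u n))\<^sup>2)"
      proof (cases "\<bar>real_of_int n\<bar> < R")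
        case False
        have "1 = R powr (- 2 * \<sigma>) * R powr (2 * \<sigma>)" using R by (simp flip: powr_add)
        also have "\<dots> \<le> R powr (- 2 * \<sigma>) * (wt n) powr (2 * \<sigma>)"
          using False R \<sigma> by (intro mult_left_mono powr_mono2) auto
        finally have "1 * (cmod (u n))\<^sup>2 \<le> (R powr (- 2 * \<sigma>) * (wt n) powr (2 * \<sigma>)) * (cmod (u n))\<^sup>2"
          by (rule mult_right_mono) auto
        moreover have "(wt n) powr (2 * 0) = 1" using weight_pos[of n] by simp
        ultimately show ?thesis using False by (simp add: v mult.assoc)
      qed (simp add: v)
    qed
    also have "\<dots> \<le> R powr (- 2 * \<sigma>) * (wnorm \<sigma> u)\<^sup>2"
      unfolding sum_distrib_left[symmetric] by (intro mult_left_mono finite_sum_le_wnorm_sq u F) auto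
    also have "R powr (- 2 * \<sigma>) = (R powr (- \<sigma>))\<^sup>2"
      by (simp add: power2_eq_square flip: powr_add)
    finally show ?thesis by (simp only: power_mult_distrib)
  qed
  thus "l2 v" "wnorm 0 v \<le> R powr (- \<sigma>) * wnorm \<sigma> u"
    using in_l2wI_finite_sums[of "R powr (- \<sigma>) * wnorm \<sigma> u" 0 v] wnorm_nonneg[of \<sigma> u] by auto
qed

lemma in_l2w_imp_l2:
  assumes "in_l2w \<sigma> u" "\<sigma> > 0"
  shows "l2 u" "wnorm 0 u \<le> wnorm \<sigma> u"
proof -
  have "(\<Sum>n\<in>F. (wt n) powr (2 * 0) * (cmod (u n))\<^sup>2) \<le> (wnorm \<sigma> u)\<^sup>2" if F: "finite F" for F
  proof -
    have "(\<Sum>n\<in>F. (wt n) powr (2 * 0) * (cmod (u n))\<^sup>2) \<le> (\<Sum>n\<in>F. (wt n) powr (2 * \<sigma>) * (cmod (u n))\<^sup>2)"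
      using assms(2) by (intro sum_mono mult_right_mono powr_mono) auto
    also have "\<dots> \<le> (wnorm \<sigma> u)\<^sup>2" by (rule finite_sum_le_wnorm_sq[OF assms(1) F])
    finally show ?thesis .
  qed
  thus "l2 u" "wnorm 0 u \<le> wnorm \<sigma> u"
    using in_l2wI_finite_sums[of "wnorm \<sigma> u" 0 u] wnorm_nonneg[of \<sigma> u] by auto
qed

lemma weight_powr_summable:
  assumes "s < -1"
  shows "(\<lambda>n. (wt n) powr s) summable_on UNIV"
proof -
  have "summable (\<lambda>k. real k powr s)" using assms by (simp add: summable_real_powr_iff)
  hence "summable (\<lambda>k. real (Suc k) powr s)" by (subst summable_Suc_iff)
  from int_summable_on[OF this] have "(\<lambda>n::int. real (Suc (nat \<bar>n\<bar>)) powr s) summable_on UNIV" by simp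
  moreover have "real (Suc (nat \<bar>n\<bar>)) = 1 + \<bar>real_of_int n\<bar>" for n :: int by simp
  ultimately show ?thesis by (simp only:)
qed

lemma l2_finite_tail:
  assumes u: "l2 u" and e: "\<epsilon> > 0"
  shows "\<exists>F. finite F \<and> wnorm 0 (\<lambda>n. if n \<in> F then 0 else u n) \<le> \<epsilon>"
proof -
  have s: "(\<lambda>n. (cmod (u n))\<^sup>2) summable_on UNIV" using u by (simp add: l2_iff)
  obtain F where F: "finite F" "dist (\<Sum>n\<in>F. (cmod (u n))\<^sup>2) (\<Sum>\<^sub>\<infinity>n. (cmod (u n))\<^sup>2) \<le> \<epsilon>\<^sup>2"
    using infsum_finite_approximation[OF s, of "\<epsilon>\<^sup>2"] e by auto
  define v where "v = (\<lambda>n. if n \<in> F then 0 else u n)"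
  have "L2_set (\<lambda>n. cmod (v n)) G \<le> \<epsilon>" if G: "finite G" for G
  proof -
    have "(\<Sum>n\<in>G. (cmod (v n))\<^sup>2) = (\<Sum>n\<in>G - F. (cmod (u n))\<^sup>2)"
      by (rule sum.mono_neutral_cong_right) (use G in \<open>auto simp: v_def\<close>)
    moreover have "(\<Sum>n\<in>G - F. (cmod (u n))\<^sup>2) + (\<Sum>n\<in>F. (cmod (u n))\<^sup>2) = (\<Sum>n\<in>(G - F) \<union> F. (cmod (u n))\<^sup>2)"
      using F(1) G by (subst sum.union_disjoint) auto
    moreover have "(\<Sum>n\<in>(G - F) \<union> F. (cmod (u n))\<^sup>2) \<le> (\<Sum>\<^sub>\<infinity>n. (cmod (u n))\<^sup>2)"
      using F(1) G s by (intro finite_sum_le_infsum) auto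
    moreover have "(\<Sum>\<^sub>\<infinity>n. (cmod (u n))\<^sup>2) - (\<Sum>n\<in>F. (cmod (u n))\<^sup>2) \<le> \<epsilon>\<^sup>2"
      using F(2) by (simp add: dist_real_def)
    ultimately have "(\<Sum>n\<in>G. (cmod (v n))\<^sup>2) \<le> \<epsilon>\<^sup>2" by linarith
    thus ?thesis unfolding L2_set_def using e by (simp add: real_le_lsqrt sum_nonneg)
  qed
  from l2I_L2_set(2)[OF this] show ?thesis unfolding v_def using F(1) by blast
qed

context nonresonant
begin

subsection \<open>The projection onto the continuous subspace\<close>

text \<open>\<open>PK\<close> is an explicit form of \<open>Pc q\<close>, identified only in \<open>Pc_eq_PK\<close>.\<close>

definition PK :: "(int \<Rightarrow> complex) \<Rightarrow> int \<Rightarrow> complex" where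
  "PK u n = u n + (\<Sum>z\<in>Z. (jkap z * l2inner u (jf q z)) * jf q z n)"

lemma Z_l2: "z \<in> Z \<Longrightarrow> l2 (jf q z)"
  using Z_eigvec by (auto simp: eigvec_def)

lemma PK_sum_l2: "l2 (\<lambda>n. \<Sum>z\<in>Z. (jkap z * l2inner u (jf q z)) * jf q z n)"
  using l2_sum[OF finite_Z, of "\<lambda>z n. (jkap z * l2inner u (jf q z)) * jf q z n"] l2_cmult Z_l2 by blast

definition "CK = 1 + (\<Sum>z\<in>Z. cmod (jkap z) * (wnorm 0 (jf q z))\<^sup>2)"

lemma CK_pos: "CK \<ge> 1"
  by (auto simp: CK_def intro!: sum_nonneg)

lemma PK_l2:
  assumes u: "l2 u"
  shows "l2 (PK u)" "wnorm 0 (PK u) \<le> CK * wnorm 0 u"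
proof -
  define s where "s = (\<lambda>n. \<Sum>z\<in>Z. (jkap z * l2inner u (jf q z)) * jf q z n)"
  have s: "l2 s" unfolding s_def by (rule PK_sum_l2)
  have eq: "PK u = (\<lambda>n. u n + s n)" by (auto simp: PK_def s_def)
  show "l2 (PK u)" unfolding eq by (intro l2_add u s)
  have l: "l2 (\<lambda>n. (jkap z * l2inner u (jf q z)) * jf q z n)" if "z \<in> Z" for z
    by (intro l2_cmult Z_l2 that)
  have "wnorm 0 s \<le> (\<Sum>z\<in>Z. wnorm 0 (\<lambda>n. (jkap z * l2inner u (jf q z)) * jf q z n))"
    unfolding s_def using l2_sum[OF finite_Z, of "\<lambda>z n. (jkap z * l2inner u (jf q z)) * jf q z n", OF l] by blast
  also have "\<dots> \<le> (\<Sum>z\<in>Z. (cmod (jkap z) * (wnorm 0 (jf q z))\<^sup>2) * wnorm 0 u)"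
  proof (rule sum_mono)
    fix z assume z: "z \<in> Z"
    have "wnorm 0 (\<lambda>n. (jkap z * l2inner u (jf q z)) * jf q z n) \<le> cmod (jkap z * l2inner u (jf q z)) * wnorm 0 (jf q z)"
      by (rule l2_cmult(2)[OF Z_l2[OF z]])
    also have "\<dots> \<le> (cmod (jkap z) * (wnorm 0 u * wnorm 0 (jf q z))) * wnorm 0 (jf q z)"
      unfolding norm_mult by (intro mult_right_mono mult_left_mono l2inner_bound u Z_l2 z wnorm_nonneg) auto
    finally show "wnorm 0 (\<lambda>n. (jkap z * l2inner u (jf q z)) * jf q z n) \<le> (cmod (jkap z) * (wnorm 0 (jf q z))\<^sup>2) * wnorm 0 u"
      by (simp add: power2_eq_square mult_ac)
  qed
  finally have "wnorm 0 s \<le> (\<Sum>z\<in>Z. cmod (jkap z) * (wnorm 0 (jf q z))\<^sup>2) * wnorm 0 u"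
    by (simp only: sum_distrib_right)
  thus "wnorm 0 (PK u) \<le> CK * wnorm 0 u"
    unfolding eq CK_def using l2_add(2)[OF u s] by (simp add: algebra_simps)
qed

lemma PK_add:
  assumes "l2 u" "l2 v"
  shows "PK (\<lambda>n. u n + v n) = (\<lambda>n. PK u n + PK v n)"
proof
  fix n
  have "(\<Sum>z\<in>Z. (jkap z * l2inner (\<lambda>n. u n + v n) (jf q z)) * jf q z n) =
     (\<Sum>z\<in>Z. (jkap z * l2inner u (jf q z)) * jf q z n + (jkap z * l2inner v (jf q z)) * jf q z n)"
    using l2inner_add_left[OF assms Z_l2] by (intro sum.cong) (auto simp: algebra_simps)
  thus "PK (\<lambda>n. u n + v n) n = PK u n + PK v n" by (simp add: PK_def sum.distrib)
qed

text \<open>The difference is a finite combination of eigenfunctions, so the approximation demanded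
  by \<open>pp_space\<close> is exact; the bijection only supplies the indexing by an initial
  segment.\<close>

lemma PK_pp_space:
  assumes u: "l2 u"
  shows "(\<lambda>n. u n - PK u n) \<in> pp_space q"
proof -
  obtain h where h: "bij_betw h {0..<card Z} Z" using ex_bij_betw_nat_finite[OF finite_Z] by blast
  define c where "c j = - (jkap (h j) * l2inner u (jf q (h j)))" for j
  have hz: "h j \<in> Z" if "j < card Z" for j using h that by (auto simp: bij_betw_def)
  have "u n - PK u n = (\<Sum>z\<in>Z. - (jkap z * l2inner u (jf q z)) * jf q z n)" for n
    by (simp add: PK_def sum_negf)
  also have "\<dots> n = (\<Sum>j\<in>{0..<card Z}. c j * jf q (h j) n)" for n
    unfolding c_def using sum.reindex_bij_betw[OF h, of "\<lambda>z. - (jkap z * l2inner u (jf q z)) * jf q z n"] by simp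
  finally have eq: "u n - PK u n = (\<Sum>j<card Z. c j * jf q (h j) n)" for n by (simp add: atLeast0LessThan)
  have l: "l2 (\<lambda>n. u n - PK u n)" by (intro l2_diff u PK_l2)
  have "\<exists>(m::nat) c \<phi>. (\<forall>j<m. eigvec q (\<phi> j)) \<and> wnorm 0 (\<lambda>n. (u n - PK u n) - (\<Sum>j<m. c j * \<phi> j n)) < e" if "e > 0" for e
  proof (intro exI conjI)
    show "\<forall>j<card Z. eigvec q (jf q (h j))" using Z_eigvec hz by blast
    show "wnorm 0 (\<lambda>n. (u n - PK u n) - (\<Sum>j<card Z. c j * jf q (h j) n)) < e"
      unfolding eq using that by (simp add: l2_zero)
  qed
  thus ?thesis using l by (simp add: pp_space_def)
qed

lemma l2_finite_support:
  assumes "finite S" "\<And>n. n \<notin> S \<Longrightarrow> u n = 0"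
  shows "l2 u"
proof -
  have "(\<lambda>n. (cmod (u n))\<^sup>2) summable_on UNIV \<longleftrightarrow> (\<lambda>n. (cmod (u n))\<^sup>2) summable_on S"
    by (rule summable_on_cong_neutral) (use assms in auto)
  thus ?thesis using assms(1) by (simp add: l2_iff)
qed

text \<open>This is \<open>completeness\<close> summed against \<open>u\<close>. The eigenfunctions
  at \<open>Z\<close> are real, which removes the conjugation in \<open>l2inner\<close>.\<close>

lemma PK_finite_support:
  assumes S: "finite S" "\<And>n. n \<notin> S \<Longrightarrow> u n = 0"
  shows "PK u = (\<lambda>n. \<Sum>m\<in>S. u m * jK (\<lambda>_. 1) n m)"
proof
  fix n
  have inner: "l2inner u (jf q z) = (\<Sum>m\<in>S. u m * jf q z m)" if "z \<in> Z" for z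
  proof -
    have "l2inner u (jf q z) = (\<Sum>\<^sub>\<infinity>m\<in>S. u m * cnj (jf q z m))"
      unfolding l2inner_def by (rule infsum_cong_neutral) (use S in auto)
    thus ?thesis using S(1) Z_jf_real[OF that] by simp
  qed
  have "(\<Sum>m\<in>S. u m * jK (\<lambda>_. 1) n m) = (\<Sum>m\<in>S. u m * (if n = m then 1 else 0)) + (\<Sum>m\<in>S. \<Sum>z\<in>Z. u m * (jkap z * jf q z n * jf q z m))"
    unfolding completeness by (simp add: ring_distribs sum.distrib sum_distrib_left)
  also have "(\<Sum>m\<in>S. u m * (if n = m then 1 else 0)) = (\<Sum>m\<in>S. if n = m then u m else 0)"
    by (intro sum.cong) auto
  also have "\<dots> = u n" using S by (simp add: sum.delta)
  also have "(\<Sum>m\<in>S. \<Sum>z\<in>Z. u m * (jkap z * jf q z n * jf q z m)) = (\<Sum>z\<in>Z. \<Sum>m\<in>S. u m * (jkap z * jf q z n * jf q z m))"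
    by (rule sum.swap)
  also have "\<dots> = (\<Sum>z\<in>Z. (jkap z * l2inner u (jf q z)) * jf q z n)"
    by (intro sum.cong refl) (simp add: inner sum_distrib_left sum_distrib_right mult_ac)
  finally show "PK u n = (\<Sum>m\<in>S. u m * jK (\<lambda>_. 1) n m)" by (simp add: PK_def)
qed

text \<open>Square summability of a column is not visible in the integral; it comes from identifying
  the column with \<open>PK\<close> of a unit vector.\<close>

lemma jK_l2: "l2 (\<lambda>n. jK (\<lambda>_. 1) n m)"
proof -
  have "PK (\<lambda>n. if n = m then 1 else 0) = (\<lambda>n. \<Sum>m'\<in>{m}. (if m' = m then 1 else 0) * jK (\<lambda>_. 1) n m')"
    by (rule PK_finite_support) auto
  moreover have "l2 (PK (\<lambda>n. if n = m then 1 else 0))"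
    by (intro PK_l2 l2_finite_support[of "{m}"]) auto
  ultimately show ?thesis by simp
qed

lemma evol_PK_finite_support:
  assumes S: "finite S" "\<And>n. n \<notin> S \<Longrightarrow> u n = 0"
  shows "evol q t (PK u) n = (\<Sum>m\<in>S. u m * jK (phase t) n m)"
proof -
  have "PK u = (\<lambda>n. \<Sum>m\<in>S. u m * jK (\<lambda>_. 1) n m)" by (rule PK_finite_support) (use S in auto)
  moreover have "evol q t (\<lambda>n. \<Sum>m\<in>S. u m * jK (\<lambda>_. 1) n m) = (\<lambda>n. \<Sum>m\<in>S. u m * evol q t (\<lambda>n. jK (\<lambda>_. 1) n m) n)"
    by (rule evol_sum[where f="\<lambda>m n. jK (\<lambda>_. 1) n m", OF S(1) jK_l2 Q])
  ultimately show ?thesis by (simp add: evol_jK)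
qed

lemma evol_PK_l2:
  assumes "l2 u"
  shows "l2 (evol q t (PK u))" "wnorm 0 (evol q t (PK u)) \<le> CK * wnorm 0 u"
  using evol_l2(1)[where q=q, OF PK_l2(1)[OF assms] Q] evol_l2(4)[where q=q, OF PK_l2(1)[OF assms] Q] PK_l2(2)[OF assms]
  by simp_all

lemma evol_PK_add:
  assumes "l2 u" "l2 v"
  shows "evol q t (PK (\<lambda>n. u n + v n)) n = evol q t (PK u) n + evol q t (PK v) n"
  using fun_cong[OF evol_add[where q=q and t=t, OF PK_l2(1)[OF assms(1)] PK_l2(1)[OF assms(2)] Q], of n]
  by (simp add: PK_add[OF assms])


subsection \<open>The weighted decay estimate\<close>

text \<open>Cauchy-Schwarz; \<open>2 - 2 * \<sigma> < -1\<close> makes the weight sum converge. The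
  same sum appears once more when the squared kernel bound is summed over \<open>n\<close>.\<close>

lemma weighted_l1_bound:
  assumes u: "in_l2w \<sigma> u" and \<sigma>: "\<sigma> > 3 / 2" and S: "finite S"
  shows "(\<Sum>m\<in>S. (wt m) * cmod (u m)) 
     \<le> sqrt (\<Sum>\<^sub>\<infinity>m. (wt m) powr (2 - 2 * \<sigma>)) * wnorm \<sigma> u"
proof -
  define a where "a m = (wt m) powr (1 - \<sigma>)" for m
  define b where "b m = (wt m) powr \<sigma> * cmod (u m)" for m
  have ab: "(wt m) * cmod (u m) = \<bar>a m\<bar> * \<bar>b m\<bar>" for m
  proof -
    have "(wt m) powr (1 - \<sigma>) * (wt m) powr \<sigma> = 1 + \<bar>real_of_int m\<bar>"
      using weight_pos[of m] by (simp flip: powr_add)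
    thus ?thesis by (simp add: a_def b_def abs_mult mult.assoc[symmetric])
  qed
  have "(\<Sum>m\<in>S. (wt m) * cmod (u m)) \<le> L2_set a S * L2_set b S"
    unfolding ab by (rule L2_set_mult_ineq)
  also have "\<dots> \<le> sqrt (\<Sum>\<^sub>\<infinity>m. (wt m) powr (2 - 2 * \<sigma>)) * wnorm \<sigma> u"
  proof (intro mult_mono)
    have "(a m)\<^sup>2 = (wt m) powr (2 - 2 * \<sigma>)" for m
      by (simp add: a_def power2_eq_square algebra_simps flip: powr_add)
    moreover have "(\<Sum>m\<in>S. (wt m) powr (2 - 2 * \<sigma>)) \<le> (\<Sum>\<^sub>\<infinity>m. (wt m) powr (2 - 2 * \<sigma>))"
      using \<sigma> S by (intro finite_sum_le_infsum weight_powr_summable) auto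
    ultimately show "L2_set a S \<le> sqrt (\<Sum>\<^sub>\<infinity>m. (wt m) powr (2 - 2 * \<sigma>))"
      unfolding L2_set_def by (simp add: real_sqrt_le_mono)
    have "(b m)\<^sup>2 = (wt m) powr (2 * \<sigma>) * (cmod (u m))\<^sup>2" for m
      by (simp add: b_def power_mult_distrib power2_eq_square flip: powr_add)
    hence "(\<Sum>m\<in>S. (b m)\<^sup>2) \<le> (wnorm \<sigma> u)\<^sup>2" using finite_sum_le_wnorm_sq[OF u S] by simp
    thus "L2_set b S \<le> wnorm \<sigma> u"
      unfolding L2_set_def using wnorm_nonneg[of \<sigma> u] by (simp add: real_le_lsqrt sum_nonneg)
  qed (auto intro!: infsum_nonneg)
  finally show ?thesis .
qed

text \<open>Sites with \<open>\<bar>n\<bar> \<ge> t / 4\<close> or \<open>\<bar>m\<bar> \<ge> t / 4\<close> are controlled by the weights and unitarity; for the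
  remaining ones the phase has nondegenerate stationary points and the kernel bound applies.\<close>

lemma decay_finite_support:
  assumes \<sigma>: "\<sigma> > 3 / 2"
  shows "\<exists>C\<ge>0. \<forall>t u S F. t \<ge> 4 \<longrightarrow> finite S \<longrightarrow> (\<forall>n. n \<notin> S \<longrightarrow> u n = 0) \<longrightarrow> in_l2w \<sigma> u \<longrightarrow> finite F \<longrightarrow>
    (\<Sum>n\<in>F. (wt n) powr (2 * (- \<sigma>)) * (cmod (evol q t (PK u) n))\<^sup>2) \<le> (C * t powr (- 3 / 2) * wnorm \<sigma> u)\<^sup>2"
proof -
  obtain B where B: "B \<ge> 0" "\<forall>t n m. t \<ge> 4 \<longrightarrow> \<bar>real_of_int n\<bar> \<le> t / 4 \<longrightarrow> \<bar>real_of_int m\<bar> \<le> t / 4 \<longrightarrow>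
     cmod (jK (phase t) n m) \<le> 
       B * t powr (- 3 / 2) * ((wt n) * (wt m))"
    using kernel_bound by auto
  define S0 where "S0 = (\<Sum>\<^sub>\<infinity>m. (wt m) powr (2 - 2 * \<sigma>))"
  have S0: "S0 \<ge> 0" unfolding S0_def by (intro infsum_nonneg) auto
  \<comment> \<open>One factor \<open>S0\<close> comes from the sum over \<open>m\<close>, another
    from the sum over \<open>n\<close>. The number \<open>192 = 2 * 64 + 64\<close> comes from the
    far part of \<open>u\<close> and from the far sites.\<close>
  define C2 where "C2 = 2 * B\<^sup>2 * S0\<^sup>2 + 192 * CK\<^sup>2"
  have C2: "C2 \<ge> 0" by (simp add: C2_def)
  have main: "(\<Sum>n\<in>F. (wt n) powr (2 * (- \<sigma>)) * (cmod (evol q t (PK u) n))\<^sup>2) \<le> C2 * (t powr (- 3 / 2) * wnorm \<sigma> u)\<^sup>2"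
    if t: "t \<ge> 4" and S: "finite S" "\<forall>n. n \<notin> S \<longrightarrow> u n = 0" and u: "in_l2w \<sigma> u" and F: "finite F" for t u S F
  proof -
    define \<tau> where "\<tau> = t powr (- 3 / 2)"
    define U where "U = wnorm \<sigma> u"
    have U: "U \<ge> 0" unfolding U_def by (rule wnorm_nonneg)
    define R where "R = t / 4"
    have R: "R \<ge> 1" using t by (simp add: R_def)
    have R\<sigma>: "R powr (- \<sigma>) \<le> 8 * \<tau>"
    proof -
      have "R powr (- \<sigma>) \<le> R powr (- 3 / 2)" using R \<sigma> by (intro powr_mono) auto
      also have "\<dots> = \<tau> * 4 powr (3 / 2)"
        using t by (simp add: R_def \<tau>_def powr_divide powr_minus_divide)
      also have "(4::real) powr (3 / 2) = 8"
      proof -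
        have "(4::real) = 2 powr 2" by simp
        hence "(4::real) powr (3 / 2) = 2 powr 3" by (simp only: powr_powr) simp
        thus ?thesis by simp
      qed
      finally show ?thesis by simp
    qed
    have R\<sigma>2: "(R powr (- \<sigma>))\<^sup>2 \<le> 64 * \<tau>\<^sup>2"
      using power_mono[OF R\<sigma>, of 2] by (simp add: power_mult_distrib)
    have ul: "l2 u" "wnorm 0 u \<le> U" using in_l2w_imp_l2[OF u] \<sigma> by (auto simp: U_def)
    define u1 where "u1 = (\<lambda>n. if \<bar>real_of_int n\<bar> < R then u n else 0)"
    define u2 where "u2 = (\<lambda>n. if \<bar>real_of_int n\<bar> < R then 0 else u n)"
    have u2: "l2 u2" "wnorm 0 u2 \<le> R powr (- \<sigma>) * U"
      using l2_tail_bound[OF u _ _, of R u2] \<sigma> R by (auto simp: u2_def U_def)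
    have u1: "l2 u1" by (rule l2_finite_support[OF S(1)]) (use S(2) in \<open>auto simp: u1_def\<close>)
    have u12: "u = (\<lambda>n. u1 n + u2 n)" by (auto simp: u1_def u2_def)
    define w where "w n = (wt n) powr (2 * (- \<sigma>))" for n
    define v where "v = evol q t (PK u)"
    define v1 where "v1 = evol q t (PK u1)"
    define v2 where "v2 = evol q t (PK u2)"
    have v12: "v n = v1 n + v2 n" for n
      unfolding v_def v1_def v2_def by (subst u12) (rule evol_PK_add[OF u1 u2(1)])
    have w: "0 \<le> w n" "w n \<le> 1" for n
    proof -
      show "0 \<le> w n" by (simp add: w_def)
      have "w n \<le> (wt n) powr 0"
        unfolding w_def using \<sigma> by (intro powr_mono) auto
      thus "w n \<le> 1" using weight_pos[of n] by simp
    qed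
    have v1b: "cmod (v1 n) \<le> B * \<tau> * (wt n) * (sqrt S0 * U)" if n: "\<bar>real_of_int n\<bar> < R" for n
    proof -
      define S1 where "S1 = {m \<in> S. \<bar>real_of_int m\<bar> < R}"
      have fS1: "finite S1" using S(1) by (simp add: S1_def)
      have "v1 n = (\<Sum>m\<in>S1. u1 m * jK (phase t) n m)"
        unfolding v1_def by (rule evol_PK_finite_support[OF fS1]) (use S(2) in \<open>auto simp: u1_def S1_def\<close>)
      also have "cmod \<dots> \<le> (\<Sum>m\<in>S1. (B * \<tau> * (wt n)) * ((wt m) * cmod (u m)))"
      proof (rule order_trans[OF norm_sum], rule sum_mono)
        fix m assume m: "m \<in> S1"
        have "cmod (u1 m * jK (phase t) n m) \<le> 
           cmod (u m) * (B * t powr (- 3 / 2) * ((wt n) * (wt m)))"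
          unfolding norm_mult using m n B(2)[rule_format, OF t, of n m]
          by (intro mult_mono) (auto simp: S1_def u1_def R_def)
        thus "cmod (u1 m * jK (phase t) n m) \<le> 
           (B * \<tau> * (wt n)) * ((wt m) * cmod (u m))"
          by (simp add: \<tau>_def mult_ac)
      qed
      also have "\<dots> = (B * \<tau> * (wt n)) * (\<Sum>m\<in>S1. (wt m) * cmod (u m))"
        by (rule sum_distrib_left[symmetric])
      also have "\<dots> \<le> (B * \<tau> * (wt n)) * (sqrt S0 * U)"
        unfolding S0_def U_def using B(1) by (intro mult_left_mono weighted_l1_bound u \<sigma> fS1) (auto simp: \<tau>_def)
      finally show ?thesis .
    qed
    have near: "w n * (cmod (v n))\<^sup>2 \<le> 2 * (B\<^sup>2 * \<tau>\<^sup>2 * S0 * U\<^sup>2) * (wt n) powr (2 - 2 * \<sigma>) + 2 * (cmod (v2 n))\<^sup>2"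
      if n: "\<bar>real_of_int n\<bar> < R" for n
    proof -
      have "(cmod (v n))\<^sup>2 \<le> (cmod (v1 n) + cmod (v2 n))\<^sup>2" unfolding v12 by (intro power_mono norm_triangle_ineq) auto
      also have "\<dots> \<le> 2 * (cmod (v1 n))\<^sup>2 + 2 * (cmod (v2 n))\<^sup>2"
        using zero_le_power2[of "cmod (v1 n) - cmod (v2 n)"] by (simp add: power2_eq_square algebra_simps)
      also have "(cmod (v1 n))\<^sup>2 \<le> (B * \<tau> * (wt n) * (sqrt S0 * U))\<^sup>2"
        by (intro power_mono v1b n) auto
      also have "\<dots> = (B\<^sup>2 * \<tau>\<^sup>2 * S0 * U\<^sup>2) * (wt n)\<^sup>2"
        using S0 by (simp add: power_mult_distrib)
      finally have "w n * (cmod (v n))\<^sup>2 \<le> w n * (2 * ((B\<^sup>2 * \<tau>\<^sup>2 * S0 * U\<^sup>2) * (wt n)\<^sup>2) + 2 * (cmod (v2 n))\<^sup>2)"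
        using w by (intro mult_left_mono) auto
      also have "\<dots> = 2 * (B\<^sup>2 * \<tau>\<^sup>2 * S0 * U\<^sup>2) * (w n * (wt n)\<^sup>2) + w n * (2 * (cmod (v2 n))\<^sup>2)"
        by (simp add: algebra_simps)
      also have "w n * (wt n)\<^sup>2 = (wt n) powr (2 - 2 * \<sigma>)"
      proof -
        have e: "(wt n)\<^sup>2 = (wt n) powr 2" using weight_pos[of n] by simp
        show ?thesis unfolding w_def e powr_add[symmetric] by simp
      qed
      also have "w n * (2 * (cmod (v2 n))\<^sup>2) \<le> 1 * (2 * (cmod (v2 n))\<^sup>2)" using w by (intro mult_right_mono) auto
      finally show ?thesis by simp
    qed
    have far: "w n * (cmod (v n))\<^sup>2 \<le> 64 * \<tau>\<^sup>2 * (cmod (v n))\<^sup>2" if n: "\<not> \<bar>real_of_int n\<bar> < R" for n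
    proof (intro mult_right_mono)
      have "w n \<le> R powr (2 * (- \<sigma>))" unfolding w_def using n R \<sigma> by (intro powr_mono2') auto
      also have "\<dots> = (R powr (- \<sigma>))\<^sup>2" by (simp add: power2_eq_square flip: powr_add)
      finally show "w n \<le> 64 * \<tau>\<^sup>2" using R\<sigma>2 by linarith
    qed auto
    have v: "l2 v" "wnorm 0 v \<le> CK * U"
    proof -
      show "l2 v" unfolding v_def by (rule evol_PK_l2[OF ul(1)])
      have "wnorm 0 v \<le> CK * wnorm 0 u" unfolding v_def by (rule evol_PK_l2[OF ul(1)])
      also have "\<dots> \<le> CK * U" using CK_pos ul by (intro mult_left_mono) auto
      finally show "wnorm 0 v \<le> CK * U" .
    qed
    have v2: "l2 v2" "wnorm 0 v2 \<le> CK * (R powr (- \<sigma>) * U)"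
    proof -
      show "l2 v2" unfolding v2_def by (rule evol_PK_l2[OF u2(1)])
      have "wnorm 0 v2 \<le> CK * wnorm 0 u2" unfolding v2_def by (rule evol_PK_l2[OF u2(1)])
      also have "\<dots> \<le> CK * (R powr (- \<sigma>) * U)" using CK_pos u2 by (intro mult_left_mono) auto
      finally show "wnorm 0 v2 \<le> CK * (R powr (- \<sigma>) * U)" .
    qed
    have sq: "(\<Sum>n\<in>G. (cmod (x n))\<^sup>2) \<le> b\<^sup>2" if "finite G" "l2 x" "wnorm 0 x \<le> b" for G x b
    proof -
      have "(\<Sum>n\<in>G. (cmod (x n))\<^sup>2) \<le> (\<Sum>\<^sub>\<infinity>n. (cmod (x n))\<^sup>2)"
        using that by (intro finite_sum_le_infsum) (auto simp: l2_iff)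
      also have "\<dots> = (wnorm 0 x)\<^sup>2" by (rule wnorm_0_sq[symmetric])
      also have "\<dots> \<le> b\<^sup>2" using that wnorm_nonneg by (intro power_mono) auto
      finally show ?thesis .
    qed
    define F1 where "F1 = {n \<in> F. \<bar>real_of_int n\<bar> < R}"
    define F2 where "F2 = {n \<in> F. \<not> \<bar>real_of_int n\<bar> < R}"
    have F12: "finite F1" "finite F2" "F = F1 \<union> F2" "F1 \<inter> F2 = {}" using F by (auto simp: F1_def F2_def)
    have "(\<Sum>n\<in>F1. w n * (cmod (v n))\<^sup>2) \<le> (\<Sum>n\<in>F1. 2 * (B\<^sup>2 * \<tau>\<^sup>2 * S0 * U\<^sup>2) * (wt n) powr (2 - 2 * \<sigma>) + 2 * (cmod (v2 n))\<^sup>2)"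
      by (intro sum_mono near) (auto simp: F1_def)
    also have "\<dots> = 2 * (B\<^sup>2 * \<tau>\<^sup>2 * S0 * U\<^sup>2) * (\<Sum>n\<in>F1. (wt n) powr (2 - 2 * \<sigma>)) + 2 * (\<Sum>n\<in>F1. (cmod (v2 n))\<^sup>2)"
      by (simp only: sum.distrib sum_distrib_left)
    also have "\<dots> \<le> 2 * (B\<^sup>2 * \<tau>\<^sup>2 * S0 * U\<^sup>2) * S0 + 2 * (CK * (R powr (- \<sigma>) * U))\<^sup>2"
    proof (intro add_mono mult_left_mono)
      show "(\<Sum>n\<in>F1. (wt n) powr (2 - 2 * \<sigma>)) \<le> S0"
        unfolding S0_def using \<sigma> F12 by (intro finite_sum_le_infsum weight_powr_summable) auto
      show "(\<Sum>n\<in>F1. (cmod (v2 n))\<^sup>2) \<le> (CK * (R powr (- \<sigma>) * U))\<^sup>2" by (rule sq[OF F12(1) v2])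
    qed (use S0 in auto)
    also have "(CK * (R powr (- \<sigma>) * U))\<^sup>2 \<le> CK\<^sup>2 * (64 * \<tau>\<^sup>2 * U\<^sup>2)"
      unfolding power_mult_distrib by (intro mult_left_mono mult_right_mono R\<sigma>2) auto
    finally have 1: "(\<Sum>n\<in>F1. w n * (cmod (v n))\<^sup>2) \<le> 2 * (B\<^sup>2 * \<tau>\<^sup>2 * S0 * U\<^sup>2) * S0 + 2 * (CK\<^sup>2 * (64 * \<tau>\<^sup>2 * U\<^sup>2))" by simp
    have "(\<Sum>n\<in>F2. w n * (cmod (v n))\<^sup>2) \<le> (\<Sum>n\<in>F2. 64 * \<tau>\<^sup>2 * (cmod (v n))\<^sup>2)"
      by (intro sum_mono far) (auto simp: F2_def)
    also have "\<dots> = 64 * \<tau>\<^sup>2 * (\<Sum>n\<in>F2. (cmod (v n))\<^sup>2)" by (rule sum_distrib_left[symmetric])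
    also have "\<dots> \<le> 64 * \<tau>\<^sup>2 * (CK * U)\<^sup>2" by (intro mult_left_mono sq[OF F12(2) v]) auto
    finally have 2: "(\<Sum>n\<in>F2. w n * (cmod (v n))\<^sup>2) \<le> 64 * \<tau>\<^sup>2 * (CK * U)\<^sup>2" .
    have "(\<Sum>n\<in>F. w n * (cmod (v n))\<^sup>2) = (\<Sum>n\<in>F1. w n * (cmod (v n))\<^sup>2) + (\<Sum>n\<in>F2. w n * (cmod (v n))\<^sup>2)"
      unfolding F12(3) by (rule sum.union_disjoint[OF F12(1,2,4)])
    also have "\<dots> \<le> C2 * (\<tau> * U)\<^sup>2"
      using add_mono[OF 1 2] by (simp add: C2_def power_mult_distrib power2_eq_square algebra_simps)
    finally show ?thesis unfolding w_def v_def \<tau>_def U_def .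
  qed
  show ?thesis
  proof (intro exI[of _ "sqrt C2"] conjI allI impI)
    fix t :: real and u :: "int \<Rightarrow> complex" and S F :: "int set"
    assume a: "t \<ge> 4" "finite S" "\<forall>n. n \<notin> S \<longrightarrow> u n = 0" "in_l2w \<sigma> u" "finite F"
    have "(sqrt C2 * t powr (- 3 / 2) * wnorm \<sigma> u)\<^sup>2 = C2 * (t powr (- 3 / 2) * wnorm \<sigma> u)\<^sup>2"
      using C2 by (simp add: power_mult_distrib)
    thus "(\<Sum>n\<in>F. (wt n) powr (2 * (- \<sigma>)) * (cmod (evol q t (PK u) n))\<^sup>2) \<le> (sqrt C2 * t powr (- 3 / 2) * wnorm \<sigma> u)\<^sup>2"
      using main[OF a] by simp
  qed (use C2 in auto)
qed

text \<open>Truncations of \<open>u\<close> converge in \<open>l2\<close>, hence their evolutions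
  converge at each site. The estimate over a finite set of sites has a constant independent of the
  truncation and passes to the limit.\<close>

lemma decay:
  assumes \<sigma>: "\<sigma> > 3 / 2"
  shows "\<exists>C\<ge>0. \<forall>t u. t \<ge> 4 \<longrightarrow> in_l2w \<sigma> u \<longrightarrow>
    in_l2w (- \<sigma>) (evol q t (PK u)) \<and> wnorm (- \<sigma>) (evol q t (PK u)) \<le> C * t powr (- 3 / 2) * wnorm \<sigma> u"
proof -
  obtain C where C: "C \<ge> 0" "\<forall>t u S F. t \<ge> 4 \<longrightarrow> finite S \<longrightarrow> (\<forall>n. n \<notin> S \<longrightarrow> u n = 0) \<longrightarrow> in_l2w \<sigma> u \<longrightarrow> finite F \<longrightarrow>
    (\<Sum>n\<in>F. (wt n) powr (2 * (- \<sigma>)) * (cmod (evol q t (PK u) n))\<^sup>2) \<le> (C * t powr (- 3 / 2) * wnorm \<sigma> u)\<^sup>2"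
    using decay_finite_support[OF \<sigma>] by auto
  have "in_l2w (- \<sigma>) (evol q t (PK u)) \<and> wnorm (- \<sigma>) (evol q t (PK u)) \<le> C * t powr (- 3 / 2) * wnorm \<sigma> u"
    if t: "t \<ge> 4" and u: "in_l2w \<sigma> u" for t u
  proof -
    have ul: "l2 u" using in_l2w_imp_l2[OF u] \<sigma> by auto
    define a where "a N n = (if \<bar>real_of_int n\<bar> < real (Suc N) then u n else 0)" for N n
    define b where "b N n = (if \<bar>real_of_int n\<bar> < real (Suc N) then 0 else u n)" for N n
    have b: "l2 (b N)" "wnorm 0 (b N) \<le> real (Suc N) powr (- \<sigma>) * wnorm \<sigma> u" for N
      using l2_tail_bound[OF u _ _, of "real (Suc N)" "b N"] \<sigma> by (auto simp: b_def)
    have a: "in_l2w \<sigma> (a N)" "wnorm \<sigma> (a N) \<le> wnorm \<sigma> u" for N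
      using in_l2w_mono[OF u, of "a N"] by (auto simp: a_def)
    have al: "l2 (a N)" for N using in_l2w_imp_l2[OF a(1)] \<sigma> by auto
    have ab: "u = (\<lambda>n. a N n + b N n)" for N by (auto simp: a_def b_def)
    have lim: "(\<lambda>N. evol q t (PK (a N)) n) \<longlonglongrightarrow> evol q t (PK u) n" for n
    proof -
      have le: "norm (evol q t (PK (a N)) n - evol q t (PK u) n) \<le> CK * (real (Suc N) powr (- \<sigma>) * wnorm \<sigma> u)" for N
      proof -
        have "evol q t (PK u) n = evol q t (PK (a N)) n + evol q t (PK (b N)) n"
          by (subst ab[of N]) (rule evol_PK_add[OF al b(1)])
        hence "norm (evol q t (PK (a N)) n - evol q t (PK u) n) = norm (evol q t (PK (b N)) n)" by simp
        also have "\<dots> \<le> wnorm 0 (evol q t (PK (b N)))" by (intro cmod_le_wnorm_0 evol_PK_l2 b)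
        also have "\<dots> \<le> CK * wnorm 0 (b N)" by (intro evol_PK_l2 b)
        also have "\<dots> \<le> CK * (real (Suc N) powr (- \<sigma>) * wnorm \<sigma> u)" using CK_pos by (intro mult_left_mono b) auto
        finally show ?thesis .
      qed
      have "(\<lambda>N. real N powr (- \<sigma>)) \<longlonglongrightarrow> 0"
        using \<sigma> by (intro tendsto_neg_powr filterlim_real_sequentially) auto
      from LIMSEQ_Suc[OF this] have "(\<lambda>N. CK * (real (Suc N) powr (- \<sigma>) * wnorm \<sigma> u)) \<longlonglongrightarrow> CK * (0 * wnorm \<sigma> u)"
        by (intro tendsto_intros)
      hence "(\<lambda>N. evol q t (PK (a N)) n - evol q t (PK u) n) \<longlonglongrightarrow> 0"
        by (intro Lim_null_comparison[OF always_eventually[OF allI[OF le]]]) simp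
      thus ?thesis by (simp add: LIM_zero_iff)
    qed
    have fin: "(\<Sum>n\<in>F. (wt n) powr (2 * (- \<sigma>)) * (cmod (evol q t (PK u) n))\<^sup>2) \<le> (C * t powr (- 3 / 2) * wnorm \<sigma> u)\<^sup>2"
      if F: "finite F" for F
    proof (rule LIMSEQ_le_const2)
      show "(\<lambda>N. \<Sum>n\<in>F. (wt n) powr (2 * (- \<sigma>)) * (cmod (evol q t (PK (a N)) n))\<^sup>2) \<longlonglongrightarrow> 
         (\<Sum>n\<in>F. (wt n) powr (2 * (- \<sigma>)) * (cmod (evol q t (PK u) n))\<^sup>2)"
        by (intro tendsto_intros lim)
      have "(\<Sum>n\<in>F. (wt n) powr (2 * (- \<sigma>)) * (cmod (evol q t (PK (a N)) n))\<^sup>2) \<le> (C * t powr (- 3 / 2) * wnorm \<sigma> u)\<^sup>2" for N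
      proof -
        have fs: "finite {- int (Suc N)..int (Suc N)}" by simp
        have z: "\<forall>n. n \<notin> {- int (Suc N)..int (Suc N)} \<longrightarrow> a N n = 0" by (auto simp: a_def)
        have "(\<Sum>n\<in>F. (wt n) powr (2 * (- \<sigma>)) * (cmod (evol q t (PK (a N)) n))\<^sup>2) \<le> (C * t powr (- 3 / 2) * wnorm \<sigma> (a N))\<^sup>2"
          by (rule C(2)[rule_format, OF t fs z[rule_format] a(1) F])
        also have "\<dots> \<le> (C * t powr (- 3 / 2) * wnorm \<sigma> u)\<^sup>2"
          using C(1) a(2)[of N] wnorm_nonneg by (intro power_mono mult_left_mono mult_nonneg_nonneg) auto
        finally show ?thesis .
      qed
      thus "\<exists>N. \<forall>n\<ge>N. (\<Sum>na\<in>F. (wt na) powr (2 * (- \<sigma>)) * (cmod (evol q t (PK (a n)) na))\<^sup>2) \<le> (C * t powr (- 3 / 2) * wnorm \<sigma> u)\<^sup>2"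
        by blast
    qed
    have "0 \<le> C * t powr (- 3 / 2) * wnorm \<sigma> u" using C(1) wnorm_nonneg by (intro mult_nonneg_nonneg) auto
    from in_l2wI_finite_sums[OF this fin] show ?thesis by blast
  qed
  thus ?thesis using C(1) by (intro exI[of _ C]) blast
qed

text \<open>The evolution only multiplies \<open>l2inner (PK u) \<phi>\<close> by a phase, while \<open>evol q t (PK u)\<close> tends weakly to \<open>0\<close>.\<close>

lemma PK_orthogonal:
  assumes \<sigma>: "\<sigma> > 3 / 2" and u: "in_l2w \<sigma> u" and phi: "eigvec q \<phi>"
  shows "l2inner (PK u) \<phi> = 0"
proof -
  obtain C where C: "C \<ge> 0" "\<forall>t u. t \<ge> 4 \<longrightarrow> in_l2w \<sigma> u \<longrightarrow>
    in_l2w (- \<sigma>) (evol q t (PK u)) \<and> wnorm (- \<sigma>) (evol q t (PK u)) \<le> C * t powr (- 3 / 2) * wnorm \<sigma> u"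
    using decay[OF \<sigma>] by auto
  have ul: "l2 u" using in_l2w_imp_l2[OF u] \<sigma> by auto
  have pl: "l2 \<phi>" using phi by (simp add: eigvec_def)
  define v where "v t = evol q t (PK u)" for t
  have vl: "l2 (v t)" "wnorm 0 (v t) \<le> CK * wnorm 0 u" for t
    unfolding v_def by (rule evol_PK_l2[OF ul])+
  have const: "cmod (l2inner (v t) \<phi>) = cmod (l2inner (PK u) \<phi>)" for t
    unfolding v_def by (rule evol_eigvec[where q=q, OF PK_l2(1)[OF ul] Q phi])
  have pointwise: "((\<lambda>t. v t n) \<longlongrightarrow> 0) at_top" for n
  proof (rule Lim_null_comparison)
    define K where "K = (wt n) powr \<sigma> * (C * wnorm \<sigma> u)"
    show "eventually (\<lambda>t. norm (v t n) \<le> K * t powr (- 3 / 2)) at_top"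
      using eventually_ge_at_top[of 4]
    proof eventually_elim
      case (elim t)
      have w: "in_l2w (- \<sigma>) (v t)" "wnorm (- \<sigma>) (v t) \<le> C * t powr (- 3 / 2) * wnorm \<sigma> u"
        using C(2)[rule_format, OF elim u] by (auto simp: v_def)
      define x where "x = (wt n) powr (- \<sigma>) * cmod (v t n)"
      have "x\<^sup>2 = (\<Sum>n\<in>{n}. (wt n) powr (2 * (- \<sigma>)) * (cmod (v t n))\<^sup>2)"
        by (simp add: x_def power_mult_distrib power2_eq_square flip: powr_add)
      also have "\<dots> \<le> (wnorm (- \<sigma>) (v t))\<^sup>2" by (rule finite_sum_le_wnorm_sq[OF w(1)]) simp
      finally have "x \<le> wnorm (- \<sigma>) (v t)" using wnorm_nonneg power2_le_imp_le by blast
      hence x: "x \<le> C * t powr (- 3 / 2) * wnorm \<sigma> u" using w(2) by linarith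
      have "(wt n) powr \<sigma> * (wt n) powr (- \<sigma>) = 1"
        using weight_pos[of n] by (simp flip: powr_add)
      hence "cmod (v t n) = (wt n) powr \<sigma> * x" by (simp add: x_def mult.assoc[symmetric])
      also have "\<dots> \<le> (wt n) powr \<sigma> * (C * t powr (- 3 / 2) * wnorm \<sigma> u)"
        by (intro mult_left_mono x) auto
      finally show ?case by (simp add: K_def mult_ac)
    qed
    have "((\<lambda>t::real. t powr (- 3 / 2)) \<longlongrightarrow> 0) at_top"
      by (rule tendsto_neg_powr[OF _ filterlim_ident]) simp
    from tendsto_mult_right_zero[OF this, of K] show "((\<lambda>t. K * t powr (- 3 / 2)) \<longlongrightarrow> 0) at_top" .
  qed
  have small: "cmod (l2inner (PK u) \<phi>) \<le> (CK * wnorm 0 u) * \<epsilon>" if e: "\<epsilon> > 0" for \<epsilon>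
  proof -
    \<comment> \<open>Weak convergence from pointwise convergence: on the finite set
      \<open>F\<close> the decay acts, off \<open>F\<close> the uniform norm bound is multiplied by
      the small tail of \<phi>.\<close>
    obtain F where F: "finite F" "wnorm 0 (\<lambda>n. if n \<in> F then 0 else \<phi> n) \<le> \<epsilon>"
      using l2_finite_tail[OF pl e] by auto
    define \<phi>2 where "\<phi>2 = (\<lambda>n. if n \<in> F then 0 else \<phi> n)"
    define \<phi>1 where "\<phi>1 = (\<lambda>n. if n \<in> F then \<phi> n else 0)"
    have l1: "l2 \<phi>1" by (rule l2_finite_support[OF F(1)]) (simp add: \<phi>1_def)
    have l2': "l2 \<phi>2" by (rule l2_mono(1)[OF pl, of 1]) (auto simp: \<phi>2_def)
    have p12: "\<phi> = (\<lambda>n. \<phi>1 n + \<phi>2 n)" by (auto simp: \<phi>1_def \<phi>2_def)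
    have i1: "l2inner (v t) \<phi>1 = (\<Sum>n\<in>F. v t n * cnj (\<phi> n))" for t
    proof -
      have "l2inner (v t) \<phi>1 = (\<Sum>\<^sub>\<infinity>n\<in>F. v t n * cnj (\<phi> n))"
        unfolding l2inner_def by (rule infsum_cong_neutral) (auto simp: \<phi>1_def)
      thus ?thesis using F(1) by simp
    qed
    have i2: "cmod (l2inner (v t) \<phi>2) \<le> (CK * wnorm 0 u) * \<epsilon>" for t
    proof -
      have "cmod (l2inner (v t) \<phi>2) \<le> wnorm 0 (v t) * wnorm 0 \<phi>2" by (rule l2inner_bound[OF vl(1) l2'])
      also have "\<dots> \<le> (CK * wnorm 0 u) * \<epsilon>"
        using vl(2)[of t] F(2) wnorm_nonneg CK_pos unfolding \<phi>2_def by (intro mult_mono mult_nonneg_nonneg) auto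
      finally show ?thesis .
    qed
    have le: "cmod (l2inner (PK u) \<phi>) \<le> cmod (\<Sum>n\<in>F. v t n * cnj (\<phi> n)) + (CK * wnorm 0 u) * \<epsilon>" for t
    proof -
      have "l2inner (v t) \<phi> = l2inner (v t) \<phi>1 + l2inner (v t) \<phi>2"
        by (subst p12) (rule l2inner_add_right[OF l1 l2' vl(1)])
      hence "cmod (l2inner (v t) \<phi>) \<le> cmod (l2inner (v t) \<phi>1) + cmod (l2inner (v t) \<phi>2)" by (simp add: norm_triangle_ineq)
      thus ?thesis using i2[of t] unfolding i1 const by linarith
    qed
    have "((\<lambda>t. cmod (\<Sum>n\<in>F. v t n * cnj (\<phi> n)) + (CK * wnorm 0 u) * \<epsilon>) \<longlongrightarrow> cmod (\<Sum>n\<in>F. 0 * cnj (\<phi> n)) + (CK * wnorm 0 u) * \<epsilon>) at_top"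
      by (intro tendsto_intros pointwise)
    from tendsto_lowerbound[OF this, of "cmod (l2inner (PK u) \<phi>)"] le show ?thesis by simp
  qed
  have "cmod (l2inner (PK u) \<phi>) \<le> 0 + e" if "e > 0" for e
  proof -
    have K: "CK * wnorm 0 u \<ge> 0" using CK_pos wnorm_nonneg[of 0 u] by (intro mult_nonneg_nonneg) auto
    have "cmod (l2inner (PK u) \<phi>) \<le> (CK * wnorm 0 u) * (e / (1 + CK * wnorm 0 u))"
      by (rule small) (use that K in \<open>auto intro!: divide_pos_pos\<close>)
    also have "\<dots> \<le> e" using that K by (simp add: field_simps)
    finally show ?thesis by simp
  qed
  hence "cmod (l2inner (PK u) \<phi>) \<le> 0" by (rule field_le_epsilon)
  thus ?thesis by simp
qed

text \<open>The restriction to the weighted space is inherited from \<open>PK_orthogonal\<close>,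
  which argues through the decay estimate.\<close>

lemma Pc_eq_PK:
  assumes "\<sigma> > 3 / 2" "in_l2w \<sigma> u"
  shows "Pc q u = PK u"
proof (rule Pc_eqI)
  have u: "l2 u" using in_l2w_imp_l2[OF assms(2)] assms(1) by auto
  show "l2 (PK u)" "(\<lambda>n. u n - PK u n) \<in> pp_space q" by (intro PK_l2 PK_pp_space u)+
qed (rule PK_orthogonal[OF assms])

end

theorem theorem6p4:
  fixes q :: "int \<Rightarrow> real" and \<sigma> :: real
  assumes "(\<lambda>n. (1 + \<bar>real_of_int n\<bar>)\<^sup>2 * \<bar>q n\<bar>) summable_on UNIV"
    and "\<not> resonance q 0" and "\<not> resonance q 4"
    and "\<sigma> > 3 / 2"
  shows "\<exists>C. \<forall>\<^sub>F t in at_top. \<forall>u. in_l2w \<sigma> u \<longrightarrow>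
           in_l2w (- \<sigma>) (evol q t (Pc q u)) \<and>
           wnorm (- \<sigma>) (evol q t (Pc q u)) \<le> C * t powr (- 3 / 2) * wnorm \<sigma> u"
proof -
  interpret nonresonant q
    by unfold_locales (use assms in \<open>auto simp: decaying_def\<close>)
  obtain C where C: "\<forall>t u. t \<ge> 4 \<longrightarrow> in_l2w \<sigma> u \<longrightarrow>
    in_l2w (- \<sigma>) (evol q t (PK u)) \<and> wnorm (- \<sigma>) (evol q t (PK u)) \<le> C * t powr (- 3 / 2) * wnorm \<sigma> u"
    using decay[OF assms(4)] by auto
  show ?thesis
  proof (rule exI[of _ C])
    show "\<forall>\<^sub>F t in at_top. \<forall>u. in_l2w \<sigma> u \<longrightarrow>
           in_l2w (- \<sigma>) (evol q t (Pc q u)) \<and>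
           wnorm (- \<sigma>) (evol q t (Pc q u)) \<le> C * t powr (- 3 / 2) * wnorm \<sigma> u"
      using eventually_ge_at_top[of 4]
    proof eventually_elim
      case (elim t)
      show ?case using C[rule_format, OF elim] Pc_eq_PK[OF assms(4)] by simp
    qed
  qed
qed

end
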